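(* Let $d\ge 1$. There exists a dense $G_\delta$ set $\mathcal{G}\subseteq C([0,1]^d)$ such that for every $f\in\mathcal{G}$ and for $i=1,2$ the following hold: \begin{itemize} \item $\varphi_{i,f}$ is continuously differentiable on $(0,1)^d$; \item if $\mathbf{x}\in\partial([0,1]^d)$ then $h_{\varphi_{i,f}}(\mathbf{x})=0$; hence $d_{\varphi_{i,f}}(0)=d-1$; and $\mathbf{E}^{0}_{\varphi_{i,f}}\cap(0,1)^d=\emptyset$; \item $d_{\varphi_{i,f}}(1)=d-1$; \item $d_{\varphi_{i,f}}(+\infty)=d$; \item $d_{\varphi_{i,f}}(h)=-\infty$, that is, $\mathbf{E}^{h}_{\varphi_{i,f}}=\emptyset$, for every $h\in(0,+\infty)\setminus\{1\}$; \item for $j=1,\dots,d$: if $\mathbf{x}\in F_{0,j}$ then $\partial_{j,+}\varphi_{i,f}(\mathbf{x})=(-1)^{i+1}(+\infty)$, and if $\mathbf{x}\in F_{1,j}$ then $\partial_{j,-}\varphi_{i,f}(\mathbf{x})=(-1)^{i}(+\infty)$; \item $\dim_H E_{i,f}=0$. \end{itemize}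
   Context: $C([0,1]^d)$ is the space of continuous functions $f:[0,1]^d\to\mathbb{R}$ with the supremum metric. $\partial([0,1]^d)$ denotes the boundary of the cube in $\mathbb{R}^d$, and $\dim_H$ denotes Hausdorff dimension, with the convention $\dim_H\emptyset=-\infty$. For $f\in C([0,1]^d)$ let $H_f\subset\mathbb{R}^{d+1}$ be the convex hull of the graph $\{(\mathbf{x},f(\mathbf{x})):\mathbf{x}\in[0,1]^d\}$. For $\mathbf{x}\in[0,1]^d$ put $\varphi_{1,f}(\mathbf{x})=\max\{y:(\mathbf{x},y)\in H_f\}$ and $\varphi_{2,f}(\mathbf{x})=\min\{y:(\mathbf{x},y)\in H_f\}$. For $i=1,2$ let $E_{i,f}=\{\mathbf{x}\in[0,1]^d:\varphi_{i,f}(\mathbf{x})=f(\mathbf{x})\}$. Pointwise Hölder exponent: for a bounded function $g:[0,1]^d\to\mathbb{R}$, $h\ge 0$ and $\mathbf{x}\in[0,1]^d$, we say $g\in C^h_{\mathbf{x}}$ if there are a polynomial $P$ (in $d$ variables) of degree at most $[h]$ (the integer part of $h$) and a constant $C$ such that $|g(\mathbf{x}')-P(\mathbf{x}'-\mathbf{x})|\le C|\mathbf{x}'-\mathbf{x}|^h$ for all $\mathbf{x}'\in[0,1]^d$ close to $\mathbf{x}$. The pointwise Hölder exponent is $h_g(\mathbf{x})=\sup\{h\ge0: g\in C^h_{\mathbf{x}}\}\in[0,+\infty]$. For $h\in[0,+\infty]$ put $\mathbf{E}^h_g=\{\mathbf{x}\in[0,1]^d:h_g(\mathbf{x})=h\}$.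 The singularity spectrum of $g$ is $d_g(h)=\dim_H\mathbf{E}^h_g$. Faces: for $j=1,\dots,d$, $F_{0,j}=\{(x_1,\dots,x_d)\in[0,1]^d:x_j=0\}$ and $F_{1,j}=\{(x_1,\dots,x_d)\in[0,1]^d:x_j=1\}$. With $\mathbf{e}_j$ the $j$-th standard basis vector, $\partial_{j,\pm}g(\mathbf{x})=\lim_{t\to0\pm}\frac{g(\mathbf{x}+t\mathbf{e}_j)-g(\mathbf{x})}{t}$ denote the one-sided partial derivatives (values $\pm\infty$ allowed). The expression $(-1)^k(+\infty)$ means $+\infty$ if $k$ is even and $-\infty$ if $k$ is odd. *)

theory Defs
  imports "HOL-Analysis.Analysis"
begin

abbreviation unit_cube :: "(real ^ 'n::finite) set" where
  "unit_cube \<equiv> cbox 0 1"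

abbreviation open_unit_cube :: "(real ^ 'n::finite) set" where
  "open_unit_cube \<equiv> box 0 1"

text \<open>Elements of the library's metric space of continuous functions are extensional:
  they take the value \<open>undefined\<close> outside the cube.\<close>

abbreviation C_cube :: "(real ^ 'n::finite \<Rightarrow> real) metric" where
  "C_cube \<equiv> cfunspace (top_of_set unit_cube) euclidean_metric"

abbreviation C_cube_topology :: "(real ^ 'n::finite \<Rightarrow> real) topology" where
  "C_cube_topology \<equiv> mtopology_of C_cube"


section \<open>Hausdorff dimension\<close>

text \<open>The case \<open>s = 0\<close> is separated because \<open>0 powr 0 = 0\<close>; a nonempty set, singletons
  included, has zeroth gauge 1.\<close>

definition hausdorff_gauge :: "real \<Rightarrow> 'a::metric_space set \<Rightarrow> ennreal" where
  "hausdorff_gauge s U =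
     (if U = {} then 0 else if s = 0 then 1 else ennreal (diameter U powr s))"

text \<open>Boundedness is required explicitly since \<open>diameter\<close> has an unspecified value on
  unbounded sets.\<close>

definition hausdorff_content :: "real \<Rightarrow> real \<Rightarrow> 'a::metric_space set \<Rightarrow> ennreal" where
  "hausdorff_content \<delta> s A =
     (INF U \<in> {U :: nat \<Rightarrow> 'a set. A \<subseteq> (\<Union>k. U k) \<and> (\<forall>k. bounded (U k) \<and> diameter (U k) \<le> \<delta>)}.
        \<Sum>k. hausdorff_gauge s (U k))"

definition hausdorff_measure :: "real \<Rightarrow> 'a::metric_space set \<Rightarrow> ennreal" where
  "hausdorff_measure s A = (SUP \<delta> \<in> {0<..}. hausdorff_content \<delta> s A)"

definition hausdorff_dim :: "'a::metric_space set \<Rightarrow> ereal" where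
  "hausdorff_dim A =
     (if A = {} then -\<infinity> else Inf {ereal s | s. s \<ge> 0 \<and> hausdorff_measure s A = 0})"


section \<open>Convex hull of the graph\<close>

definition graph_hull :: "(real ^ 'n::finite \<Rightarrow> real) \<Rightarrow> ((real ^ 'n) \<times> real) set" where
  "graph_hull f = convex hull ((\<lambda>x. (x, f x)) ` unit_cube)"

text \<open>The upper envelope is \<open>envelope 1 f\<close>, the lower one \<open>envelope 2 f\<close>.\<close>

definition envelope :: "nat \<Rightarrow> (real ^ 'n::finite \<Rightarrow> real) \<Rightarrow> real ^ 'n \<Rightarrow> real" where
  "envelope i f x =
     (if i = 1 then (GREATEST y. (x, y) \<in> graph_hull f)
      else (LEAST y. (x, y) \<in> graph_hull f))"

definition contact_set :: "nat \<Rightarrow> (real ^ 'n::finite \<Rightarrow> real) \<Rightarrow> (real ^ 'n) set" where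
  "contact_set i f = {x \<in> unit_cube. envelope i f x = f x}"


section \<open>Pointwise Hoelder exponents and the singularity spectrum\<close>

text \<open>A polynomial in the coordinates of \<open>z\<close> of total degree at most \<open>n\<close>, with coefficient
  \<open>c \<alpha>\<close> at the multi-index \<open>\<alpha>\<close>.\<close>

definition mpoly_eval :: "nat \<Rightarrow> (('n::finite \<Rightarrow> nat) \<Rightarrow> real) \<Rightarrow> real ^ 'n \<Rightarrow> real" where
  "mpoly_eval n c z =
     (\<Sum>\<alpha> | (\<Sum>k\<in>UNIV. \<alpha> k) \<le> n. c \<alpha> * (\<Prod>k\<in>UNIV. (z $ k) ^ \<alpha> k))"

lemma finite_multi_indices: "finite {\<alpha> :: 'n::finite \<Rightarrow> nat. (\<Sum>k\<in>UNIV. \<alpha> k) \<le> n}"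
proof (rule finite_subset)
  show "{\<alpha> :: 'n \<Rightarrow> nat. (\<Sum>k\<in>UNIV. \<alpha> k) \<le> n} \<subseteq> (UNIV \<rightarrow>\<^sub>E {..n})"
  proof (clarsimp simp: PiE_UNIV_domain)
    fix \<alpha> :: "'n \<Rightarrow> nat" and k
    assume "(\<Sum>k\<in>UNIV. \<alpha> k) \<le> n"
    moreover have "\<alpha> k \<le> (\<Sum>k\<in>UNIV. \<alpha> k)"
      by (rule member_le_sum) auto
    ultimately show "\<alpha> k \<le> n" by linarith
  qed
qed (auto intro: finite_PiE)

text \<open>For \<open>h = 0\<close> the convention \<open>0 powr 0 = 0\<close> only forces \<open>c 0 = g x\<close> at \<open>x' = x\<close>; the
  condition still means that \<open>g\<close> is bounded near \<open>x\<close>.\<close>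

definition pointwise_hoelder ::
  "(real ^ 'n::finite \<Rightarrow> real) \<Rightarrow> real \<Rightarrow> real ^ 'n \<Rightarrow> bool" where
  "pointwise_hoelder g h x \<longleftrightarrow>
     (\<exists>c C. \<forall>\<^sub>F x' in nhds x. x' \<in> unit_cube \<longrightarrow>
        \<bar>g x' - mpoly_eval (nat \<lfloor>h\<rfloor>) c (x' - x)\<bar> \<le> C * norm (x' - x) powr h)"

definition hoelder_exponent :: "(real ^ 'n::finite \<Rightarrow> real) \<Rightarrow> real ^ 'n \<Rightarrow> ereal" where
  "hoelder_exponent g x = Sup {ereal h | h. h \<ge> 0 \<and> pointwise_hoelder g h x}"

definition iso_hoelder_set :: "(real ^ 'n::finite \<Rightarrow> real) \<Rightarrow> ereal \<Rightarrow> (real ^ 'n) set" where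
  "iso_hoelder_set g h = {x \<in> unit_cube. hoelder_exponent g x = h}"

definition singularity_spectrum :: "(real ^ 'n::finite \<Rightarrow> real) \<Rightarrow> ereal \<Rightarrow> ereal" where
  "singularity_spectrum g h = hausdorff_dim (iso_hoelder_set g h)"


section \<open>Differentiability and faces\<close>

definition continuously_differentiable_on ::
  "('a::real_normed_vector \<Rightarrow> 'b::real_normed_vector) \<Rightarrow> 'a set \<Rightarrow> bool" where
  "continuously_differentiable_on g S \<longleftrightarrow>
     (\<exists>g' :: 'a \<Rightarrow> 'a \<Rightarrow>\<^sub>L 'b.
        (\<forall>x\<in>S. (g has_derivative blinfun_apply (g' x)) (at x)) \<and> continuous_on S g')"

text \<open>\<open>has_one_sided_partial g j F x L\<close> with \<open>F = at_right 0\<close> or \<open>F = at_left 0\<close> says that the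
  right or left partial derivative of \<open>g\<close> in direction \<open>j\<close> at \<open>x\<close> exists in the extended
  reals and equals \<open>L\<close>.\<close>

definition has_one_sided_partial ::
  "(real ^ 'n::finite \<Rightarrow> real) \<Rightarrow> 'n \<Rightarrow> real filter \<Rightarrow> real ^ 'n \<Rightarrow> ereal \<Rightarrow> bool" where
  "has_one_sided_partial g j F x L \<longleftrightarrow>
     ((\<lambda>t. ereal ((g (x + t *\<^sub>R axis j 1) - g x) / t)) \<longlongrightarrow> L) F"

definition cube_face :: "real \<Rightarrow> 'n::finite \<Rightarrow> (real ^ 'n) set" where
  "cube_face a j = {x \<in> unit_cube. x $ j = a}"

end

theory Submission
  imports Defs
begin

text \<open>Write \<open>\<phi>\<close> for the upper envelope; the lower one is \<open>-\<phi>\<close> for \<open>-f\<close>. Three kinds of conditions on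
  \<open>f\<close> hold on open dense sets, hence generically at infinitely many scales.

  Steepness: \<open>f\<close> increases by \<open>t powr (1 / n)\<close> over a distance \<open>t\<close> from the faces. Hull points over
  a face are combinations of graph points over that face, so \<open>\<phi>\<close> inherits this, and concavity gives
  infinite one-sided derivatives and exponent 0 on the boundary.

  Smoothness: second differences of \<open>f\<close> at scale \<open>t\<close> are at least \<open>- t / n\<close>. Two supergradients of
  \<open>\<phi>\<close> at an interior point \<open>x\<close> would both touch \<open>f\<close> at a common contact point, in the interior by
  steepness, and would give a second difference of order \<open>- t\<close> there. So \<open>\<phi>\<close> is \<open>C\<^sup>1\<close>.

  Polyhedrality: \<open>f\<close> is extremely close to a function whose envelope is the polyhedral envelope of
  finitely many points in general position and which touches it only there. Contact points then
  lie near these points, \<open>\<phi>\<close> is affine off a tiny neighbourhood of the skeleton of codimension 1, and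
  near the skeleton \<open>\<phi>\<close> has second differences of order \<open>- r\<close> at a scale \<open>r\<close>, which excludes
  exponents above 1. Since every line parallel to an axis meets the set where \<open>\<phi>\<close> is not locally
  affine (the slope at its end is infinite), that set has dimension at least \<open>d - 1\<close>.\<close>

section \<open>Supergradients of concave functions\<close>

text \<open>Moving \<open>f\<close> by \<delta> in the supremum norm moves its envelope by at most
  \<delta>, but says nothing about slopes. Steepness, smoothness and bends are therefore
  inequalities between values at one scale fixed in advance, with slack for the perturbation;
  required for every \<open>n\<close>, they recur at arbitrarily small scales. Concavity turns such
  isolated scales into limits: quotients taken from a boundary point only grow as the step shrinks,
  and a kink has second differences of order \<open>- t\<close> at every small \<open>t\<close>.

  The exponents \<open>1 / Suc n\<close> and \<open>1 + 1 / Suc n\<close> approach the critical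
  orders 0 and 1, so each larger order is refuted for large \<open>n\<close>. Second differences are
  used above order 1 because they cancel the affine part of the comparison polynomial and leave a
  quadratic remainder, whatever its degree.

  Local affinity is not an inequality and is unstable for functions. It is stable for envelopes: if
  the contact points of a supporting plane come close to every vertex of a simplex, their hull still
  contains a slightly smaller ball. General position makes all facets simplices, so that no vertex
  can be missed.\<close>

definition supergradient :: "'a::real_inner set \<Rightarrow> ('a \<Rightarrow> real) \<Rightarrow> 'a \<Rightarrow> 'a \<Rightarrow> bool" where
  "supergradient S h x a \<longleftrightarrow> (\<forall>z\<in>S. h z \<le> h x + a \<bullet> (z - x))"

lemma supergradientD: "supergradient S h x a \<Longrightarrow> z \<in> S \<Longrightarrow> h z \<le> h x + a \<bullet> (z - x)"
  by (simp add: supergradient_def)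

lemma concave_on_affine: "convex S \<Longrightarrow> concave_on S (\<lambda>z. c + a \<bullet> (z - x))"
  for a :: "'a::real_inner"
  unfolding concave_on_iff
proof (intro conjI ballI allI impI)
  fix p q :: 'a and u v :: real
  assume "u + v = 1"
  then have "v = 1 - u" by simp
  show "u * (c + a \<bullet> (p - x)) + v * (c + a \<bullet> (q - x)) \<le> c + a \<bullet> (u *\<^sub>R p + v *\<^sub>R q - x)"
    unfolding \<open>v = 1 - u\<close> by (simp add: algebra_simps)
qed

lemma convex_hypograph:
  fixes h :: "'a::euclidean_space \<Rightarrow> real"
  assumes "concave_on S h"
  shows "convex {p. fst p \<in> S \<and> snd p \<le> h (fst p)}"
proof -
  have "{p. fst p \<in> S \<and> snd p \<le> h (fst p)} = (\<lambda>p. (fst p, - snd p)) -` epigraph S (\<lambda>x. - h x)"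
    by (auto simp: epigraph_def)
  moreover have "linear (\<lambda>p::'a \<times> real. (fst p, - snd p))"
    by (auto intro!: linearI simp: algebra_simps)
  ultimately show ?thesis
    using assms by (simp add: concave_on_def convex_epigraph convex_linear_vimage)
qed

text \<open>Separates the hypograph from the open vertical ray above \<open>(x, h x)\<close>. The
  hyperplane cannot be vertical because \<open>x\<close> is interior to \<open>S\<close>, so its
  normal can be scaled to give a slope.\<close>

lemma concave_supergradient_exists:
  fixes h :: "'a::euclidean_space \<Rightarrow> real"
  assumes conc: "concave_on S h" and x: "x \<in> interior S"
  obtains a where "supergradient S h x a"
proof -
  have S: "convex S" using conc by (simp add: concave_on_iff)
  have xS: "x \<in> S" using x interior_subset by blast
  define A where "A = {p. fst p \<in> S \<and> snd p \<le> h (fst p)}"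
  define B where "B = {p. fst p = x \<and> snd p > h x}"
  have "convex A" unfolding A_def by (rule convex_hypograph[OF conc])
  moreover have "convex B"
  proof -
    have "B = {x} \<times> {h x<..}" unfolding B_def by auto
    then show ?thesis by (simp add: convex_Times)
  qed
  moreover have "A \<noteq> {}" "B \<noteq> {}" "A \<inter> B = {}"
  proof -
    have "(x, h x) \<in> A" "(x, h x + 1) \<in> B" using xS by (auto simp: A_def B_def)
    then show "A \<noteq> {}" "B \<noteq> {}" by auto
    show "A \<inter> B = {}" by (auto simp: A_def B_def)
  qed
  ultimately obtain c b where c: "c \<noteq> 0" "\<forall>p\<in>A. c \<bullet> p \<le> b" "\<forall>p\<in>B. c \<bullet> p \<ge> b"
    using separating_hyperplane_sets[of A B] by auto
  obtain a \<beta> where ab: "c = (a, \<beta>)" by (cases c)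
  have cA: "a \<bullet> z + \<beta> * t \<le> b" if "z \<in> S" "t \<le> h z" for z t
    using c(2)[rule_format, of "(z,t)"] that by (simp add: A_def ab)
  have cB: "b \<le> a \<bullet> x + \<beta> * t" if "t > h x" for t
    using c(3)[rule_format, of "(x,t)"] that by (simp add: B_def ab)
  have \<beta>0: "\<beta> \<ge> 0"
    using cA[OF xS order_refl] cB[of "h x + 1"] by (simp add: algebra_simps)
  \<comment> \<open>The ray omits its end point, so the bound at height \<open>h x\<close> is
    obtained as a limit.\<close>
  have eq: "b \<le> a \<bullet> x + \<beta> * h x"
  proof (rule field_le_epsilon)
    fix e :: real assume e: "e > 0"
    have "b \<le> a \<bullet> x + \<beta> * (h x + e / (\<beta> + 1))" by (rule cB) (use e \<beta>0 in auto)
    also have "\<dots> \<le> a \<bullet> x + \<beta> * h x + e"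
    proof -
      have "\<beta> * (e / (\<beta> + 1)) \<le> e" using e \<beta>0 by (simp add: divide_le_eq mult.commute distrib_left)
      then show ?thesis by (simp add: distrib_left)
    qed
    finally show "b \<le> a \<bullet> x + \<beta> * h x + e" .
  qed
  have "\<beta> \<noteq> 0"
  proof
    assume \<beta>: "\<beta> = 0"
    obtain e where e: "e > 0" "cball x e \<subseteq> S" using x mem_interior_cball by blast
    have a0: "a \<noteq> 0" using c(1) ab \<beta> by (simp add: zero_prod_def)
    have "x + (e / norm a) *\<^sub>R a \<in> S" using e a0 by (intro subsetD[OF e(2)]) (simp add: dist_norm)
    from cA[OF this order_refl] eq \<beta> have "(e / norm a) * (a \<bullet> a) \<le> 0"
      by (simp add: inner_add_right)
    moreover have "(e / norm a) * (a \<bullet> a) > 0" using e a0 by simp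
    ultimately show False by simp
  qed
  then have \<beta>: "\<beta> > 0" using \<beta>0 by simp
  have "supergradient S h x (- (1 / \<beta>) *\<^sub>R a)"
    unfolding supergradient_def
  proof
    fix z assume "z \<in> S"
    from cA[OF this order_refl] eq have "\<beta> * h z \<le> \<beta> * h x - a \<bullet> (z - x)"
      by (simp add: inner_diff_right)
    then show "h z \<le> h x + (- (1 / \<beta>) *\<^sub>R a) \<bullet> (z - x)"
      using \<beta> by (simp add: field_simps)
  qed
  then show ?thesis using that by blast
qed

text \<open>A step from \<open>x\<close> in the direction \<open>a - b\<close> would otherwise put
  the lower affine function above the upper one. Used to read off slopes from one-sided domination
  around a contact point.\<close>

lemma affine_contact_imp_eq:
  fixes a b x :: "'a::euclidean_space"
  assumes e: "e > 0" and le: "\<And>p. dist x p < e \<Longrightarrow> c + a \<bullet> (p - x) \<le> c' + b \<bullet> (p - x)"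
    and c: "c = c'"
  shows "a = b"
proof (rule ccontr)
  assume n: "a \<noteq> b"
  define p where "p = x + (e / (2 * norm (a - b))) *\<^sub>R (a - b)"
  have "dist x p < e" using e n by (simp add: p_def dist_norm)
  from le[OF this] c have "(e / (2 * norm (a - b))) * ((a - b) \<bullet> (a - b)) \<le> 0"
    by (simp add: p_def inner_diff_left right_diff_distrib)
  moreover have "(e / (2 * norm (a - b))) * ((a - b) \<bullet> (a - b)) > 0" using e n
    by (intro mult_pos_pos) (auto simp: inner_gt_zero_iff)
  ultimately show False by simp
qed

section \<open>Concave envelopes\<close>

definition envelope_hull :: "'a::euclidean_space set \<Rightarrow> ('a \<Rightarrow> real) \<Rightarrow> ('a \<times> real) set" where
  "envelope_hull Z y = convex hull ((\<lambda>z. (z, y z)) ` Z)"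

text \<open>\<open>Z\<close> is arbitrary so that one theory covers both the graph over the whole
  cube and the polyhedral envelope of finitely many vertices with prescribed heights.\<close>

definition cenv :: "'a::euclidean_space set \<Rightarrow> ('a \<Rightarrow> real) \<Rightarrow> 'a \<Rightarrow> real" where
  "cenv Z y x = Sup {t. (x, t) \<in> envelope_hull Z y}"

lemma envelope_hull_fst:
  assumes "(x, t) \<in> envelope_hull Z y"
  shows "x \<in> convex hull Z"
proof -
  have "fst ` envelope_hull Z y = convex hull (fst ` (\<lambda>z. (z, y z)) ` Z)"
    unfolding envelope_hull_def by (rule convex_hull_linear_image) (rule linear_fst)
  also have "fst ` (\<lambda>z. (z, y z)) ` Z = Z" by (auto simp: image_image)
  finally show ?thesis using assms by (metis fst_conv imageI)
qed

lemma envelope_hull_exists: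
  assumes "x \<in> convex hull Z"
  obtains t where "(x, t) \<in> envelope_hull Z y"
proof -
  have "fst ` envelope_hull Z y = convex hull (fst ` (\<lambda>z. (z, y z)) ` Z)"
    unfolding envelope_hull_def by (rule convex_hull_linear_image) (rule linear_fst)
  also have "fst ` (\<lambda>z. (z, y z)) ` Z = Z" by (auto simp: image_image)
  finally have "x \<in> fst ` envelope_hull Z y" using assms by simp
  then show ?thesis using that by auto
qed

context
  fixes Z :: "'a::euclidean_space set" and y :: "'a \<Rightarrow> real"
  assumes Z: "compact Z" and y: "continuous_on Z y"
begin

lemma compact_envelope_hull: "compact (envelope_hull Z y)"
  unfolding envelope_hull_def
  by (intro compact_convex_hull compact_continuous_image Z continuous_intros y)

lemma cenv_upper:
  assumes "(x, t) \<in> envelope_hull Z y"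
  shows "t \<le> cenv Z y x"
  unfolding cenv_def
proof (rule cSup_upper)
  have "bounded (snd ` envelope_hull Z y)"
    using compact_envelope_hull compact_imp_bounded bounded_snd by blast
  moreover have "{t. (x, t) \<in> envelope_hull Z y} \<subseteq> snd ` envelope_hull Z y" by force
  ultimately show "bdd_above {t. (x, t) \<in> envelope_hull Z y}"
    by (metis bounded_imp_bdd_above bounded_subset)
qed (use assms in auto)

lemma cenv_mem:
  assumes x: "x \<in> convex hull Z"
  shows "(x, cenv Z y x) \<in> envelope_hull Z y"
proof -
  let ?S = "{t. (x, t) \<in> envelope_hull Z y}"
  have "closed ((\<lambda>t. (x, t)) -` envelope_hull Z y)"
    by (intro continuous_closed_vimage compact_imp_closed compact_envelope_hull)
      (auto intro!: continuous_intros)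
  then have "closed ?S" by (simp add: vimage_def)
  moreover have "?S \<noteq> {}" using envelope_hull_exists[OF x] by blast
  moreover have "bdd_above ?S" using cenv_upper by (auto simp: bdd_above_def)
  ultimately have "Sup ?S \<in> ?S" by (intro closed_contains_Sup)
  then show ?thesis by (simp add: cenv_def)
qed

lemma cenv_ge: "z \<in> Z \<Longrightarrow> y z \<le> cenv Z y z"
  by (rule cenv_upper) (auto simp: envelope_hull_def intro: hull_inc)

lemma concave_cenv: "concave_on (convex hull Z) (cenv Z y)"
  unfolding concave_on_iff
proof (intro conjI ballI allI impI)
  fix p q and u v :: real
  assume *: "p \<in> convex hull Z" "q \<in> convex hull Z" "0 \<le> u" "0 \<le> v" "u + v = 1"
  have "u *\<^sub>R (p, cenv Z y p) + v *\<^sub>R (q, cenv Z y q) \<in> envelope_hull Z y"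
    by (rule convexD) (use * cenv_mem in \<open>auto simp: envelope_hull_def\<close>)
  then show "u * cenv Z y p + v * cenv Z y q \<le> cenv Z y (u *\<^sub>R p + v *\<^sub>R q)"
    by (intro cenv_upper) simp
qed simp

text \<open>The choice of \<open>C\<close> decides what passes to the envelope: a hypograph gives
  minimality among concave majorants, a set constrained only over a face gives the boundary
  increments.\<close>

lemma cenv_in_convex:
  assumes "convex C" "\<And>z. z \<in> Z \<Longrightarrow> (z, y z) \<in> C" "x \<in> convex hull Z"
  shows "(x, cenv Z y x) \<in> C"
proof -
  have "envelope_hull Z y \<subseteq> C"
    unfolding envelope_hull_def by (rule hull_minimal) (use assms in auto)
  then show ?thesis using cenv_mem[OF assms(3)] by blast
qed

lemma cenv_least:
  assumes h: "concave_on (convex hull Z) h" and le: "\<And>z. z \<in> Z \<Longrightarrow> y z \<le> h z"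
    and x: "x \<in> convex hull Z"
  shows "cenv Z y x \<le> h x"
proof -
  define C where "C = {p. fst p \<in> convex hull Z \<and> snd p \<le> h (fst p)}"
  have "convex C" unfolding C_def by (rule convex_hypograph[OF h])
  then have "(x, cenv Z y x) \<in> C"
    by (rule cenv_in_convex) (use x le in \<open>auto simp: C_def intro: hull_inc\<close>)
  then show ?thesis by (simp add: C_def)
qed

lemma cenv_le_affine:
  assumes "\<And>z. z \<in> Z \<Longrightarrow> y z \<le> c + a \<bullet> (z - p)" "x \<in> convex hull Z"
  shows "cenv Z y x \<le> c + a \<bullet> (x - p)"
  using cenv_least[OF concave_on_affine] assms by simp

text \<open>The supergradient defines a supporting hyperplane of the compact hull of the graph. It
  cuts out a face, a face is spanned by the generators in it, and projection to the base gives the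
  claim. This is the source of all contact points over interior points.\<close>

lemma cenv_contact_hull:
  assumes a: "supergradient (convex hull Z) (cenv Z y) x a" and x: "x \<in> convex hull Z"
  shows "x \<in> convex hull {z \<in> Z. y z = cenv Z y x + a \<bullet> (z - x)}"
proof -
  let ?c = "cenv Z y x - a \<bullet> x"
  let ?n = "(-a, 1::real)"
  let ?G = "(\<lambda>z. (z, y z)) ` Z"
  have le: "?n \<bullet> p \<le> ?c" if "p \<in> convex hull ?G" for p
  proof -
    obtain w t where p: "p = (w, t)" by (cases p)
    with that have "(w, t) \<in> envelope_hull Z y" by (simp add: envelope_hull_def)
    then have "t \<le> cenv Z y w" "w \<in> convex hull Z" using cenv_upper envelope_hull_fst by auto
    with supergradientD[OF a this(2)] show ?thesis by (simp add: p inner_diff_right)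
  qed
  have "(convex hull ?G \<inter> {p. ?n \<bullet> p = ?c}) face_of convex hull ?G"
    using convex_convex_hull le by (rule face_of_Int_supporting_hyperplane_le)
  moreover have "compact ?G" by (intro compact_continuous_image Z continuous_intros y)
  ultimately obtain S' where S': "S' \<subseteq> ?G" "convex hull ?G \<inter> {p. ?n \<bullet> p = ?c} = convex hull S'"
    using face_of_convex_hull_subset[of ?G "convex hull ?G \<inter> {p. ?n \<bullet> p = ?c}"] by auto
  have "(x, cenv Z y x) \<in> convex hull S'"
    unfolding S'(2)[symmetric] using cenv_mem[OF x] by (simp add: envelope_hull_def)
  then have "fst (x, cenv Z y x) \<in> fst ` (convex hull S')" by blast
  then have "x \<in> convex hull (fst ` S')"
    by (simp add: convex_hull_linear_image[OF linear_fst])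
  moreover have "fst ` S' \<subseteq> {z \<in> Z. y z = cenv Z y x + a \<bullet> (z - x)}"
  proof
    fix w assume "w \<in> fst ` S'"
    then obtain z where z: "z \<in> Z" "(z, y z) \<in> S'" "w = z" using S'(1) by auto
    then have "?n \<bullet> (z, y z) = ?c" using S'(2) hull_subset[of S' convex] by blast
    then show "w \<in> {z \<in> Z. y z = cenv Z y x + a \<bullet> (z - x)}" using z by (simp add: inner_diff_right)
  qed
  ultimately show ?thesis using hull_mono by blast
qed

lemma supergradient_cenvI:
  assumes "\<And>z. z \<in> Z \<Longrightarrow> y z \<le> cenv Z y x + a \<bullet> (z - x)"
  shows "supergradient (convex hull Z) (cenv Z y) x a"
  unfolding supergradient_def using cenv_le_affine[OF assms] by blast

end

text \<open>Raising one envelope by \<delta> gives a concave majorant of the other function. This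
  makes conditions on the envelope robust under small changes of the function.\<close>

lemma cenv_close:
  assumes Z: "compact Z" and y: "continuous_on Z y" "continuous_on Z y'"
    and d: "\<And>z. z \<in> Z \<Longrightarrow> \<bar>y z - y' z\<bar> \<le> \<delta>" and x: "x \<in> convex hull Z"
  shows "\<bar>cenv Z y x - cenv Z y' x\<bar> \<le> \<delta>"
proof -
  have *: "cenv Z f x \<le> cenv Z g x + \<delta>"
    if "continuous_on Z f" "continuous_on Z g" "\<And>z. z \<in> Z \<Longrightarrow> f z \<le> g z + \<delta>" for f g
  proof (rule cenv_least[OF Z that(1) _ _ x])
    show "concave_on (convex hull Z) (\<lambda>x. cenv Z g x + \<delta>)"
      using concave_on_add[OF concave_cenv[OF Z that(2)] concave_on_affine[of "convex hull Z" \<delta> 0 0]] by simp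
    show "f z \<le> cenv Z g z + \<delta>" if "z \<in> Z" for z
      using cenv_ge[OF Z \<open>continuous_on Z g\<close>, of z] \<open>\<And>z. z \<in> Z \<Longrightarrow> f z \<le> g z + \<delta>\<close>[of z] that by linarith
  qed
  have "cenv Z y x \<le> cenv Z y' x + \<delta>"
    by (rule *[OF y]) (use d in \<open>force simp: abs_le_iff\<close>)
  moreover have "cenv Z y' x \<le> cenv Z y x + \<delta>"
    by (rule *[OF y(2,1)]) (use d in \<open>force simp: abs_le_iff\<close>)
  ultimately show ?thesis by linarith
qed

lemma continuous_on_Min_finite:
  fixes F :: "'i \<Rightarrow> 'a::topological_space \<Rightarrow> real"
  assumes "finite I" "I \<noteq> {}" "\<And>i. i \<in> I \<Longrightarrow> continuous_on S (F i)"
  shows "continuous_on S (\<lambda>x. Min ((\<lambda>i. F i x) ` I))"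
  using assms
proof (induction I rule: finite_ne_induct)
  case (insert i I)
  have "Min ((\<lambda>i. F i x) ` insert i I) = min (F i x) (Min ((\<lambda>i. F i x) ` I))" for x
    using insert by simp
  then show ?case using insert by (auto intro!: continuous_on_min)
qed simp

text \<open>Over finitely many points the hull is a polyhedron, hence the envelope is a minimum of
  finitely many affine functions; for general compact sets continuity may fail at the boundary.\<close>

lemma continuous_on_cenv_finite:
  fixes Z :: "'a::euclidean_space set"
  assumes Z: "finite Z"
  shows "continuous_on (convex hull Z) (cenv Z y)"
proof (cases "Z = {}")
  case False
  have y: "continuous_on Z y" and cZ: "compact Z"
    using Z by (auto simp: finite_imp_compact intro: continuous_on_finite)
  have "polytope (envelope_hull Z y)" unfolding envelope_hull_def polytope_def using Z by blast
  then obtain F where F: "finite F" "envelope_hull Z y = \<Inter>F"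
      "\<forall>h\<in>F. \<exists>a b. a \<noteq> 0 \<and> h = {p. a \<bullet> p \<le> b}"
    using polytope_imp_polyhedron polyhedron_def by metis
  then obtain A B where AB: "\<And>h. h \<in> F \<Longrightarrow> h = {p. A h \<bullet> p \<le> B h}" by metis
  have mem: "(x, t) \<in> envelope_hull Z y \<longleftrightarrow> (\<forall>h\<in>F. fst (A h) \<bullet> x + snd (A h) * t \<le> B h)" for x t
  proof -
    have "(x, t) \<in> envelope_hull Z y \<longleftrightarrow> (\<forall>h\<in>F. (x, t) \<in> h)" using F(2) by auto
    also have "\<dots> \<longleftrightarrow> (\<forall>h\<in>F. A h \<bullet> (x, t) \<le> B h)" using AB by auto
    finally show ?thesis by (simp add: inner_prod_def)
  qed
  \<comment> \<open>Only half-spaces whose normal has a positive last coordinate bound the height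
    from above. There must be one, since otherwise a raised hull point would still be in the
    hull.\<close>
  define I where "I = {h \<in> F. snd (A h) > 0}"
  define M where "M x = (\<lambda>h. (B h - fst (A h) \<bullet> x) / snd (A h)) ` I" for x
  have I: "I \<noteq> {}"
  proof
    assume I: "I = {}"
    obtain z where z: "z \<in> Z" using False by blast
    have "(z, cenv Z y z + 1) \<in> envelope_hull Z y"
      unfolding mem
    proof
      fix h assume h: "h \<in> F"
      have "fst (A h) \<bullet> z + snd (A h) * cenv Z y z \<le> B h"
        using cenv_mem[OF cZ y, of z] z mem h by (auto intro: hull_inc)
      moreover have "snd (A h) \<le> 0" using I h by (force simp: I_def)
      ultimately show "fst (A h) \<bullet> z + snd (A h) * (cenv Z y z + 1) \<le> B h"
        by (simp add: algebra_simps)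
    qed
    from cenv_upper[OF cZ y this] show False by simp
  qed
  have fI: "finite I" using F by (simp add: I_def)
  have "cenv Z y x = Min (M x)" if x: "x \<in> convex hull Z" for x
  proof (rule antisym)
    have m: "(x, cenv Z y x) \<in> envelope_hull Z y" by (rule cenv_mem[OF cZ y x])
    show le: "cenv Z y x \<le> Min (M x)"
      using m fI I by (auto simp: M_def mem I_def field_simps)
    have "(x, Min (M x)) \<in> envelope_hull Z y"
      unfolding mem
    proof
      fix h assume h: "h \<in> F"
      show "fst (A h) \<bullet> x + snd (A h) * Min (M x) \<le> B h"
      proof (cases "snd (A h) > 0")
        case True
        then have "Min (M x) \<le> (B h - fst (A h) \<bullet> x) / snd (A h)"
          using fI h by (intro Min_le) (auto simp: M_def I_def)
        then show ?thesis using True by (simp add: field_simps)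
      next
        case False
        then have "snd (A h) * Min (M x) \<le> snd (A h) * cenv Z y x"
          using le by (intro mult_left_mono_neg) auto
        then show ?thesis using m h unfolding mem by force
      qed
    qed
    then show "Min (M x) \<le> cenv Z y x" by (rule cenv_upper[OF cZ y])
  qed
  moreover have "continuous_on (convex hull Z) (\<lambda>x. Min (M x))"
    unfolding M_def by (rule continuous_on_Min_finite[OF fI I])
      (auto intro!: continuous_intros simp: I_def)
  ultimately show ?thesis by (simp cong: continuous_on_cong)
qed simp

section \<open>Hausdorff dimension bounds\<close>

text \<open>A finite stage of the bound \<open>m\<close> for the Hausdorff dimension: one cover by
  balls of equal radius, with excess of the exponent, mesh and total all tied to \<open>n\<close>.
  One finite cover can be kept under small perturbations of \<open>f\<close>; the dimension could
  not.\<close>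

definition coverable :: "nat \<Rightarrow> nat \<Rightarrow> 'a::metric_space set \<Rightarrow> bool" where
  "coverable m n S \<longleftrightarrow>
     (\<exists>P \<eta>. finite P \<and> 0 < \<eta> \<and> 2 * \<eta> \<le> 1 / Suc n \<and> S \<subseteq> (\<Union>p\<in>P. cball p \<eta>) \<and>
        card P * (2 * \<eta>) powr (m + 1 / Suc n) \<le> 1 / Suc n)"

lemma coverable_mono: "coverable m n S \<Longrightarrow> T \<subseteq> S \<Longrightarrow> coverable m n T"
  unfolding coverable_def by (meson subset_trans)

lemma hausdorff_content_le_cballs:
  fixes P :: "'a::metric_space set"
  assumes P: "finite P" and S: "S \<subseteq> (\<Union>p\<in>P. cball p \<eta>)" and \<eta>: "0 < \<eta>" "2 * \<eta> \<le> \<delta>" and s: "s > 0"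
  shows "hausdorff_content \<delta> s S \<le> ennreal (card P * (2 * \<eta>) powr s)"
proof -
  obtain e where e: "bij_betw e {0..<card P} P" using ex_bij_betw_nat_finite[OF P] by blast
  define U where "U k = (if k < card P then cball (e k) \<eta> else {})" for k
  have diam: "diameter (U k) \<le> 2 * \<eta>" for k
  proof -
    have "dist x y \<le> 2 * \<eta>" if "x \<in> cball p \<eta>" "y \<in> cball p \<eta>" for x y p :: 'a
      using that dist_triangle2[of x y p] by (simp add: dist_commute)
    then have "diameter (cball p \<eta>) \<le> 2 * \<eta>" for p :: 'a
      unfolding diameter_def using \<eta> by (auto intro!: cSUP_least)
    then show ?thesis using \<eta> by (simp add: U_def)
  qed
  have "p \<in> e ` {0..<card P}" if "p \<in> P" for p using e that by (simp add: bij_betw_def)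
  then have "S \<subseteq> (\<Union>k. U k)"
    using S by (fastforce simp: U_def)
  moreover have "\<forall>k. bounded (U k) \<and> diameter (U k) \<le> \<delta>"
    using order_trans[OF diam \<eta>(2)] by (simp add: U_def)
  ultimately have "hausdorff_content \<delta> s S \<le> (\<Sum>k. hausdorff_gauge s (U k))"
    unfolding hausdorff_content_def by (intro INF_lower) simp
  also have "\<dots> = (\<Sum>k<card P. hausdorff_gauge s (U k))"
    by (rule suminf_finite) (auto simp: U_def hausdorff_gauge_def)
  also have "\<dots> \<le> (\<Sum>k<card P. ennreal ((2 * \<eta>) powr s))"
  proof (rule sum_mono)
    fix k
    have "diameter (U k) powr s \<le> (2 * \<eta>) powr s"
      by (rule powr_mono2) (use s diam in \<open>auto simp: U_def intro!: diameter_ge_0\<close>)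
    then show "hausdorff_gauge s (U k) \<le> ennreal ((2 * \<eta>) powr s)"
      using s by (simp add: hausdorff_gauge_def ennreal_leI)
  qed
  also have "\<dots> = ennreal (card P * (2 * \<eta>) powr s)"
    by (simp add: ennreal_mult' ennreal_of_nat_eq_real_of_nat)
  finally show ?thesis .
qed

text \<open>For \<open>s > m\<close>, take \<open>1 / Suc n\<close> below \<open>s - m\<close>, the
  mesh and the tolerance. As \<open>2 * \<eta> \<le> 1\<close>, raising the exponent to
  \<open>s\<close> only decreases the controlled sum.\<close>

lemma hausdorff_dim_le:
  assumes "\<And>n. coverable m n S"
  shows "hausdorff_dim S \<le> ereal m"
proof (cases "S = {}")
  case False
  have "hausdorff_dim S \<le> ereal s" if s: "s > real m" for s
  proof -
    have "hausdorff_content \<delta> s S = 0" if \<delta>: "\<delta> > 0" for \<delta>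
    proof -
      have "hausdorff_content \<delta> s S \<le> ennreal e" if e: "e > 0" for e
      proof -
        obtain n where n: "1 / Suc n < min e (min \<delta> (s - m))"
          using nat_approx_posE[of "min e (min \<delta> (s - m))"] e \<delta> s by (metis diff_gt_0_iff_gt min_less_iff_conj)
        obtain P \<eta> where P: "finite P" "0 < \<eta>" "2 * \<eta> \<le> 1 / Suc n" "S \<subseteq> (\<Union>p\<in>P. cball p \<eta>)"
           "card P * (2 * \<eta>) powr (m + 1 / Suc n) \<le> 1 / Suc n"
          using assms[of n] unfolding coverable_def by blast
        have \<eta>1: "2 * \<eta> \<le> 1" using P(3) by (rule order_trans) simp
        have "hausdorff_content \<delta> s S \<le> ennreal (card P * (2 * \<eta>) powr s)"
          by (rule hausdorff_content_le_cballs) (use P n s in auto)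
        also have "card P * (2 * \<eta>) powr s \<le> card P * (2 * \<eta>) powr (m + 1 / Suc n)"
          by (intro mult_left_mono powr_mono') (use n P(2) \<eta>1 in auto)
        also have "\<dots> \<le> e" using P(5) n by simp
        finally show ?thesis using ennreal_leI by blast
      qed
      then have "hausdorff_content \<delta> s S \<le> 0 + ennreal e" if "e > 0" for e using that by simp
      then have "hausdorff_content \<delta> s S \<le> 0" by (rule ennreal_le_epsilon)
      then show ?thesis by simp
    qed
    then have "hausdorff_measure s S = 0" by (simp add: hausdorff_measure_def)
    moreover have "s \<ge> 0" using s by (meson less_imp_le of_nat_0_le_iff order_trans)
    ultimately show ?thesis using False by (auto simp: hausdorff_dim_def intro!: Inf_lower)
  qed
  then have "hausdorff_dim S \<le> y" if "ereal m < y" for y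
    using that by (cases y) auto
  then show ?thesis by (rule dense_ge)
qed (simp add: hausdorff_dim_def)

section \<open>Lower bounds for the dimension by comparison of volumes\<close>

lemma hausdorff_dim_ge_0: "S \<noteq> {} \<Longrightarrow> hausdorff_dim S \<ge> 0"
  by (auto simp: hausdorff_dim_def intro!: Inf_greatest)

text \<open>For diameters at most 1 the \<open>m\<close>-th power is dominated by the gauge of every
  smaller order, so the content at mesh 1 is already bounded below by \<open>c\<close> for all
  \<open>s < m\<close>.\<close>

lemma hausdorff_dim_ge:
  fixes A :: "'a::metric_space set"
  assumes A: "A \<noteq> {}" and c: "c > 0"
    and mass: "\<And>U :: nat \<Rightarrow> 'a set. A \<subseteq> (\<Union>k. U k) \<Longrightarrow>
        (\<forall>k. bounded (U k) \<and> diameter (U k) \<le> 1) \<Longrightarrow> ennreal c \<le> (\<Sum>k. ennreal (diameter (U k) ^ m))"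
  shows "ereal m \<le> hausdorff_dim A"
proof -
  have "m \<le> s" if s: "s \<ge> 0" "hausdorff_measure s A = 0" for s :: real
  proof (rule ccontr)
    assume "\<not> m \<le> s"
    then have sm: "s < m" by simp
    then have m: "m > 0" using s by (cases m) auto
    have "ennreal c \<le> hausdorff_content 1 s A"
      unfolding hausdorff_content_def
    proof (rule INF_greatest)
      fix U :: "nat \<Rightarrow> 'a set"
      assume U: "U \<in> {U. A \<subseteq> \<Union> (range U) \<and> (\<forall>k. bounded (U k) \<and> diameter (U k) \<le> 1)}"
      have "ennreal c \<le> (\<Sum>k. ennreal (diameter (U k) ^ m))" using mass U by blast
      also have "\<dots> \<le> (\<Sum>k. hausdorff_gauge s (U k))"
      proof (intro suminf_le allI)
        fix k
        let ?D = "diameter (U k)"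
        have D: "0 \<le> ?D" "?D \<le> 1" using U by (auto intro: diameter_ge_0)
        have "?D ^ m \<le> ?D powr s" if "s \<noteq> 0"
        proof (cases "?D = 0")
          case False
          then have "?D ^ m = ?D powr m" using D by (simp add: powr_realpow)
          then show ?thesis using D False sm by (simp add: powr_mono')
        qed (use m in \<open>simp add: zero_power\<close>)
        moreover have "?D ^ m \<le> 1" using D by (rule power_le_one)
        ultimately show "ennreal (?D ^ m) \<le> hausdorff_gauge s (U k)"
          using m by (auto simp: hausdorff_gauge_def ennreal_leI)
      qed auto
      finally show "ennreal c \<le> (\<Sum>k. hausdorff_gauge s (U k))" .
    qed
    also have "\<dots> \<le> hausdorff_measure s A"
      unfolding hausdorff_measure_def by (rule SUP_upper) simp
    finally show False using c s by simp
  qed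
  then show ?thesis using A by (auto simp: hausdorff_dim_def intro!: Inf_greatest)
qed

lemma emeasure_lborel_cbox_cart:
  fixes a b :: "real^'n::finite"
  assumes "\<And>i. a $ i \<le> b $ i"
  shows "emeasure lborel (cbox a b) = ennreal (\<Prod>i\<in>UNIV. b $ i - a $ i)"
proof -
  have "a \<in> cbox a b" using assms by (simp add: mem_box_cart)
  then have "cbox a b \<noteq> {}" by blast
  then have "measure lborel (cbox a b) = (\<Prod>i\<in>UNIV. b $ i - a $ i)" using content_cbox_cart by blast
  then show ?thesis
    by (metis emeasure_eq_ennreal_measure emeasure_lborel_cbox_finite infinity_ennreal_def less_irrefl)
qed

lemma emeasure_le_suminf_boxes:
  assumes "A \<subseteq> (\<Union>k. cbox (a k) (b k))" "A \<in> sets lborel"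
  shows "emeasure lborel A \<le> (\<Sum>k::nat. emeasure lborel (cbox (a k) (b k)))"
proof -
  have "emeasure lborel A \<le> emeasure lborel (\<Union>k. cbox (a k) (b k))"
    by (rule emeasure_mono) (use assms in auto)
  also have "\<dots> \<le> (\<Sum>k. emeasure lborel (cbox (a k) (b k)))"
    by (rule emeasure_subadditive_countably) auto
  finally show ?thesis .
qed

lemma abs_component_diff_le_diameter:
  fixes x y :: "real^'n::finite"
  assumes "bounded U" "x \<in> U" "y \<in> U"
  shows "\<bar>x $ i - y $ i\<bar> \<le> diameter U"
proof -
  have "\<bar>x $ i - y $ i\<bar> \<le> norm (x - y)" using component_le_norm_cart[of "x - y" i] by simp
  also have "\<dots> \<le> diameter U" using diameter_bounded_bound[OF assms] by (simp add: dist_norm)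
  finally show ?thesis .
qed

text \<open>Enclosing each covering set of diameter \<open>D\<close> in a box with sides \<open>2 D\<close> in the directions of
  \<open>J\<close> and full length in the others avoids projecting to a space of lower dimension.\<close>

lemma hausdorff_dim_ge_box:
  fixes A :: "(real^'n::finite) set"
  assumes lu: "\<And>i. l $ i < u $ i"
    and A: "\<And>x. x \<in> box l u \<Longrightarrow> \<exists>z\<in>A. \<forall>i\<in>J. z $ i = x $ i"
  shows "ereal (real (card J)) \<le> hausdorff_dim A"
proof -
  define v where "v = (\<Prod>i\<in>UNIV. u $ i - l $ i)"
  \<comment> \<open>The volume of an enclosing box is \<open>M * D k ^ card J\<close>: its sides in
    the directions of \<open>J\<close> have length \<open>2 * D k\<close>.\<close>
  define M where "M = 2 ^ card J * (\<Prod>i\<in>-J. u $ i - l $ i)"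
  have v: "v > 0" and M: "M > 0"
    unfolding v_def M_def using lu by (auto intro!: prod_pos mult_pos_pos)
  have "(\<chi> i. (l $ i + u $ i) / 2) \<in> box l u" using lu by (simp add: mem_box_cart field_simps)
  then have "A \<noteq> {}" using A by blast
  then show ?thesis
  proof (rule hausdorff_dim_ge[of _ "v / M"])
    fix U :: "nat \<Rightarrow> (real^'n) set"
    assume U: "A \<subseteq> (\<Union>k. U k)" "\<forall>k. bounded (U k) \<and> diameter (U k) \<le> 1"
    define c where "c k = (SOME x. x \<in> U k)" for k
    define D where "D k = diameter (U k)" for k
    define a where "a k = (\<chi> i. if i \<in> J then c k $ i - D k else l $ i)" for k
    define b where "b k = (\<chi> i. if i \<in> J then c k $ i + D k else u $ i)" for k
    have D0: "D k \<ge> 0" for k using U by (auto simp: D_def intro: diameter_ge_0)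
    have "box l u \<subseteq> (\<Union>k. cbox (a k) (b k))"
    proof
      fix x assume x: "x \<in> box l u"
      obtain z k where z: "z \<in> U k" "\<forall>i\<in>J. z $ i = x $ i" using A[OF x] U(1) by blast
      then have ck: "c k \<in> U k" unfolding c_def by (intro someI)
      have "\<bar>x $ i - c k $ i\<bar> \<le> D k" if "i \<in> J" for i
        using abs_component_diff_le_diameter[OF _ z(1) ck, of i] U(2) z(2) that by (simp add: D_def)
      then have "x \<in> cbox (a k) (b k)"
        using x by (force simp: mem_box_cart a_def b_def abs_le_iff less_imp_le)
      then show "x \<in> (\<Union>k. cbox (a k) (b k))" by blast
    qed
    then have "emeasure lborel (box l u) \<le> (\<Sum>k. emeasure lborel (cbox (a k) (b k)))"
      by (rule emeasure_le_suminf_boxes) simp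
    also have "emeasure lborel (box l u) = ennreal v"
    proof -
      have "emeasure lborel (box l u) = emeasure lborel (cbox l u)"
        by (simp add: emeasure_lborel_box_eq emeasure_lborel_cbox_eq)
      then show ?thesis unfolding v_def using lu by (simp add: emeasure_lborel_cbox_cart less_imp_le)
    qed
    finally have F: "ennreal v \<le> (\<Sum>k. emeasure lborel (cbox (a k) (b k)))" .
    have eq: "emeasure lborel (cbox (a k) (b k)) = ennreal M * ennreal (D k ^ card J)" for k
    proof -
      have "(\<Prod>i\<in>UNIV. b k $ i - a k $ i) = (\<Prod>i\<in>UNIV. if i \<in> J then 2 * D k else u $ i - l $ i)"
        by (rule prod.cong) (auto simp: a_def b_def)
      also have "\<dots> = M * D k ^ card J"
        by (subst prod.If_cases) (auto simp: M_def power_mult_distrib Compl_eq)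
      finally have "(\<Prod>i\<in>UNIV. b k $ i - a k $ i) = M * D k ^ card J" .
      moreover have "emeasure lborel (cbox (a k) (b k)) = ennreal (\<Prod>i\<in>UNIV. b k $ i - a k $ i)"
        by (rule emeasure_lborel_cbox_cart) (use D0[of k] lu in \<open>auto simp: a_def b_def less_imp_le\<close>)
      ultimately show ?thesis using D0[of k] M by (simp add: ennreal_mult)
    qed
    from F have "ennreal v \<le> ennreal M * (\<Sum>k. ennreal (D k ^ card J))" unfolding eq by simp
    then have "ennreal (1 / M) * ennreal v \<le> ennreal (1 / M) * (ennreal M * (\<Sum>k. ennreal (D k ^ card J)))"
      by (rule mult_left_mono) simp
    also have "\<dots> = (\<Sum>k. ennreal (D k ^ card J))"
      using M by (simp add: mult.assoc[symmetric] ennreal_mult[symmetric])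
    also have "ennreal (1 / M) * ennreal v = ennreal (v / M)"
      using v M by (simp add: ennreal_mult[symmetric])
    finally show "ennreal (v / M) \<le> (\<Sum>k. ennreal (diameter (U k) ^ card J))" by (simp add: D_def)
  qed (use v M in simp)
qed

text \<open>Sliding along the axis to a point of \<open>A\<close> keeps the other coordinates, so
  the projection of \<open>A\<close> to them contains an open box.\<close>

lemma hausdorff_dim_ge_lines:
  fixes A :: "(real^'n::finite) set"
  assumes A: "\<And>x. x \<in> open_unit_cube \<Longrightarrow> \<exists>t. x + t *\<^sub>R axis j 1 \<in> A"
  shows "ereal (real CARD('n) - 1) \<le> hausdorff_dim A"
proof -
  have "ereal (real (card (UNIV - {j}))) \<le> hausdorff_dim A"
  proof (rule hausdorff_dim_ge_box)
    show "(0 :: real^'n) $ i < 1 $ i" for i by simp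
    fix x :: "real^'n" assume "x \<in> open_unit_cube"
    then obtain t where "x + t *\<^sub>R axis j 1 \<in> A" using A by blast
    then show "\<exists>z\<in>A. \<forall>i\<in>UNIV - {j}. z $ i = x $ i"
      by (intro bexI[of _ "x + t *\<^sub>R axis j 1"]) (auto simp: axis_def)
  qed
  then show ?thesis by (simp add: card_Diff_singleton of_nat_diff)
qed

lemma hausdorff_dim_ge_open:
  fixes A :: "(real^'n::finite) set"
  assumes "open V" "V \<noteq> {}" "V \<subseteq> A"
  shows "ereal (real CARD('n)) \<le> hausdorff_dim A"
proof -
  obtain x where x: "x \<in> V" using assms by blast
  obtain l u where lu: "cbox l u \<subseteq> V" "x \<in> box l u" "\<forall>i\<in>Basis. l \<bullet> i < u \<bullet> i"
    by (rule open_contains_cbox[OF assms(1) x])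
  show ?thesis
  proof (rule hausdorff_dim_ge_box)
    show "l $ i < u $ i" for i using lu(2) unfolding mem_box_cart by (meson less_trans)
    show "\<exists>z\<in>A. \<forall>i\<in>UNIV. z $ i = y $ i" if "y \<in> box l u" for y
      using that lu(1) assms(3) box_subset_cbox by blast
  qed
qed

section \<open>Box counting\<close>

text \<open>An upper box dimension bound with one constant for all scales. Since the scale stays
  free, the radius can be enlarged to absorb a neighbourhood and the scale chosen
  afterwards.\<close>

definition box_covered :: "nat \<Rightarrow> 'a::metric_space set \<Rightarrow> bool" where
  "box_covered m A \<longleftrightarrow>
     (\<exists>C. \<forall>N\<ge>1. \<exists>P. finite P \<and> card P \<le> C * real N ^ m \<and> A \<subseteq> (\<Union>p\<in>P. cball p (C / real N)))"

lemma box_coveredE: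
  assumes "box_covered m A"
  obtains C where "C \<ge> 0"
    "\<And>N. N \<ge> 1 \<Longrightarrow> \<exists>P. finite P \<and> card P \<le> C * real N ^ m \<and> A \<subseteq> (\<Union>p\<in>P. cball p (C / real N))"
proof -
  obtain C where C: "\<And>N. N \<ge> 1 \<Longrightarrow> \<exists>P. finite P \<and> card P \<le> C * real N ^ m \<and> A \<subseteq> (\<Union>p\<in>P. cball p (C / real N))"
    using assms unfolding box_covered_def by blast
  from C[of 1] obtain P :: "'a set" where "card P \<le> C" by auto
  then have "C \<ge> 0" using of_nat_0_le_iff order_trans by blast
  then show ?thesis using that C by blast
qed

lemma box_covered_mono: "box_covered m A \<Longrightarrow> B \<subseteq> A \<Longrightarrow> box_covered m B"
  unfolding box_covered_def by (meson subset_trans)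

lemma box_covered_mono_dim:
  assumes "box_covered m A" and mk: "m \<le> k"
  shows "box_covered k A"
proof -
  obtain C where C: "C \<ge> 0" "\<And>N. N \<ge> 1 \<Longrightarrow>
      \<exists>P. finite P \<and> card P \<le> C * real N ^ m \<and> A \<subseteq> (\<Union>p\<in>P. cball p (C / real N))"
    using box_coveredE[OF assms(1)] by blast
  show ?thesis
    unfolding box_covered_def
  proof (intro exI[of _ C] allI impI)
    fix N :: nat assume N: "N \<ge> 1"
    obtain P where P: "finite P" "card P \<le> C * real N ^ m" "A \<subseteq> (\<Union>p\<in>P. cball p (C / real N))"
      using C(2)[OF N] by blast
    have "C * real N ^ m \<le> C * real N ^ k"
      using C(1) mk N by (intro mult_left_mono power_increasing) auto
    then show "\<exists>P. finite P \<and> card P \<le> C * real N ^ k \<and> A \<subseteq> (\<Union>p\<in>P. cball p (C / real N))"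
      using P by (intro exI[of _ P]) simp
  qed
qed

lemma box_covered_empty: "box_covered m {}"
  unfolding box_covered_def by (rule exI[of _ 0]) (auto intro: exI[of _ "{}"])

lemma box_covered_Un:
  assumes "box_covered m A" "box_covered m B"
  shows "box_covered m (A \<union> B)"
proof -
  obtain C where C: "C \<ge> 0"
    "\<And>N. N \<ge> 1 \<Longrightarrow> \<exists>P. finite P \<and> card P \<le> C * real N ^ m \<and> A \<subseteq> (\<Union>p\<in>P. cball p (C / real N))"
    using box_coveredE[OF assms(1)] by blast
  obtain D where D: "D \<ge> 0"
    "\<And>N. N \<ge> 1 \<Longrightarrow> \<exists>P. finite P \<and> card P \<le> D * real N ^ m \<and> B \<subseteq> (\<Union>p\<in>P. cball p (D / real N))"
    using box_coveredE[OF assms(2)] by blast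
  show ?thesis
    unfolding box_covered_def
  proof (intro exI[of _ "C + D"] allI impI)
    fix N :: nat assume N: "N \<ge> 1"
    obtain P where P: "finite P" "card P \<le> C * real N ^ m" "A \<subseteq> (\<Union>p\<in>P. cball p (C / real N))"
      using C(2)[OF N] by blast
    obtain R where R: "finite R" "card R \<le> D * real N ^ m" "B \<subseteq> (\<Union>p\<in>R. cball p (D / real N))"
      using D(2)[OF N] by blast
    have "real (card (P \<union> R)) \<le> real (card P) + real (card R)"
      using card_Un_le[of P R] by (metis of_nat_add of_nat_mono)
    then have "card (P \<union> R) \<le> (C + D) * real N ^ m" using P R by (simp add: distrib_right)
    moreover have "C / real N \<le> (C + D) / real N" "D / real N \<le> (C + D) / real N"
      using C(1) D(1) by (simp_all add: divide_right_mono)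
    then have "cball p (C / real N) \<subseteq> cball p ((C + D) / real N)"
      "cball p (D / real N) \<subseteq> cball p ((C + D) / real N)" for p :: 'a
      using subset_cball by blast+
    then have "A \<union> B \<subseteq> (\<Union>p\<in>P \<union> R. cball p ((C + D) / real N))"
      using order_trans[OF P(3) UN_mono] order_trans[OF R(3) UN_mono] by (simp add: UN_Un sup.coboundedI1 sup.coboundedI2)
    ultimately show "\<exists>P. finite P \<and> card P \<le> (C + D) * real N ^ m \<and>
        A \<union> B \<subseteq> (\<Union>p\<in>P. cball p ((C + D) / real N))"
      using P(1) R(1) by blast
  qed
qed

lemma box_covered_Union:
  assumes "finite I" "\<And>i. i \<in> I \<Longrightarrow> box_covered m (F i)"
  shows "box_covered m (\<Union>i\<in>I. F i)"
  using assms by (induction I rule: finite_induct) (auto intro: box_covered_Un box_covered_empty)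

lemma box_covered_finite: "finite A \<Longrightarrow> box_covered 0 A"
  unfolding box_covered_def by (rule exI[of _ "real (card A)"]) (force intro: exI[of _ A])

text \<open>Joining a new vertex \<open>a\<close> multiplies the number of balls by about
  \<open>N\<close>: the weight of \<open>a\<close> is rounded down to a multiple of
  \<open>1 / N\<close>, and the other end is replaced by a centre of the old cover.\<close>

lemma box_covered_convex_hull:
  fixes T :: "'a::real_normed_vector set"
  assumes "finite T" "T \<noteq> {}"
  shows "box_covered (card T - 1) (convex hull T)"
  using assms
proof (induction T rule: finite_ne_induct)
  case (singleton x)
  then show ?case by (simp add: box_covered_finite)
next
  case (insert a T)
  define m where "m = card T - 1"
  have m: "card (insert a T) - 1 = Suc m"
    using insert by (simp add: m_def card_gt_0_iff)
  obtain C where C: "C \<ge> 0" "\<And>N. N \<ge> 1 \<Longrightarrow> \<exists>P. finite P \<and> card P \<le> C * real N ^ m \<and>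
      convex hull T \<subseteq> (\<Union>p\<in>P. cball p (C / real N))"
    using box_coveredE insert.IH m_def by metis
  obtain R where R: "\<And>b. b \<in> convex hull T \<Longrightarrow> norm (a - b) \<le> R"
  proof -
    have "bounded (convex hull T)" using insert(1) by (intro bounded_convex_hull finite_imp_bounded)
    then obtain e where "\<forall>b\<in>convex hull T. dist a b \<le> e" using bounded_any_center by blast
    then show ?thesis using that[of e] by (simp add: dist_norm)
  qed
  have R0: "R \<ge> 0"
  proof -
    obtain t where "t \<in> T" using insert(2) by blast
    then have "norm (a - t) \<le> R" using R hull_inc by metis
    then show ?thesis using norm_ge_zero order_trans by blast
  qed
  show ?case
    unfolding box_covered_def m
  \<comment> \<open>The count needs \<open>2 * C\<close>, from \<open>N + 1 \<le> 2 * N\<close>; the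
    distance needs \<open>R + C\<close>, where \<open>R\<close> bounds the distance from
    \<open>a\<close> to the old hull.\<close>
  proof (intro exI[of _ "2 * C + R"] allI impI)
    fix N :: nat assume N: "N \<ge> 1"
    obtain P where P: "finite P" "card P \<le> C * real N ^ m" "convex hull T \<subseteq> (\<Union>p\<in>P. cball p (C / real N))"
      using C(2)[OF N] by blast
    define q where "q = (\<lambda>(i::nat, p). (i / N) *\<^sub>R a + (1 - i / N) *\<^sub>R p)"
    let ?Q = "q ` ({..N} \<times> P)"
    have "card ?Q \<le> card ({..N} \<times> P)" using P(1) by (intro card_image_le) auto
    then have "real (card ?Q) \<le> (real N + 1) * card P"
      by (metis card_atMost card_cartesian_product of_nat_Suc of_nat_le_iff of_nat_mult add.commute)
    also have "\<dots> \<le> (2 * real N) * (C * real N ^ m)"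
      using N P(2) C(1) by (intro mult_mono) auto
    also have "\<dots> \<le> (2 * C + R) * real N ^ Suc m" using R0 by (simp add: distrib_right)
    finally have "card ?Q \<le> (2 * C + R) * real N ^ Suc m" .
    moreover have "convex hull (insert a T) \<subseteq> (\<Union>p\<in>?Q. cball p ((2 * C + R) / real N))"
    proof
      fix x assume "x \<in> convex hull (insert a T)"
      then obtain u v b where uv: "u \<ge> 0" "v \<ge> 0" "u + v = 1" "b \<in> convex hull T" "x = u *\<^sub>R a + v *\<^sub>R b"
        unfolding convex_hull_insert[OF insert(2)] by blast
      obtain p where p: "p \<in> P" "dist p b \<le> C / real N" using P(3) uv(4) by auto
      define i where "i = nat \<lfloor>u * N\<rfloor>"
      have i: "real i \<le> u * N" "u * N < real i + 1" using uv(1) unfolding i_def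
        by (auto simp: of_nat_nat)
      have "u * real N \<le> 1 * real N" using uv by (intro mult_right_mono) auto
      then have iN: "i \<le> N" using i(1) by linarith
      have "u - i / N = (u * N - i) / N" using N by (simp add: field_simps)
      also have "\<bar>\<dots>\<bar> \<le> 1 / N"
        unfolding abs_divide using i by (simp add: divide_right_mono abs_le_iff)
      finally have d: "\<bar>u - i / N\<bar> \<le> 1 / N" "0 \<le> 1 - i / N" "1 - i / N \<le> 1"
        using N iN by (auto simp: field_simps)
      have v: "v = 1 - u" using uv(3) by simp
      have "x - q (i, p) = (u - i / N) *\<^sub>R (a - b) + (1 - i / N) *\<^sub>R (b - p)"
        by (simp add: uv(5) q_def v algebra_simps)
      then have "norm (x - q (i, p)) \<le> \<bar>u - i / N\<bar> * norm (a - b) + (1 - i / N) * norm (b - p)"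
        using norm_triangle_ineq[of "(u - i / N) *\<^sub>R (a - b)" "(1 - i / N) *\<^sub>R (b - p)"] d(2) by simp
      also have "\<dots> \<le> (1 / N) * R + 1 * (C / N)"
        using d R[OF uv(4)] p(2) C(1) by (intro add_mono mult_mono) (auto simp: dist_norm norm_minus_commute)
      also have "\<dots> \<le> (2 * C + R) / N" using C(1) N by (simp add: field_simps)
      finally have "x \<in> cball (q (i, p)) ((2 * C + R) / N)" by (simp add: dist_norm norm_minus_commute)
      moreover have "q (i, p) \<in> ?Q" using iN p(1) by simp
      ultimately show "x \<in> (\<Union>p\<in>?Q. cball p ((2 * C + R) / real N))" by blast
    qed
    ultimately show "\<exists>P. finite P \<and> card P \<le> (2 * C + R) * real N ^ Suc m \<and>
        convex hull (insert a T) \<subseteq> (\<Union>p\<in>P. cball p ((2 * C + R) / real N))"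
      using P(1) by (intro exI[of _ ?Q]) simp
  qed
qed

text \<open>A grid in the free coordinates. Those outside \<open>J\<close> are pinned to
  \<open>a\<close>, so that the cube and its faces are handled together.\<close>

lemma box_covered_face:
  fixes a :: "real^'n::finite"
  shows "box_covered (card J) {x. \<forall>k. if k \<in> J then 0 \<le> x $ k \<and> x $ k \<le> 1 else x $ k = a $ k}"
    (is "box_covered _ ?A")
proof -
  \<comment> \<open>The power of 2 comes from \<open>Suc N \<le> 2 * N\<close> in each free
    coordinate, \<open>CARD('n)\<close> from bounding the norm by the sum of the
    coordinates.\<close>
  define C where "C = real (2 ^ card J) + CARD('n)"
  show ?thesis
    unfolding box_covered_def
  proof (intro exI[of _ C] allI impI)
    fix N :: nat assume N: "N \<ge> 1"
    define q where "q i = (\<chi> k. if k \<in> J then real (i k) / N else a $ k)" for i :: "'n \<Rightarrow> nat"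
    let ?I = "J \<rightarrow>\<^sub>E {..N}"
    have fI: "finite ?I" by (auto intro: finite_PiE)
    have "card (q ` ?I) \<le> card ?I" using fI by (rule card_image_le)
    also have "card ?I = Suc N ^ card J" by (simp add: card_PiE)
    also have "\<dots> \<le> (2 * N) ^ card J" using N by (intro power_mono) auto
    finally have "real (card (q ` ?I)) \<le> real ((2 * N) ^ card J)" using of_nat_mono by blast
    also have "\<dots> = real (2 ^ card J) * real N ^ card J" by (simp add: power_mult_distrib)
    also have "\<dots> \<le> C * real N ^ card J" by (intro mult_right_mono) (auto simp: C_def)
    finally have "card (q ` ?I) \<le> C * real N ^ card J" .
    moreover have "?A \<subseteq> (\<Union>p\<in>q ` ?I. cball p (C / real N))"
    proof
      fix x assume x: "x \<in> ?A"
      define i where "i = restrict (\<lambda>k. nat \<lfloor>x $ k * N\<rfloor>) J"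
      have i: "real (i k) \<le> x $ k * N" "x $ k * N < real (i k) + 1" "i k \<le> N" if "k \<in> J" for k
      proof -
        have xk: "0 \<le> x $ k" "x $ k \<le> 1" using x that by auto
        then show *: "real (i k) \<le> x $ k * N" "x $ k * N < real (i k) + 1"
          using that by (auto simp: i_def)
        have "x $ k * real N \<le> 1 * real N" using xk by (intro mult_right_mono) auto
        then show "i k \<le> N" using * by linarith
      qed
      have "\<bar>(q i - x) $ k\<bar> \<le> 1 / N" for k
      proof (cases "k \<in> J")
        case True
        have "(q i - x) $ k = (real (i k) - x $ k * N) / N"
          using True N by (simp add: q_def field_simps)
        also have "\<bar>\<dots>\<bar> \<le> 1 / N"
          unfolding abs_divide using i[OF True] by (simp add: divide_right_mono abs_le_iff)
        finally show ?thesis .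
      next
        case False
        then show ?thesis using x by (simp add: q_def)
      qed
      then have "norm (q i - x) \<le> (\<Sum>k\<in>(UNIV::'n set). 1 / N)"
        by (intro order_trans[OF norm_le_l1_cart] sum_mono)
      also have "\<dots> \<le> C / N" by (simp add: C_def divide_right_mono)
      finally have "x \<in> cball (q i) (C / N)" by (simp add: dist_norm)
      moreover have "i \<in> ?I" using i by (auto simp: i_def)
      ultimately show "x \<in> (\<Union>p\<in>q ` ?I. cball p (C / real N))" by blast
    qed
    ultimately show "\<exists>P. finite P \<and> card P \<le> C * real N ^ card J \<and> ?A \<subseteq> (\<Union>p\<in>P. cball p (C / real N))"
      using fI by blast
  qed
qed

lemma box_covered_frontier_cube:
  "box_covered (CARD('n) - 1) (frontier unit_cube :: (real^'n::finite) set)"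
proof -
  let ?F = "\<lambda>(j, a). {x::real^'n. \<forall>k. if k \<in> UNIV - {j} then 0 \<le> x $ k \<and> x $ k \<le> 1 else x $ k = (\<chi> i. a) $ k}"
  have "box_covered (CARD('n) - 1) (\<Union>i\<in>UNIV \<times> {0,1}. ?F i)"
  proof (rule box_covered_Union)
    fix i :: "'n \<times> real"
    show "box_covered (CARD('n) - 1) (?F i)"
      using box_covered_face[of "UNIV - {fst i}" "\<chi> k. snd i"]
      by (simp only: card_Diff_singleton case_prod_beta UNIV_I if_True)
  qed simp
  moreover have "frontier unit_cube \<subseteq> (\<Union>i\<in>UNIV \<times> {0,1}. ?F i)"
  proof
    fix x :: "real^'n" assume "x \<in> frontier unit_cube"
    then have x: "x \<in> unit_cube" "x \<notin> open_unit_cube" by (auto simp: frontier_cbox)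
    then obtain j where j: "\<not> (0 < x $ j \<and> x $ j < 1)" by (auto simp: mem_box_cart)
    have xj: "0 \<le> x $ k \<and> x $ k \<le> 1" for k using x(1) by (simp add: mem_box_cart)
    then have "x $ j \<in> {0, 1}" using j xj[of j] by force
    then have "(j, x $ j) \<in> UNIV \<times> {0, 1}" "x \<in> ?F (j, x $ j)" using xj by auto
    then show "x \<in> (\<Union>i\<in>UNIV \<times> {0,1}. ?F i)" by blast
  qed
  ultimately show ?thesis by (rule box_covered_mono)
qed

lemma box_covered_cube: "box_covered CARD('n) (unit_cube :: (real^'n::finite) set)"
  using box_covered_face[of "UNIV :: 'n set"]
  by (rule box_covered_mono) (auto simp: mem_box_cart)

text \<open>Enlarging the radius from \<open>C / N\<close> to \<open>(C + 1) / N\<close> covers the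
  \<open>1 / N\<close>-neighbourhood, and the sum with exponent \<open>m + e\<close> is at most
  \<open>K * real N powr (- e)\<close>, which tends to 0.\<close>

lemma box_covered_neighbourhood:
  assumes "box_covered m A"
  obtains \<eta> where "\<eta> > 0" "coverable m n {x. \<exists>a\<in>A. dist x a < \<eta>}"
proof -
  obtain C where C: "C \<ge> 0" "\<And>N. N \<ge> 1 \<Longrightarrow>
      \<exists>P. finite P \<and> card P \<le> C * real N ^ m \<and> A \<subseteq> (\<Union>p\<in>P. cball p (C / real N))"
    using box_coveredE[OF assms] by blast
  define e where "e = 1 / real (Suc n)"
  have e: "e > 0" by (simp add: e_def)
  define K where "K = C * (2 * (C + 1)) powr (m + e)"
  have "(\<lambda>N. K * real N powr (- e)) \<longlonglongrightarrow> K * 0"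
    by (intro tendsto_intros tendsto_neg_powr filterlim_real_sequentially) (use e in simp)
  then have 1: "\<forall>\<^sub>F N in sequentially. K * real N powr (- e) < e"
    using e by (simp add: order_tendstoD(2))
  have "(\<lambda>N. (2 * (C + 1)) * inverse (real N)) \<longlonglongrightarrow> (2 * (C + 1)) * 0"
    by (intro tendsto_intros lim_inverse_n)
  then have 2: "\<forall>\<^sub>F N in sequentially. (2 * (C + 1)) * inverse (real N) < e"
    using e by (simp add: order_tendstoD(2))
  from eventually_conj[OF eventually_conj[OF 1 2] eventually_ge_at_top[of 1]]
  obtain N where N: "K * real N powr (- e) < e" "(2 * (C + 1)) * inverse (real N) < e" "N \<ge> 1"
    by (auto simp: eventually_sequentially)
  obtain P where P: "finite P" "card P \<le> C * real N ^ m" "A \<subseteq> (\<Union>p\<in>P. cball p (C / real N))"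
    using C(2)[OF N(3)] by blast
  define \<eta> where "\<eta> = (C + 1) / N"
  have \<eta>: "\<eta> > 0" "2 * \<eta> \<le> e" using N C(1) by (auto simp: \<eta>_def field_simps)
  show ?thesis
  proof (rule that[of "1 / N"])
    show "1 / real N > 0" using N by simp
    have "{x. \<exists>a\<in>A. dist x a < 1 / real N} \<subseteq> (\<Union>p\<in>P. cball p \<eta>)"
    proof clarify
      fix x a assume a: "a \<in> A" "dist x a < 1 / real N"
      then obtain p where p: "p \<in> P" "dist p a \<le> C / N" using P(3) by auto
      then have "dist p x \<le> \<eta>"
        using a(2) dist_triangle2[of p x a] by (simp add: \<eta>_def add_divide_distrib dist_commute)
      then show "x \<in> (\<Union>p\<in>P. cball p \<eta>)" using p(1) by auto
    qed
    moreover have "card P * (2 * \<eta>) powr (m + e) \<le> e"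
    proof -
      have "card P * (2 * \<eta>) powr (m + e) \<le> (C * real N ^ m) * (2 * \<eta>) powr (m + e)"
        using P(2) by (rule mult_right_mono) simp
      also have "\<dots> = C * real N ^ m * ((2 * (C + 1)) powr (m + e) / (real N ^ m * real N powr e))"
      proof -
        have "real N powr (m + e) = real N ^ m * real N powr e"
          using N by (simp add: powr_add powr_realpow)
        then show ?thesis using C(1) by (simp add: \<eta>_def powr_divide)
      qed
      also have "\<dots> = K * real N powr (- e)"
        using N by (simp add: K_def powr_minus field_simps)
      finally show ?thesis using N(1) by linarith
    qed
    ultimately show "coverable m n {x. \<exists>a\<in>A. dist x a < 1 / real N}"
      unfolding coverable_def using P(1) \<eta> unfolding e_def by blast
  qed
qed

lemma box_covered_imp_coverable: "box_covered m A \<Longrightarrow> coverable m n A"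
proof -
  assume "box_covered m A"
  then obtain \<eta> where "\<eta> > 0" "coverable m n {x. \<exists>a\<in>A. dist x a < \<eta>}"
    using box_covered_neighbourhood by blast
  moreover from \<open>\<eta> > 0\<close> have "A \<subseteq> {x. \<exists>a\<in>A. dist x a < \<eta>}" by force
  ultimately show ?thesis using coverable_mono by blast
qed

section \<open>Polynomials and pointwise Hoelder regularity\<close>

lemma abs_mult_mono: "\<bar>a\<bar> \<le> A \<Longrightarrow> \<bar>b\<bar> \<le> B \<Longrightarrow> \<bar>a * b\<bar> \<le> A * B" for a b A B :: real
  unfolding abs_mult by (rule mult_mono) (auto intro: order_trans[OF abs_ge_zero])

text \<open>A second order Taylor bound without derivatives. Values, first differences and symmetric
  second differences are carried together because the product rule for the last uses all
  three.\<close>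

definition taylor_bounded :: "real \<Rightarrow> ('a::real_normed_vector \<Rightarrow> real) \<Rightarrow> real \<Rightarrow> bool" where
  "taylor_bounded B p K \<longleftrightarrow> K \<ge> 0 \<and> (\<forall>x v. norm x \<le> B \<longrightarrow> \<bar>p x\<bar> \<le> K \<and>
     (norm (x + v) \<le> B \<longrightarrow> \<bar>p (x + v) - p x\<bar> \<le> K * norm v \<and>
       (norm (x - v) \<le> B \<longrightarrow> \<bar>p (x + v) + p (x - v) - 2 * p x\<bar> \<le> K * (norm v)\<^sup>2)))"

lemma taylor_boundedD:
  assumes "taylor_bounded B p K"
  shows "K \<ge> 0"
    "norm x \<le> B \<Longrightarrow> \<bar>p x\<bar> \<le> K"
    "norm x \<le> B \<Longrightarrow> norm (x + v) \<le> B \<Longrightarrow> \<bar>p (x + v) - p x\<bar> \<le> K * norm v"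
    "norm x \<le> B \<Longrightarrow> norm (x + v) \<le> B \<Longrightarrow> norm (x - v) \<le> B \<Longrightarrow>
       \<bar>p (x + v) + p (x - v) - 2 * p x\<bar> \<le> K * (norm v)\<^sup>2"
  using assms unfolding taylor_bounded_def by blast+

lemma real_polynomial_function_taylor_bounded:
  assumes "real_polynomial_function p"
  obtains K where "taylor_bounded B p K"
proof -
  have "\<exists>K. taylor_bounded B p K"
    using assms
  proof induction
    case (linear f)
    interpret bounded_linear f by fact
    obtain K where K: "K \<ge> 0" "\<And>x. \<bar>f x\<bar> \<le> norm x * K" using nonneg_bounded by auto
    have "\<bar>f x\<bar> \<le> K * (\<bar>B\<bar> + 1)" if "norm x \<le> B" for x
    proof -
      have "norm x * K \<le> (\<bar>B\<bar> + 1) * K" using that K by (intro mult_right_mono) auto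
      then show ?thesis using K(2)[of x] by (simp add: mult.commute)
    qed
    moreover have "\<bar>f (x + v) - f x\<bar> \<le> K * (\<bar>B\<bar> + 1) * norm v" for x v
    proof -
      have "norm v * K * 1 \<le> norm v * K * (\<bar>B\<bar> + 1)" using K by (intro mult_left_mono) auto
      then show ?thesis using K(2)[of v] by (simp add: add mult_ac)
    qed
    moreover have "f (x + v) + f (x - v) - 2 * f x = 0" for x v by (simp add: add diff)
    ultimately show ?case
      using K unfolding taylor_bounded_def by (intro exI[of _ "K * (\<bar>B\<bar> + 1)"]) auto
  next
    case (const c)
    then show ?case unfolding taylor_bounded_def by (intro exI[of _ "\<bar>c\<bar>"]) auto
  next
    case (add f g)
    then obtain K L where K: "taylor_bounded B f K" and L: "taylor_bounded B g L" by blast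
    note f = taylor_boundedD[OF K] and g = taylor_boundedD[OF L]
    show ?case
      unfolding taylor_bounded_def
    proof (intro exI[of _ "K + L"] conjI allI impI)
      fix x v :: 'a
      assume x: "norm x \<le> B"
      show "\<bar>f x + g x\<bar> \<le> K + L" using f(2)[OF x] g(2)[OF x] by linarith
      assume v: "norm (x + v) \<le> B"
      show "\<bar>f (x + v) + g (x + v) - (f x + g x)\<bar> \<le> (K + L) * norm v"
        unfolding distrib_right using f(3)[OF x v] g(3)[OF x v] by linarith
      assume v': "norm (x - v) \<le> B"
      show "\<bar>f (x + v) + g (x + v) + (f (x - v) + g (x - v)) - 2 * (f x + g x)\<bar> \<le> (K + L) * (norm v)\<^sup>2"
        using f(4)[OF x v v'] g(4)[OF x v v'] unfolding distrib_right distrib_left abs_le_iff by linarith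
    qed (use f(1) g(1) in simp)
  next
    case (mult f g)
    then obtain K L where K: "taylor_bounded B f K" and L: "taylor_bounded B g L" by blast
    note f = taylor_boundedD[OF K] and g = taylor_boundedD[OF L]
    show ?case
      unfolding taylor_bounded_def
    \<comment> \<open>The second difference of a product splits into four terms, each at most
      \<open>K * L * (norm v)\<^sup>2\<close> in absolute value.\<close>
    proof (intro exI[of _ "4 * (K * L)"] conjI allI impI)
      show "0 \<le> 4 * (K * L)" using f(1) g(1) by simp
      fix x v :: 'a
      assume x: "norm x \<le> B"
      have "\<bar>f x * g x\<bar> \<le> K * L" by (rule abs_mult_mono[OF f(2)[OF x] g(2)[OF x]])
      then show "\<bar>f x * g x\<bar> \<le> 4 * (K * L)" using f(1) g(1) by (smt (verit) mult_nonneg_nonneg)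
      assume v: "norm (x + v) \<le> B"
      have "\<bar>f (x + v) * (g (x + v) - g x)\<bar> \<le> K * (L * norm v)" "\<bar>g x * (f (x + v) - f x)\<bar> \<le> L * (K * norm v)"
        using abs_mult_mono[OF f(2)[OF v] g(3)[OF x v]] abs_mult_mono[OF g(2)[OF x] f(3)[OF x v]] by auto
      moreover have "f (x + v) * g (x + v) - f x * g x = f (x + v) * (g (x + v) - g x) + g x * (f (x + v) - f x)"
        by (simp add: algebra_simps)
      moreover have "0 \<le> K * (L * norm v)" using f(1) g(1) by simp
      ultimately show "\<bar>f (x + v) * g (x + v) - f x * g x\<bar> \<le> 4 * (K * L) * norm v"
        by (simp add: abs_le_iff mult_ac)
      assume v': "norm (x - v) \<le> B"
      have neg: "\<bar>f (x - v) - f x\<bar> \<le> K * norm v" "\<bar>g (x - v) - g x\<bar> \<le> L * norm v"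
        using f(3)[OF x, of "- v"] g(3)[OF x, of "- v"] v' by simp_all
      have "\<bar>f x * (g (x + v) + g (x - v) - 2 * g x)\<bar> \<le> K * (L * (norm v)\<^sup>2)"
        "\<bar>g x * (f (x + v) + f (x - v) - 2 * f x)\<bar> \<le> L * (K * (norm v)\<^sup>2)"
        "\<bar>(f (x + v) - f x) * (g (x + v) - g x)\<bar> \<le> (K * norm v) * (L * norm v)"
        "\<bar>(f (x - v) - f x) * (g (x - v) - g x)\<bar> \<le> (K * norm v) * (L * norm v)"
        using abs_mult_mono[OF f(2)[OF x] g(4)[OF x v v']] abs_mult_mono[OF g(2)[OF x] f(4)[OF x v v']]
          abs_mult_mono[OF f(3)[OF x v] g(3)[OF x v]] abs_mult_mono[OF neg] by auto
      moreover have "f (x + v) * g (x + v) + f (x - v) * g (x - v) - 2 * (f x * g x) =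
          f x * (g (x + v) + g (x - v) - 2 * g x) + g x * (f (x + v) + f (x - v) - 2 * f x) +
          (f (x + v) - f x) * (g (x + v) - g x) + (f (x - v) - f x) * (g (x - v) - g x)"
        by (simp add: algebra_simps)
      moreover have "L * (K * (norm v)\<^sup>2) = K * (L * (norm v)\<^sup>2)" "(K * norm v) * (L * norm v) = K * (L * (norm v)\<^sup>2)"
         "4 * (K * L) * (norm v)\<^sup>2 = 4 * (K * (L * (norm v)\<^sup>2))"
        by (simp_all add: power2_eq_square)
      ultimately show "\<bar>f (x + v) * g (x + v) + f (x - v) * g (x - v) - 2 * (f x * g x)\<bar> \<le> 4 * (K * L) * (norm v)\<^sup>2"
        by linarith
    qed
  qed
  then show ?thesis using that by blast
qed

lemma real_polynomial_function_mpoly_eval: "real_polynomial_function (mpoly_eval n c)"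
  unfolding mpoly_eval_def
  by (intro real_polynomial_function_sum finite_multi_indices real_polynomial_function.intros(4)
      real_polynomial_function_prod real_polynomial_function_power finite
      real_polynomial_function.intros(2) real_polynomial_function.intros(1)[OF bounded_linear_vec_nth])

text \<open>Only the zero multi-index and the unit multi-indices \<open>e k\<close> get
  coefficients; both kinds have degree at most 1. This makes locally affine points Hoelder of every
  positive integer order.\<close>

lemma mpoly_eval_affine:
  fixes a :: "real^'n::finite"
  assumes "1 \<le> m"
  obtains c where "\<And>z. mpoly_eval m c z = b + a \<bullet> z"
proof -
  define e where "e k = (\<lambda>i. if i = k then 1 else 0 :: nat)" for k :: 'n
  define c where "c \<alpha> = (if \<alpha> = (\<lambda>_. 0) then b else 0) + (\<Sum>k\<in>UNIV. if \<alpha> = e k then a $ k else 0)" for \<alpha>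
  have "mpoly_eval m c z = b + a \<bullet> z" for z
  proof -
    let ?I = "{\<alpha> :: 'n \<Rightarrow> nat. (\<Sum>k\<in>UNIV. \<alpha> k) \<le> m}"
    let ?m = "\<lambda>\<alpha>::'n \<Rightarrow> nat. \<Prod>k\<in>UNIV. (z $ k) ^ \<alpha> k"
    have fin: "finite ?I" by (rule finite_multi_indices)
    have e: "e k \<in> ?I" for k using assms by (simp add: e_def)
    have me: "?m (e k) = z $ k" for k
    proof -
      have "?m (e k) = (\<Prod>i\<in>UNIV. if i = k then z $ k else 1)" by (rule prod.cong) (auto simp: e_def)
      then show ?thesis by simp
    qed
    have "mpoly_eval m c z = (\<Sum>\<alpha>\<in>?I. (if \<alpha> = (\<lambda>_. 0) then b * ?m \<alpha> else 0)
        + (\<Sum>k\<in>UNIV. if \<alpha> = e k then a $ k * ?m \<alpha> else 0))"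
      unfolding mpoly_eval_def c_def
      by (intro sum.cong refl) (auto simp: distrib_right sum_distrib_right intro!: sum.cong)
    also have "\<dots> = b + (\<Sum>k\<in>UNIV. \<Sum>\<alpha>\<in>?I. if \<alpha> = e k then a $ k * ?m \<alpha> else 0)"
      unfolding sum.distrib by (subst sum.swap) (simp add: fin sum.delta)
    also have "(\<Sum>k\<in>UNIV. \<Sum>\<alpha>\<in>?I. if \<alpha> = e k then a $ k * ?m \<alpha> else 0) = (\<Sum>k\<in>UNIV. a $ k * z $ k)"
      using e by (intro sum.cong refl) (simp add: fin sum.delta me del: mem_Collect_eq)
    finally show ?thesis by (simp add: inner_vec_def)
  qed
  then show ?thesis using that by blast
qed

lemma mpoly_eval_const: "mpoly_eval n (\<lambda>\<alpha>. if \<alpha> = (\<lambda>_. 0) then b else 0) z = b"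
  unfolding mpoly_eval_def
  by (subst sum.cong[OF refl, of _ _ "\<lambda>\<alpha>. if \<alpha> = (\<lambda>_. 0) then b else 0"])
     (auto simp: finite_multi_indices sum.delta)

lemma pointwise_hoelder_cong:
  assumes "\<And>x. x \<in> unit_cube \<Longrightarrow> g x = g' x"
  shows "pointwise_hoelder g h x = pointwise_hoelder g' h x"
  unfolding pointwise_hoelder_def by (simp add: assms cong: imp_cong)

lemma hoelder_exponent_cong:
  assumes "\<And>x. x \<in> unit_cube \<Longrightarrow> g x = g' x"
  shows "hoelder_exponent g x = hoelder_exponent g' x"
proof -
  have "pointwise_hoelder g h x = pointwise_hoelder g' h x" for h
    by (rule pointwise_hoelder_cong) (rule assms)
  then show ?thesis by (simp add: hoelder_exponent_def)
qed

lemma mpoly_eval_uminus: "mpoly_eval n (\<lambda>\<alpha>. - c \<alpha>) z = - mpoly_eval n c z"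
  by (simp add: mpoly_eval_def sum_negf)

lemma pointwise_hoelder_uminus:
  assumes "pointwise_hoelder g h x"
  shows "pointwise_hoelder (\<lambda>x. - g x) h x"
proof -
  obtain c C where c: "\<forall>\<^sub>F x' in nhds x. x' \<in> unit_cube \<longrightarrow>
        \<bar>g x' - mpoly_eval (nat \<lfloor>h\<rfloor>) c (x' - x)\<bar> \<le> C * norm (x' - x) powr h"
    using assms unfolding pointwise_hoelder_def by blast
  show ?thesis
    unfolding pointwise_hoelder_def
    by (rule exI[of _ "\<lambda>\<alpha>. - c \<alpha>"], rule exI[of _ C], rule eventually_mono[OF c])
      (auto simp: mpoly_eval_uminus abs_minus_commute)
qed

lemma hoelder_exponent_uminus: "hoelder_exponent (\<lambda>x. - g x) x = hoelder_exponent g x"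
proof -
  have "pointwise_hoelder (\<lambda>x. - g x) h x = pointwise_hoelder g h x" for h
    using pointwise_hoelder_uminus[of g h x] pointwise_hoelder_uminus[of "\<lambda>x. - g x" h x] by auto
  then show ?thesis by (simp add: hoelder_exponent_def)
qed

lemma hoelder_exponent_eqI:
  assumes "\<And>h. h > H \<Longrightarrow> \<not> pointwise_hoelder g h x" "pointwise_hoelder g H x" "H \<ge> 0"
  shows "hoelder_exponent g x = ereal H"
  unfolding hoelder_exponent_def
  by (rule Sup_eqI) (use assms in \<open>force simp: not_le[symmetric]\<close>)+

section \<open>Generic conditions\<close>

lemma convex_hull_unit_cube [simp]: "convex hull unit_cube = (unit_cube :: (real^'n::finite) set)"
  by (simp add: hull_same convex_box)

text \<open>The pairs \<open>(a, \<sigma>)\<close> stand for the two faces \<open>x $ j = a\<close> with inward direction \<open>\<sigma>\<close>.\<close>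

definition boundary_steep :: "nat \<Rightarrow> (real^'n::finite \<Rightarrow> real) \<Rightarrow> bool" where
  "boundary_steep n f \<longleftrightarrow>
     (\<exists>t. 0 < t \<and> t < 1 / Suc n \<and>
        (\<forall>j a \<sigma>. (a, \<sigma>) \<in> {(0, 1), (1, -1)} \<longrightarrow>
           (\<forall>w\<in>unit_cube. w $ j = a \<longrightarrow> t powr (1 / Suc n) \<le> f (w + (\<sigma> * t) *\<^sub>R axis j 1) - f w)))"

text \<open>A lower bound is what counts: the envelope majorises \<open>f\<close>, so a kink of the
  envelope over a contact point forces these differences below order \<open>- t\<close>. The scale
  is common to all points because the contact point to be tested is not known in advance.\<close>

definition almost_smooth :: "nat \<Rightarrow> (real^'n::finite \<Rightarrow> real) \<Rightarrow> bool" where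
  "almost_smooth n f \<longleftrightarrow>
     (\<exists>t. 0 < t \<and> t < 1 / Suc n \<and>
        (\<forall>x u. norm u = t \<longrightarrow> x \<in> unit_cube \<longrightarrow> x + u \<in> unit_cube \<longrightarrow> x - u \<in> unit_cube \<longrightarrow>
           - (t / Suc n) \<le> f (x + u) + f (x - u) - 2 * f x))"

definition locally_affine :: "(real^'n::finite \<Rightarrow> real) \<Rightarrow> real^'n \<Rightarrow> bool" where
  "locally_affine g x \<longleftrightarrow>
     (\<exists>\<rho>>0. \<exists>c a. ball x \<rho> \<subseteq> unit_cube \<and> (\<forall>z\<in>ball x \<rho>. g z = c + a \<bullet> z))"

text \<open>The factor \<open>Suc n\<close> defeats every constant and the exponent
  \<open>1 + 1 / Suc n\<close> every Hoelder order above 1. The step \<open>u\<close> may depend on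
  the point.\<close>

definition sharp_bend :: "nat \<Rightarrow> (real^'n::finite \<Rightarrow> real) \<Rightarrow> real^'n \<Rightarrow> bool" where
  "sharp_bend n g x \<longleftrightarrow>
     (\<exists>u. u \<noteq> 0 \<and> norm u < 1 / Suc n \<and> x + u \<in> unit_cube \<and> x - u \<in> unit_cube \<and>
        g (x + u) + g (x - u) - 2 * g x \<le> - (Suc n * norm u powr (1 + 1 / Suc n)))"

text \<open>Bends are demanded only at depth \<open>1 / Suc n\<close> inside the cube, because they
  come from supergradients at interior skeleton points. Every interior point of the cube reaches
  that depth for large \<open>n\<close>.\<close>

definition almost_polyhedral :: "nat \<Rightarrow> (real^'n::finite \<Rightarrow> real) \<Rightarrow> bool" where
  "almost_polyhedral n f \<longleftrightarrow>
     coverable 0 n {x \<in> unit_cube. cenv unit_cube f x = f x} \<and>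
     (\<exists>N. coverable (CARD('n) - 1) n N \<and>
        (\<forall>x\<in>unit_cube. locally_affine (cenv unit_cube f) x \<or>
           x \<in> N \<and> (ball x (1 / Suc n) \<subseteq> unit_cube \<longrightarrow> sharp_bend n (cenv unit_cube f) x)))"

definition generic :: "(real^'n::finite \<Rightarrow> real) \<Rightarrow> bool" where
  "generic f \<longleftrightarrow> continuous_on unit_cube f \<and>
     (\<forall>n. boundary_steep n f \<and> almost_smooth n f \<and> almost_polyhedral n f)"

section \<open>Increments across the faces and elementary estimates\<close>

lemma face_inward_mem:
  fixes w :: "real^'n::finite"
  assumes "(a, \<sigma>) \<in> {(0::real, 1::real), (1, -1)}" "w \<in> unit_cube" "w $ j = a" "0 \<le> t" "t \<le> 1"
  shows "w + (\<sigma> * t) *\<^sub>R axis j 1 \<in> unit_cube"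
  unfolding mem_box_cart
proof
  fix i
  have "0 \<le> w $ i" "w $ i \<le> 1" using assms(2) by (simp_all add: mem_box_cart)
  then show "0 $ i \<le> (w + (\<sigma> * t) *\<^sub>R axis j 1) $ i \<and> (w + (\<sigma> * t) *\<^sub>R axis j 1) $ i \<le> 1 $ i"
    using assms by (cases "i = j") (auto simp: axis_def)
qed

text \<open>A hull point over a face is a combination of graph points over that face, so the
  increments of the function across the face pass to the envelope.\<close>

lemma cenv_face_increment:
  fixes f :: "real^'n::finite \<Rightarrow> real"
  assumes f: "continuous_on unit_cube f" and a: "(a, \<sigma>) \<in> {(0::real, 1::real), (1, -1)}"
    and t: "0 \<le> t" "t \<le> 1"
    and c: "\<And>w. w \<in> unit_cube \<Longrightarrow> w $ j = a \<Longrightarrow> c \<le> f (w + (\<sigma> * t) *\<^sub>R axis j 1) - f w"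
    and w: "w \<in> unit_cube" "w $ j = a"
  shows "c \<le> cenv unit_cube f (w + (\<sigma> * t) *\<^sub>R axis j 1) - cenv unit_cube f w"
proof -
  let ?\<phi> = "cenv unit_cube f"
  define v where "v = (\<sigma> * t) *\<^sub>R axis j (1::real)"
  have vQ: "z + v \<in> unit_cube" if "z \<in> unit_cube" "z $ j = a" for z
    unfolding v_def using face_inward_mem[OF a that t] .
  \<comment> \<open>\<open>C\<close> imposes nothing off the face, and is convex all the same
    because the face is extreme in the cube.\<close>
  define C where "C = {p. fst p \<in> unit_cube \<and> (fst p $ j = a \<longrightarrow> snd p \<le> ?\<phi> (fst p + v) - c)}"
  have conc: "concave_on unit_cube ?\<phi>" using concave_cenv[OF compact_cbox f] by simp
  have "convex C"
  proof (rule convexI)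
    fix p q :: "(real^'n) \<times> real" and r s :: real
    assume p: "p \<in> C" and q: "q \<in> C" and rs: "0 \<le> r" "0 \<le> s" "r + s = 1"
    \<comment> \<open>Only when both weights are positive does a combination on the face force both
      ends onto it; with a zero weight the combination is one of the ends.\<close>
    consider "r = 0" "s = 1" | "s = 0" "r = 1" | "r > 0" "s > 0" using rs by force
    then show "r *\<^sub>R p + s *\<^sub>R q \<in> C"
    proof cases
      case 3
      have pq: "fst p \<in> unit_cube" "fst q \<in> unit_cube" using p q by (auto simp: C_def)
      have "r *\<^sub>R fst p + s *\<^sub>R fst q \<in> unit_cube"
        by (rule convexD[OF convex_box(1)]) (use pq rs in auto)
      moreover have "r * snd p + s * snd q \<le> ?\<phi> (r *\<^sub>R fst p + s *\<^sub>R fst q + v) - c"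
        if "(r *\<^sub>R fst p + s *\<^sub>R fst q) $ j = a"
      proof -
        have b: "0 \<le> fst p $ j" "fst p $ j \<le> 1" "0 \<le> fst q $ j" "fst q $ j \<le> 1"
          using pq by (simp_all add: mem_box_cart)
        have e: "r * fst p $ j + s * fst q $ j = a" using that by simp
        have "fst p $ j = a \<and> fst q $ j = a"
        proof (cases "a = 0")
          case True
          have "0 \<le> r * fst p $ j" "0 \<le> s * fst q $ j" using b rs by simp_all
          then have "r * fst p $ j = 0" "s * fst q $ j = 0" using e True by linarith+
          then show ?thesis using 3 True by simp
        next
          case False
          then have a1: "a = 1" using a by auto
          have "0 \<le> r * (1 - fst p $ j)" "0 \<le> s * (1 - fst q $ j)" using b rs by simp_all
          moreover have "r * (1 - fst p $ j) + s * (1 - fst q $ j) = 0"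
            using e a1 rs(3) by (simp add: right_diff_distrib)
          ultimately have "r * (1 - fst p $ j) = 0" "s * (1 - fst q $ j) = 0" by linarith+
          then show ?thesis using 3 a1 by simp
        qed
        then have P: "snd p \<le> ?\<phi> (fst p + v) - c" "snd q \<le> ?\<phi> (fst q + v) - c"
          "fst p + v \<in> unit_cube" "fst q + v \<in> unit_cube"
          using p q vQ pq by (auto simp: C_def)
        have "r * snd p + s * snd q \<le> r * (?\<phi> (fst p + v) - c) + s * (?\<phi> (fst q + v) - c)"
          using P rs by (intro add_mono mult_left_mono) auto
        also have "\<dots> = r * ?\<phi> (fst p + v) + s * ?\<phi> (fst q + v) - (r + s) * c"
          by (simp add: algebra_simps)
        also have "\<dots> \<le> ?\<phi> (r *\<^sub>R (fst p + v) + s *\<^sub>R (fst q + v)) - c"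
          using conc P(3,4) rs unfolding concave_on_iff by force
        also have "r *\<^sub>R (fst p + v) + s *\<^sub>R (fst q + v) = r *\<^sub>R fst p + s *\<^sub>R fst q + (r + s) *\<^sub>R v"
          by (simp add: algebra_simps)
        finally show ?thesis using rs(3) by simp
      qed
      ultimately show ?thesis by (simp add: C_def)
    qed (use p q in auto)
  qed
  moreover have "(z, f z) \<in> C" if "z \<in> unit_cube" for z
    using that c[OF that] cenv_ge[OF compact_cbox f vQ[OF that]] by (auto simp: C_def v_def)
  ultimately have "(w, ?\<phi> w) \<in> C"
    using cenv_in_convex[OF compact_cbox f, of C w] w by simp
  then show ?thesis using w by (simp add: C_def v_def)
qed

lemma le_1_if_less_inverse_Suc: "t < 1 / real (Suc n) \<Longrightarrow> t \<le> 1"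
  by (rule less_imp_le, erule less_le_trans) simp

text \<open>Both sides are compared with \<open>sqrt t\<close>: the first step uses
  \<open>t < 1 / Suc n\<close>, the second \<open>n \<ge> 1\<close>. An increment at one scale thus
  becomes a slope that grows with \<open>n\<close>.\<close>

lemma sqrt_mult_le_powr:
  assumes "n \<ge> 1" "0 < t" "t < 1 / real (Suc n)"
  shows "sqrt (real (Suc n)) * t \<le> t powr (1 / real (Suc n))"
proof -
  have t1: "t \<le> 1" using assms(3) by (rule le_1_if_less_inverse_Suc)
  have "sqrt (real (Suc n)) * sqrt t \<le> 1"
    unfolding real_sqrt_mult[symmetric] using assms by (simp add: field_simps)
  then have "sqrt (real (Suc n)) * sqrt t * sqrt t \<le> 1 * sqrt t"
    using assms by (intro mult_right_mono) auto
  then have "sqrt (real (Suc n)) * t \<le> sqrt t" using assms by (simp add: mult.assoc)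
  also have "sqrt t = t powr (1/2)" using assms by (simp add: powr_half_sqrt)
  also have "\<dots> \<le> t powr (1 / real (Suc n))"
    using assms t1 by (intro powr_mono') (auto simp: field_simps)
  finally show ?thesis .
qed

lemma inner_sgn_self: "x \<bullet> sgn x = norm x" for x :: "'a::real_inner"
  by (cases "x = 0") (simp_all add: sgn_div_norm dot_square_norm power2_eq_square)

lemma real_Suc_gt_ex: "\<exists>n\<ge>1. M < real (Suc n)"
proof -
  obtain n where "M < real n" using reals_Archimedean2 by blast
  then show ?thesis by (intro exI[of _ "Suc n"]) auto
qed

lemma inverse_Suc_less_ex: "e > 0 \<Longrightarrow> \<exists>n\<ge>1. 1 / real (Suc n) < e"
  using real_Suc_gt_ex[of "1 / e"] by (auto simp: field_simps)

lemma pointwise_hoelderE: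
  assumes "pointwise_hoelder g h x" "x \<in> unit_cube" "h > 0"
  obtains p d C where "real_polynomial_function p" "d > 0" "C \<ge> 0" "g x = p 0"
    "\<And>v. norm v < d \<Longrightarrow> x + v \<in> unit_cube \<Longrightarrow> \<bar>g (x + v) - p v\<bar> \<le> C * norm v powr h"
proof -
  obtain c C where *: "\<forall>\<^sub>F x' in nhds x. x' \<in> unit_cube \<longrightarrow>
        \<bar>g x' - mpoly_eval (nat \<lfloor>h\<rfloor>) c (x' - x)\<bar> \<le> C * norm (x' - x) powr h"
    using assms unfolding pointwise_hoelder_def by blast
  then obtain d where d: "d > 0" "\<And>x'. dist x' x < d \<Longrightarrow> x' \<in> unit_cube \<Longrightarrow>
        \<bar>g x' - mpoly_eval (nat \<lfloor>h\<rfloor>) c (x' - x)\<bar> \<le> C * norm (x' - x) powr h"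
    unfolding eventually_nhds_metric by blast
  show ?thesis
  proof (rule that[OF real_polynomial_function_mpoly_eval d(1) abs_ge_zero])
    show "g x = mpoly_eval (nat \<lfloor>h\<rfloor>) c 0" using d(2)[of x] d(1) assms by simp
    fix v assume "norm v < d" "x + v \<in> unit_cube"
    then have "\<bar>g (x + v) - mpoly_eval (nat \<lfloor>h\<rfloor>) c v\<bar> \<le> C * norm v powr h"
      using d(2)[of "x + v"] by (simp add: dist_norm)
    also have "\<dots> \<le> \<bar>C\<bar> * norm v powr h" by (intro mult_right_mono) auto
    finally show "\<bar>g (x + v) - mpoly_eval (nat \<lfloor>h\<rfloor>) c v\<bar> \<le> \<bar>C\<bar> * norm v powr h" .
  qed
qed

lemma frontier_cube_face:
  assumes "x \<in> frontier (unit_cube :: (real^'n::finite) set)"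
  obtains j a \<sigma> where "(a, \<sigma>) \<in> {(0::real, 1::real), (1, -1)}" "x \<in> unit_cube" "x $ j = a"
proof -
  have x: "x \<in> unit_cube" "x \<notin> open_unit_cube" using assms by (auto simp: frontier_cbox)
  then obtain j where j: "\<not> (0 < x $ j \<and> x $ j < 1)" by (auto simp: mem_box_cart)
  have "0 \<le> x $ j \<and> x $ j \<le> 1" using x(1) by (simp add: mem_box_cart)
  then have "x $ j = 0 \<or> x $ j = 1" using j by force
  then show ?thesis using that[of 0 1 j] that[of 1 "-1" j] x(1) by auto
qed

lemma locally_affine_hoelder:
  assumes "locally_affine g x"
  shows "hoelder_exponent g x = \<infinity>"
proof -
  obtain \<rho> c a where \<rho>: "\<rho> > 0" "\<And>z. z \<in> ball x \<rho> \<Longrightarrow> g z = c + a \<bullet> z"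
    using assms unfolding locally_affine_def by blast
  have ph: "pointwise_hoelder g (real m) x" if "m \<ge> 1" for m
  proof -
    obtain k where k: "\<And>z. mpoly_eval m k z = (c + a \<bullet> x) + a \<bullet> z" using mpoly_eval_affine[OF \<open>m \<ge> 1\<close>] by blast
    show ?thesis
      unfolding pointwise_hoelder_def eventually_nhds_metric using \<rho>
      by (intro exI[of _ k] exI[of _ 0] exI[of _ \<rho>]) (simp add: k dist_commute inner_diff_right)
  qed
  show ?thesis
    unfolding hoelder_exponent_def
  proof (rule ereal_top)
    fix B :: real
    obtain m where m: "m \<ge> 1" "B < real (Suc m)" using real_Suc_gt_ex by blast
    have "ereal B \<le> ereal (real (Suc m))" using m by simp
    also have "\<dots> \<le> Sup {ereal h |h. 0 \<le> h \<and> pointwise_hoelder g h x}"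
      by (rule Sup_upper) (use ph[of "Suc m"] in \<open>auto intro!: exI[of _ "real (Suc m)"] simp del: of_nat_Suc\<close>)
    finally show "ereal B \<le> Sup {ereal h |h. 0 \<le> h \<and> pointwise_hoelder g h x}" .
  qed
qed

lemma frontier_cube_dim: "hausdorff_dim (frontier unit_cube :: (real^'n::finite) set) = ereal (real CARD('n) - 1)"
proof (rule antisym)
  have "hausdorff_dim (frontier unit_cube :: (real^'n) set) \<le> ereal (real (CARD('n) - 1))"
    by (rule hausdorff_dim_le) (rule box_covered_imp_coverable[OF box_covered_frontier_cube])
  then show "hausdorff_dim (frontier unit_cube :: (real^'n) set) \<le> ereal (real CARD('n) - 1)"
    by (simp add: of_nat_diff)
  show "ereal (real CARD('n) - 1) \<le> hausdorff_dim (frontier unit_cube :: (real^'n) set)"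
  proof (rule hausdorff_dim_ge_lines[where j = undefined])
    fix x :: "real^'n" assume x: "x \<in> open_unit_cube"
    let ?y = "x + (- x $ undefined) *\<^sub>R axis undefined 1"
    have "?y \<in> unit_cube" using x by (auto simp: mem_box_cart axis_def less_imp_le)
    moreover have "?y \<notin> open_unit_cube" by (auto simp: mem_box_cart axis_def intro!: exI[of _ undefined])
    ultimately have "?y \<in> frontier unit_cube" by (simp add: frontier_cbox)
    then show "\<exists>t. x + t *\<^sub>R axis undefined 1 \<in> frontier unit_cube" by blast
  qed
qed

section \<open>Boundary behaviour of the envelope of a generic function\<close>

context
  fixes f :: "real^'n::finite \<Rightarrow> real"
  assumes gen: "generic f"
begin

private abbreviation "\<phi> \<equiv> cenv unit_cube f"

lemma generic_continuous: "continuous_on unit_cube f"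
  using gen by (simp add: generic_def)

lemma generic_envelope_concave: "concave_on unit_cube \<phi>"
  using concave_cenv[OF compact_cbox generic_continuous] by simp

lemma generic_steep:
  obtains t where "0 < t" "t < 1 / Suc n"
    "\<And>j a \<sigma> w. (a, \<sigma>) \<in> {(0, 1), (1, -1)} \<Longrightarrow> w \<in> unit_cube \<Longrightarrow> w $ j = a \<Longrightarrow>
       t powr (1 / Suc n) \<le> \<phi> (w + (\<sigma> * t) *\<^sub>R axis j 1) - \<phi> w"
proof -
  obtain t where t: "0 < t" "t < 1 / Suc n"
    "\<And>j a \<sigma> w. (a, \<sigma>) \<in> {(0, 1), (1, -1)} \<Longrightarrow> w \<in> unit_cube \<Longrightarrow> w $ j = a \<Longrightarrow>
       t powr (1 / Suc n) \<le> f (w + (\<sigma> * t) *\<^sub>R axis j 1) - f w"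
    using gen unfolding generic_def boundary_steep_def by meson
  have "t < 1" using t(2) by (rule less_le_trans) simp
  then show ?thesis using that[OF t(1,2)] cenv_face_increment[OF generic_continuous] t by (meson less_imp_le)
qed

text \<open>By concavity the inward quotient grows as the step shrinks, so one scale
  \<open>s\<close> with slope above \<open>M\<close> settles all smaller steps.\<close>

lemma generic_quotient:
  assumes a: "(a, \<sigma>) \<in> {(0, 1), (1, -1)}" and w: "w \<in> unit_cube" "w $ j = a"
  shows "\<forall>\<^sub>F t in at_right 0. M < (\<phi> (w + (\<sigma> * t) *\<^sub>R axis j 1) - \<phi> w) / t"
proof -
  obtain n where n: "n \<ge> 1" "M\<^sup>2 < real (Suc n)" using real_Suc_gt_ex by blast
  then have M: "M < sqrt (Suc n)" using real_less_rsqrt by blast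
  obtain s where s: "0 < s" "s < 1 / Suc n" "s powr (1 / Suc n) \<le> \<phi> (w + (\<sigma> * s) *\<^sub>R axis j 1) - \<phi> w"
    by (rule generic_steep[of n]) (use a w in blast)
  have s1: "s \<le> 1" using s(2) by (rule le_1_if_less_inverse_Suc)
  have inc: "sqrt (Suc n) * s \<le> \<phi> (w + (\<sigma> * s) *\<^sub>R axis j 1) - \<phi> w"
    using sqrt_mult_le_powr[OF n(1) s(1,2)] s(3) by linarith
  have "M < (\<phi> (w + (\<sigma> * t) *\<^sub>R axis j 1) - \<phi> w) / t" if t: "0 < t" "t < s" for t
  proof -
    define \<theta> where "\<theta> = t / s"
    have \<theta>: "0 < \<theta>" "\<theta> \<le> 1" "\<theta> * s = t" using t s by (auto simp: \<theta>_def)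
    let ?ws = "w + (\<sigma> * s) *\<^sub>R axis j 1"
    have "?ws \<in> unit_cube" using face_inward_mem[OF a w] s(1) s1 by simp
    then have "(1 - \<theta>) * \<phi> w + \<theta> * \<phi> ?ws \<le> \<phi> ((1 - \<theta>) *\<^sub>R w + \<theta> *\<^sub>R ?ws)"
      using generic_envelope_concave w(1) \<theta> unfolding concave_on_iff by auto
    also have "(1 - \<theta>) *\<^sub>R w + \<theta> *\<^sub>R ?ws = w + (\<sigma> * t) *\<^sub>R axis j 1"
      using \<theta>(3) by (simp add: algebra_simps)
    finally have "\<theta> * (\<phi> ?ws - \<phi> w) \<le> \<phi> (w + (\<sigma> * t) *\<^sub>R axis j 1) - \<phi> w"
      by (simp add: algebra_simps)
    moreover have "\<theta> * (sqrt (Suc n) * s) \<le> \<theta> * (\<phi> ?ws - \<phi> w)" using inc \<theta>(1) by simp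
    moreover have "\<theta> * (sqrt (Suc n) * s) = sqrt (Suc n) * t" using \<theta>(3) by (simp add: algebra_simps)
    ultimately have "sqrt (Suc n) * t \<le> \<phi> (w + (\<sigma> * t) *\<^sub>R axis j 1) - \<phi> w" by linarith
    then have "sqrt (Suc n) \<le> (\<phi> (w + (\<sigma> * t) *\<^sub>R axis j 1) - \<phi> w) / t"
      using t(1) by (simp add: field_simps)
    then show ?thesis using M by linarith
  qed
  then show ?thesis unfolding eventually_at_right_field using s(1) by blast
qed

lemma generic_partial_face_0:
  assumes "w \<in> cube_face 0 j"
  shows "has_one_sided_partial \<phi> j (at_right 0) w \<infinity>"
  unfolding has_one_sided_partial_def tendsto_PInfty
  using generic_quotient[of 0 1 w j] assms by (simp add: cube_face_def)

lemma generic_partial_face_1: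
  assumes "w \<in> cube_face 1 j"
  shows "has_one_sided_partial \<phi> j (at_left 0) w (- \<infinity>)"
  unfolding has_one_sided_partial_def tendsto_MInfty
proof
  fix r :: real
  have "\<forall>\<^sub>F t in at_right 0. - r < (\<phi> (w + (- 1 * t) *\<^sub>R axis j 1) - \<phi> w) / t"
    using generic_quotient[of 1 "-1" w j] assms by (simp add: cube_face_def)
  then have "\<forall>\<^sub>F t in at_right (- 0). ereal ((\<phi> (w + (- t) *\<^sub>R axis j 1) - \<phi> w) / (- t)) < ereal r"
    by (simp add: minus_less_iff)
  then show "\<forall>\<^sub>F t in at_left 0. ereal ((\<phi> (w + t *\<^sub>R axis j 1) - \<phi> w) / t) < ereal r"
    unfolding eventually_at_left_to_right[of _ 0] .
qed

lemma generic_envelope_bounded: obtains B where "B \<ge> 0" "\<And>x. x \<in> unit_cube \<Longrightarrow> \<bar>\<phi> x\<bar> \<le> B"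
proof -
  have "bounded (envelope_hull unit_cube f)"
    using compact_envelope_hull[OF compact_cbox generic_continuous] compact_imp_bounded by blast
  then obtain B where B: "\<And>p. p \<in> envelope_hull unit_cube f \<Longrightarrow> norm p \<le> B"
    unfolding bounded_iff by blast
  have "\<bar>\<phi> x\<bar> \<le> \<bar>B\<bar>" if "x \<in> unit_cube" for x
  proof -
    have "(x, \<phi> x) \<in> envelope_hull unit_cube f" using cenv_mem[OF compact_cbox generic_continuous] that by simp
    from B[OF this] have "\<bar>\<phi> x\<bar> \<le> B" using norm_snd_le[of "\<phi> x" x] by simp
    then show ?thesis by linarith
  qed
  then show ?thesis using that[of "\<bar>B\<bar>"] by simp
qed

text \<open>Boundedness of the envelope suffices away from \<open>x\<close>. At \<open>x\<close> the
  bound is 0, because \<open>0 powr 0 = 0\<close>, so the constant polynomial must take the value of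
  the envelope there.\<close>

lemma generic_pointwise_hoelder_0:
  assumes "x \<in> unit_cube"
  shows "pointwise_hoelder \<phi> 0 x"
proof -
  obtain B where B: "B \<ge> 0" "\<And>x. x \<in> unit_cube \<Longrightarrow> \<bar>\<phi> x\<bar> \<le> B" using generic_envelope_bounded by metis
  have "\<bar>\<phi> x' - \<phi> x\<bar> \<le> 2 * B * norm (x' - x) powr 0" if "x' \<in> unit_cube" for x'
  proof (cases "x' = x")
    case False
    have "\<bar>\<phi> x' - \<phi> x\<bar> \<le> B + B" using B(2)[OF that] B(2)[OF assms] by linarith
    then show ?thesis using False by simp
  qed simp
  then show ?thesis
    unfolding pointwise_hoelder_def
    by (intro exI[of _ "\<lambda>\<alpha>. if \<alpha> = (\<lambda>_. 0) then \<phi> x else 0"] exI[of _ "2 * B"] always_eventually)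
      (simp add: mpoly_eval_const)
qed

text \<open>Hoelder order \<open>h\<close> and the Lipschitz bound of the polynomial allow
  increments of order \<open>t powr m\<close> only, whereas steepness yields at least
  \<open>t powr (m / 2)\<close> at arbitrarily small \<open>t\<close>.\<close>

lemma generic_not_hoelder_frontier:
  assumes x: "x \<in> frontier unit_cube" and h: "h > 0"
  shows "\<not> pointwise_hoelder \<phi> h x"
proof
  assume H: "pointwise_hoelder \<phi> h x"
  obtain j a \<sigma> where a: "(a, \<sigma>) \<in> {(0::real, 1::real), (1, -1)}" "x \<in> unit_cube" "x $ j = a"
    by (rule frontier_cube_face[OF x])
  obtain p d C where p: "real_polynomial_function p" "d > 0" "C \<ge> 0" "\<phi> x = p 0"
    "\<And>v. norm v < d \<Longrightarrow> x + v \<in> unit_cube \<Longrightarrow> \<bar>\<phi> (x + v) - p v\<bar> \<le> C * norm v powr h"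
    using pointwise_hoelderE[OF H a(2) h] by metis
  obtain K where "taylor_bounded 1 p K" by (rule real_polynomial_function_taylor_bounded[OF p(1)])
  note K = taylor_boundedD(1,3)[OF this]
  \<comment> \<open>Capped at 1 so that one power dominates both the Hoelder error and the linear
    bound for the polynomial.\<close>
  define m where "m = min h 1"
  have m: "m > 0" "m \<le> h" "m \<le> 1" using h by (auto simp: m_def)
  define L where "L = C + K + 1"
  have L: "L > 0" using p(3) K(1) by (simp add: L_def)
  \<comment> \<open>The entry \<open>m / 2\<close> bounds the exponent of steepness; the power of
    \<open>L\<close> makes \<open>L * t powr (m / 2) \<le> 1\<close>, which is the contradiction
    sought.\<close>
  define e where "e = min (min d (m / 2)) (L powr (- 2 / m))"
  have e: "e > 0" using p(2) m L by (simp add: e_def)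
  obtain n where n: "n \<ge> 1" "1 / real (Suc n) < e" using inverse_Suc_less_ex[OF e] by blast
  obtain t where t: "0 < t" "t < 1 / Suc n" "t powr (1 / Suc n) \<le> \<phi> (x + (\<sigma> * t) *\<^sub>R axis j 1) - \<phi> x"
    by (rule generic_steep[of n]) (use a in blast)
  have t1: "t \<le> 1" using t(2) by (rule le_1_if_less_inverse_Suc)
  define v where "v = (\<sigma> * t) *\<^sub>R axis j (1::real)"
  have nv: "norm v = t" using a(1) t(1) by (auto simp: v_def norm_axis_1)
  have xv: "x + v \<in> unit_cube" unfolding v_def using face_inward_mem[OF a] t(1) t1 by simp
  have "t powr (m / 2) \<le> t powr (1 / Suc n)"
    using t t1 n by (intro powr_mono') (auto simp: e_def)
  also have "\<dots> \<le> \<phi> (x + v) - p 0" using t(3) p(4) by (simp add: v_def)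
  also have "\<dots> \<le> \<bar>\<phi> (x + v) - p v\<bar> + \<bar>p v - p 0\<bar>" by linarith
  also have "\<dots> \<le> C * t powr h + K * t"
    using p(5)[of v] K(2)[of 0 v] xv nv t t1 n by (intro add_mono) (auto simp: e_def)
  also have "\<dots> \<le> C * t powr m + K * t powr m"
  proof (intro add_mono mult_left_mono)
    show "t powr h \<le> t powr m" using t t1 m by (intro powr_mono') auto
    have "t powr 1 \<le> t powr m" using t t1 m by (intro powr_mono') auto
    then show "t \<le> t powr m" using t by simp
  qed (use p K in auto)
  also have "\<dots> < L * t powr m" using t by (simp add: L_def algebra_simps)
  also have "t powr m = t powr (m / 2) * t powr (m / 2)" by (simp add: powr_add[symmetric])
  finally have "1 < L * t powr (m / 2)" using t by simp
  also have "\<dots> \<le> L * (L powr (- 2 / m)) powr (m / 2)"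
    using L t n m by (intro mult_left_mono powr_mono2) (auto simp: e_def)
  also have "(L powr (- 2 / m)) powr (m / 2) = L powr (- 1)"
  proof -
    have "(- 2 / m) * (m / 2) = - 1" using m by simp
    then show ?thesis unfolding powr_powr by simp
  qed
  also have "L * L powr (- 1) = 1" using L by (simp add: powr_minus)
  finally show False by simp
qed

lemma generic_hoelder_frontier:
  assumes "x \<in> frontier unit_cube"
  shows "hoelder_exponent \<phi> x = 0"
proof -
  have "x \<in> unit_cube" using assms by (auto simp: frontier_cbox)
  then show ?thesis
    using hoelder_exponent_eqI[of 0 \<phi> x] generic_not_hoelder_frontier[OF assms] generic_pointwise_hoelder_0
    by (simp add: zero_ereal_def)
qed

section \<open>Differentiability\<close>

lemma generic_supergradient_unique:
  assumes x: "x \<in> open_unit_cube" and a: "supergradient unit_cube \<phi> x a" and b: "supergradient unit_cube \<phi> x b"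
  shows "a = b"
proof -
  have xQ: "x \<in> unit_cube" using x box_subset_cbox by blast
  \<comment> \<open>One contact point must serve both supergradients, so it is taken for their mean:
    where the mean is attained, neither of the two inequalities can be strict.\<close>
  define m where "m = (1/2) *\<^sub>R (a + b)"
  have m: "m \<bullet> z = (a \<bullet> z + b \<bullet> z) / 2" for z by (simp add: m_def inner_add_left)
  have "supergradient unit_cube \<phi> x m"
    unfolding supergradient_def
  proof
    fix z :: "real^'n" assume "z \<in> unit_cube"
    from supergradientD[OF a this] supergradientD[OF b this] show "\<phi> z \<le> \<phi> x + m \<bullet> (z - x)"
      unfolding m by (simp add: field_simps)
  qed
  then have "x \<in> convex hull {w \<in> unit_cube. f w = \<phi> x + m \<bullet> (w - x)}"
    using cenv_contact_hull[OF compact_cbox generic_continuous, of x m] xQ by simp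
  then have "{w \<in> unit_cube. f w = \<phi> x + m \<bullet> (w - x)} \<noteq> {}" by (metis convex_hull_empty empty_iff)
  then obtain w where w: "w \<in> unit_cube" "f w = \<phi> x + m \<bullet> (w - x)" by blast
  have fw: "f w \<le> \<phi> w" by (rule cenv_ge[OF compact_cbox generic_continuous w(1)])
  have eq: "\<phi> w = f w" "\<phi> w = \<phi> x + a \<bullet> (w - x)" "\<phi> w = \<phi> x + b \<bullet> (w - x)"
    using fw w(2) supergradientD[OF a w(1)] supergradientD[OF b w(1)] unfolding m by argo+
  have aw: "\<phi> z \<le> \<phi> w + a \<bullet> (z - w)" and bw: "\<phi> z \<le> \<phi> w + b \<bullet> (z - w)" if "z \<in> unit_cube" for z
    using supergradientD[OF a that] supergradientD[OF b that] eq(2,3) by (simp_all add: inner_diff_right)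
  \<comment> \<open>At a boundary point the inward quotients exceed every bound, against the finite
    slope \<open>a\<close> of the affine majorant through \<open>w\<close>.\<close>
  have wo: "w \<in> open_unit_cube"
  proof (rule ccontr)
    assume "w \<notin> open_unit_cube"
    then have "w \<in> frontier unit_cube" using w(1) by (simp add: frontier_cbox)
    then obtain j c \<sigma> where c: "(c, \<sigma>) \<in> {(0::real, 1::real), (1, -1)}" "w \<in> unit_cube" "w $ j = c"
      by (rule frontier_cube_face)
    have "\<forall>\<^sub>F t in at_right 0. \<bar>a $ j\<bar> < (\<phi> (w + (\<sigma> * t) *\<^sub>R axis j 1) - \<phi> w) / t"
      by (rule generic_quotient[OF c])
    then have "\<forall>\<^sub>F t in at_right 0. \<bar>a $ j\<bar> < (\<phi> (w + (\<sigma> * t) *\<^sub>R axis j 1) - \<phi> w) / t \<and> 0 < t \<and> t < 1"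
      by (intro eventually_conj eventually_at_right_less) (auto simp: eventually_at_right_field intro: exI[of _ 1])
    then obtain t where t: "\<bar>a $ j\<bar> < (\<phi> (w + (\<sigma> * t) *\<^sub>R axis j 1) - \<phi> w) / t" "0 < t" "t < 1"
      using eventually_happens[of _ "at_right (0::real)"] by (metis (no_types, lifting) trivial_limit_at_right_real)
    have "w + (\<sigma> * t) *\<^sub>R axis j 1 \<in> unit_cube" using face_inward_mem[OF c] t by simp
    from aw[OF this] have "\<phi> (w + (\<sigma> * t) *\<^sub>R axis j 1) - \<phi> w \<le> \<sigma> * t * a $ j"
      by (simp add: inner_axis)
    also have "\<dots> \<le> \<bar>a $ j\<bar> * t" using c(1) t(2) by (auto simp: mult.commute intro!: mult_right_mono)
    finally show False using t(1,2) by (simp add: field_simps)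
  qed
  show ?thesis
  proof (rule ccontr)
    assume ab: "a \<noteq> b"
    obtain \<rho> where \<rho>: "\<rho> > 0" "ball w \<rho> \<subseteq> unit_cube"
      using wo open_box open_contains_ball box_subset_cbox by (metis subset_trans)
    have "min \<rho> (norm (a - b)) > 0" using \<rho>(1) ab by simp
    then obtain n where n: "1 / real (Suc n) < min \<rho> (norm (a - b))" using inverse_Suc_less_ex by blast
    obtain t where t: "0 < t" "t < 1 / Suc n" "\<And>x u. norm u = t \<Longrightarrow> x \<in> unit_cube \<Longrightarrow> x + u \<in> unit_cube \<Longrightarrow> x - u \<in> unit_cube \<Longrightarrow>
           - (t / Suc n) \<le> f (x + u) + f (x - u) - 2 * f x"
      using gen unfolding generic_def almost_smooth_def by meson
    \<comment> \<open>Along \<open>a - b\<close> the majorant with slope \<open>b\<close> is used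
      forward and the one with slope \<open>a\<close> backward, which gives a second difference of
      at most \<open>- (t * norm (a - b))\<close>.\<close>
    define u where "u = t *\<^sub>R sgn (a - b)"
    have nu: "norm u = t" using ab t(1) by (simp add: u_def norm_sgn)
    have u: "w + u \<in> unit_cube" "w - u \<in> unit_cube"
      using \<rho>(2) nu t(2) n by (auto intro!: subsetD[OF \<rho>(2)] simp: dist_norm)
    have "- (t / Suc n) \<le> f (w + u) + f (w - u) - 2 * f w" using t(3)[OF nu w(1) u] .
    also have "\<dots> \<le> \<phi> (w + u) + \<phi> (w - u) - 2 * \<phi> w"
      using cenv_ge[OF compact_cbox generic_continuous u(1)] cenv_ge[OF compact_cbox generic_continuous u(2)] eq(1) by linarith
    also have "\<dots> \<le> b \<bullet> u - a \<bullet> u" using bw[OF u(1)] aw[OF u(2)] by simp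
    also have "\<dots> = - (t * norm (a - b))"
    proof -
      have "b \<bullet> u - a \<bullet> u = - (t * ((a - b) \<bullet> sgn (a - b)))"
        by (simp add: u_def inner_diff_left algebra_simps)
      then show ?thesis by (simp add: inner_sgn_self)
    qed
    finally have "t * norm (a - b) \<le> t * (1 / Suc n)" by simp
    then have "norm (a - b) \<le> 1 / Suc n" using t(1) by (simp only: mult_le_cancel_left_pos)
    then show False using n by simp
  qed
qed

lemma generic_supergradient:
  assumes "x \<in> open_unit_cube"
  obtains a where "supergradient unit_cube \<phi> x a"
  using concave_supergradient_exists[OF generic_envelope_concave, of x] assms by (metis interior_cbox)

lemma generic_envelope_continuous: "continuous_on open_unit_cube \<phi>"
proof -
  have "concave_on open_unit_cube \<phi>"
    using generic_envelope_concave convex_on_subset[of unit_cube "\<lambda>x. - \<phi> x" open_unit_cube]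
    by (simp add: concave_on_def box_subset_cbox)
  then have "continuous_on open_unit_cube (\<lambda>x. - \<phi> x)"
    by (intro convex_on_continuous) (auto simp: concave_on_def)
  then have "continuous_on open_unit_cube (\<lambda>x. - (- \<phi> x))" by (rule continuous_on_minus)
  then show ?thesis by simp
qed

text \<open>A closed graph argument: supergradients are bounded on a small ball, and uniqueness lets
  their graph be described by non-strict inequalities, hence by a closed set.\<close>

lemma generic_continuous_supergradient:
  assumes D: "\<And>x. x \<in> open_unit_cube \<Longrightarrow> supergradient unit_cube \<phi> x (D x)"
  shows "continuous_on open_unit_cube D"
proof -
  obtain B where B: "B \<ge> 0" "\<And>x. x \<in> unit_cube \<Longrightarrow> \<bar>\<phi> x\<bar> \<le> B" using generic_envelope_bounded by metis
  have "continuous (at x0) D" if x0: "x0 \<in> open_unit_cube" for x0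
  proof -
    obtain \<rho> where \<rho>: "\<rho> > 0" "cball x0 \<rho> \<subseteq> open_unit_cube"
      using x0 open_box open_contains_cball by metis
    define S where "S = cball x0 (\<rho> / 2)"
    have S: "S \<subseteq> open_unit_cube" using \<rho> subset_cball[of "\<rho> / 2" \<rho> x0] by (auto simp: S_def)
    have bd: "norm (D x) \<le> 4 * B / \<rho>" if x: "x \<in> S" for x
    proof -
      \<comment> \<open>A step against the supergradient lowers its affine bound by
        \<open>(\<rho> / 2) * norm (D x)\<close>, while the envelope varies by at most
        \<open>2 * B\<close>.\<close>
      let ?z = "x - (\<rho> / 2) *\<^sub>R sgn (D x)"
      have "dist x0 ?z \<le> dist x0 x + dist x ?z" by (rule dist_triangle)
      also have "dist x ?z \<le> \<rho> / 2" using \<rho>(1) by (simp add: dist_norm norm_sgn)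
      finally have z: "?z \<in> unit_cube" using x \<rho>(2) box_subset_cbox by (force simp: S_def)
      have "\<phi> ?z \<le> \<phi> x - (\<rho> / 2) * norm (D x)"
        using supergradientD[OF D[OF subsetD[OF S x]] z] by (simp add: inner_sgn_self)
      moreover have "x \<in> unit_cube" using S x box_subset_cbox by blast
      ultimately have "(\<rho> / 2) * norm (D x) \<le> 2 * B" using B(2)[OF z] B(2)[of x] by linarith
      then show ?thesis using \<rho>(1) by (simp add: field_simps)
    qed
    have "continuous_on S D"
    proof (rule continuous_from_closed_graph)
      show "compact (cball (0::real^'n) (4 * B / \<rho>))" by simp
      show "D \<in> S \<rightarrow> cball 0 (4 * B / \<rho>)" using bd by simp
      have "(\<lambda>x. (x, D x)) ` S = (S \<times> UNIV) \<inter> (\<Inter>z\<in>unit_cube. {p \<in> S \<times> UNIV. \<phi> z \<le> \<phi> (fst p) + snd p \<bullet> (z - fst p)})"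
        (is "?G = ?H")
      proof (intro set_eqI iffI)
        fix p assume "p \<in> ?G"
        then show "p \<in> ?H" using supergradientD[OF D] S by force
      next
        fix p assume p: "p \<in> ?H"
        then have "supergradient unit_cube \<phi> (fst p) (snd p)" "fst p \<in> S"
          by (auto simp: supergradient_def)
        then have "snd p = D (fst p)" using generic_supergradient_unique D S by blast
        then show "p \<in> ?G" using \<open>fst p \<in> S\<close>
          by (intro image_eqI[of _ _ "fst p"]) (simp_all add: prod_eq_iff)
      qed
      moreover have "closed {p \<in> S \<times> UNIV. \<phi> z \<le> \<phi> (fst p) + snd p \<bullet> (z - fst p)}" for z
      proof (rule continuous_on_closed_Collect_le)
        show "closed (S \<times> (UNIV :: (real^'n) set))" by (intro closed_Times) (auto simp: S_def)
        have "continuous_on (S \<times> UNIV) (\<lambda>p. \<phi> (fst p))"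
          by (rule continuous_on_compose2[OF generic_envelope_continuous]) (use S in \<open>auto intro!: continuous_intros\<close>)
        then show "continuous_on (S \<times> UNIV) (\<lambda>p. \<phi> (fst p) + snd p \<bullet> (z - fst p))"
          by (intro continuous_intros)
      qed simp
      moreover have "closed (S \<times> (UNIV :: (real^'n) set))" by (intro closed_Times) (auto simp: S_def)
      ultimately show "closed ((\<lambda>x. (x, D x)) ` S)" by (metis (lifting) closed_INT closed_Int)
    qed
    moreover have "x0 \<in> interior S" using \<rho>(1) by (simp add: S_def interior_cball)
    ultimately show ?thesis by (rule continuous_on_interior)
  qed
  then show ?thesis by (simp add: continuous_at_imp_continuous_on)
qed

text \<open>The supergradients at \<open>x\<close> and at \<open>y\<close> bound the increment from
  above and from below. The error is at most the absolute value of
  \<open>(D y - D x) \<bullet> (y - x)\<close>, small by continuity of \<open>D\<close>.\<close>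

lemma generic_has_derivative:
  assumes D: "\<And>x. x \<in> open_unit_cube \<Longrightarrow> supergradient unit_cube \<phi> x (D x)" and x: "x \<in> open_unit_cube"
  shows "(\<phi> has_derivative (\<lambda>v. D x \<bullet> v)) (at x)"
  unfolding has_derivative_at_alt
proof (intro conjI allI impI)
  show "bounded_linear ((\<bullet>) (D x))" by (rule bounded_linear_inner_right)
  fix e :: real assume e: "e > 0"
  have "continuous (at x) D"
    using generic_continuous_supergradient[OF D] x continuous_on_eq_continuous_at open_box by blast
  then obtain d1 where d1: "d1 > 0" "\<And>y. dist y x < d1 \<Longrightarrow> dist (D y) (D x) < e"
    using e unfolding continuous_at_eps_delta by metis
  obtain d2 where d2: "d2 > 0" "ball x d2 \<subseteq> open_unit_cube"
    using x open_box open_contains_ball by metis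
  show "\<exists>d>0. \<forall>y. norm (y - x) < d \<longrightarrow> norm (\<phi> y - \<phi> x - D x \<bullet> (y - x)) \<le> e * norm (y - x)"
  proof (intro exI[of _ "min d1 d2"] conjI allI impI)
    fix y assume y: "norm (y - x) < min d1 d2"
    then have yo: "y \<in> open_unit_cube" using d2(2) by (auto simp: dist_norm norm_minus_commute)
    have 1: "\<phi> y \<le> \<phi> x + D x \<bullet> (y - x)"
      using supergradientD[OF D[OF x]] yo box_subset_cbox by blast
    have 2: "\<phi> x \<le> \<phi> y + D y \<bullet> (x - y)"
      using supergradientD[OF D[OF yo]] x box_subset_cbox by blast
    have "norm (\<phi> y - \<phi> x - D x \<bullet> (y - x)) \<le> \<bar>(D y - D x) \<bullet> (y - x)\<bar>"
      using 1 2 by (simp add: inner_diff_left inner_diff_right)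
    also have "\<dots> \<le> norm (D y - D x) * norm (y - x)" by (rule Cauchy_Schwarz_ineq2)
    also have "\<dots> \<le> e * norm (y - x)"
      using d1(2)[of y] y by (intro mult_right_mono) (auto simp: dist_norm)
    finally show "norm (\<phi> y - \<phi> x - D x \<bullet> (y - x)) \<le> e * norm (y - x)" .
  qed (use d1 d2 in simp)
qed

lemma generic_supergradient_function:
  obtains D where "\<And>x. x \<in> open_unit_cube \<Longrightarrow> supergradient unit_cube \<phi> x (D x)"
proof -
  have "\<forall>x\<in>open_unit_cube. \<exists>a. supergradient unit_cube \<phi> x a"
    using generic_supergradient by blast
  then show ?thesis using that by (auto simp: bchoice_iff)
qed

lemma generic_continuously_differentiable: "continuously_differentiable_on \<phi> open_unit_cube"
proof -
  obtain D where D: "\<And>x. x \<in> open_unit_cube \<Longrightarrow> supergradient unit_cube \<phi> x (D x)"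
    using generic_supergradient_function by metis
  show ?thesis
    unfolding continuously_differentiable_on_def
  proof (intro exI[of _ "\<lambda>x. blinfun_inner_right (D x)"] conjI ballI)
    show "continuous_on open_unit_cube (\<lambda>x. blinfun_inner_right (D x))"
      by (intro bounded_linear.continuous_on[OF bounded_linear_blinfun_inner_right] generic_continuous_supergradient D)
  qed (use generic_has_derivative[OF D] in simp)
qed

section \<open>Regularity in the interior\<close>

lemma generic_pointwise_hoelder_1:
  assumes x: "x \<in> open_unit_cube"
  shows "pointwise_hoelder \<phi> 1 x"
proof -
  obtain D where D: "\<And>x. x \<in> open_unit_cube \<Longrightarrow> supergradient unit_cube \<phi> x (D x)"
    using generic_supergradient_function by metis
  obtain d where d: "d > 0" "\<And>y. norm (y - x) < d \<Longrightarrow> norm (\<phi> y - \<phi> x - D x \<bullet> (y - x)) \<le> 1 * norm (y - x)"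
    using generic_has_derivative[OF D x] unfolding has_derivative_at_alt by (metis zero_less_one)
  have "\<bar>\<phi> y - \<phi> x\<bar> \<le> (norm (D x) + 1) * norm (y - x) powr 1" if "dist y x < d" for y
  proof -
    have "\<bar>\<phi> y - \<phi> x\<bar> \<le> \<bar>\<phi> y - \<phi> x - D x \<bullet> (y - x)\<bar> + \<bar>D x \<bullet> (y - x)\<bar>" by linarith
    also have "\<dots> \<le> norm (y - x) + norm (D x) * norm (y - x)"
      using d(2)[of y] that Cauchy_Schwarz_ineq2[of "D x" "y - x"] by (simp add: dist_norm)
    finally show ?thesis by (simp add: algebra_simps)
  qed
  then show ?thesis
    unfolding pointwise_hoelder_def eventually_nhds_metric using d(1)
    by (intro exI[of _ "\<lambda>\<alpha>. if \<alpha> = (\<lambda>_. 0) then \<phi> x else 0"] exI[of _ "norm (D x) + 1"] exI[of _ d])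
      (simp add: mpoly_eval_const)
qed

lemma generic_not_hoelder_interior:
  assumes x: "x \<in> open_unit_cube" and na: "\<not> locally_affine \<phi> x" and h: "h > 1"
  shows "\<not> pointwise_hoelder \<phi> h x"
proof
  assume H: "pointwise_hoelder \<phi> h x"
  have xQ: "x \<in> unit_cube" using x box_subset_cbox by blast
  have h0: "h > 0" using h by simp
  obtain p d C where p: "real_polynomial_function p" "d > 0" "C \<ge> 0" "\<phi> x = p 0"
    "\<And>v. norm v < d \<Longrightarrow> x + v \<in> unit_cube \<Longrightarrow> \<bar>\<phi> (x + v) - p v\<bar> \<le> C * norm v powr h"
    using pointwise_hoelderE[OF H xQ h0] by metis
  obtain K where "taylor_bounded 1 p K" by (rule real_polynomial_function_taylor_bounded[OF p(1)])
  note K = taylor_boundedD(1,4)[OF this]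
  obtain \<rho> where \<rho>: "\<rho> > 0" "ball x \<rho> \<subseteq> unit_cube"
    using x open_box open_contains_ball box_subset_cbox by (metis subset_trans)
  define m where "m = min h 2"
  have m: "m > 1" "m \<le> h" "m \<le> 2" using h by (auto simp: m_def)
  define L where "L = 2 * C + K + 1"
  have L: "L > 0" using p(3) K(1) by (simp add: L_def)
  \<comment> \<open>\<open>d\<close> and \<rho> keep the step in range, \<open>m - 1\<close> gives
    \<open>1 + 1 / Suc n \<le> m\<close>, and \<open>1 / L\<close> makes \<open>Suc n\<close> exceed
    the constant \<open>L\<close>.\<close>
  define e where "e = min (min d \<rho>) (min (m - 1) (1 / L))"
  have e: "e > 0" using p(2) m L \<rho>(1) by (simp add: e_def)
  obtain n where n: "n \<ge> 1" "1 / real (Suc n) < e" using inverse_Suc_less_ex[OF e] by blast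
  have "almost_polyhedral n f" using gen by (simp add: generic_def)
  then have "ball x (1 / Suc n) \<subseteq> unit_cube \<longrightarrow> sharp_bend n \<phi> x"
    using xQ na unfolding almost_polyhedral_def by blast
  moreover have "ball x (1 / Suc n) \<subseteq> ball x \<rho>" using n by (intro subset_ball) (simp add: e_def)
  ultimately have "sharp_bend n \<phi> x" using \<rho>(2) by blast
  then obtain u where u: "u \<noteq> 0" "norm u < 1 / Suc n" "x + u \<in> unit_cube" "x - u \<in> unit_cube"
        "\<phi> (x + u) + \<phi> (x - u) - 2 * \<phi> x \<le> - (Suc n * norm u powr (1 + 1 / Suc n))"
    unfolding sharp_bend_def by blast
  define r where "r = norm u"
  have r: "r > 0" "r < e" using u n by (simp_all add: r_def)
  have r1: "r \<le> 1" using u(2) unfolding r_def by (rule le_1_if_less_inverse_Suc)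
  have "\<bar>\<phi> (x + u) - p u\<bar> \<le> C * r powr h" "\<bar>\<phi> (x + - u) - p (- u)\<bar> \<le> C * r powr h"
    using p(5)[of u] p(5)[of "- u"] u r by (auto simp: r_def e_def)
  moreover have "\<bar>p (0 + u) + p (0 - u) - 2 * p 0\<bar> \<le> K * r\<^sup>2"
    using K(2)[of 0 u] r1 by (simp add: r_def)
  ultimately have "real (Suc n) * r powr (1 + 1 / Suc n) \<le> 2 * (C * r powr h) + K * r\<^sup>2"
    using u(5) p(4) unfolding r_def by simp
  also have "\<dots> \<le> 2 * (C * r powr m) + K * r powr m"
  proof (intro add_mono mult_left_mono)
    show "r powr h \<le> r powr m" using r r1 m by (intro powr_mono') auto
    have "r powr 2 \<le> r powr m" using r r1 m by (intro powr_mono') auto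
    then show "r\<^sup>2 \<le> r powr m" using r by (simp add: powr_numeral)
  qed (use p K in auto)
  also have "\<dots> \<le> L * r powr m" by (simp add: L_def algebra_simps)
  also have "\<dots> \<le> L * r powr (1 + 1 / Suc n)"
    using r r1 L n by (intro mult_left_mono powr_mono') (auto simp: e_def)
  finally have "real (Suc n) \<le> L" using r by simp
  moreover have "1 / L > 1 / real (Suc n)" using n by (simp add: e_def)
  then have "real (Suc n) > L" using L by (simp add: field_simps)
  ultimately show False by simp
qed

lemma generic_hoelder_interior:
  assumes "x \<in> open_unit_cube"
  shows "hoelder_exponent \<phi> x = (if locally_affine \<phi> x then \<infinity> else 1)"
  using locally_affine_hoelder hoelder_exponent_eqI[of 1 \<phi> x] generic_not_hoelder_interior[OF assms]
    generic_pointwise_hoelder_1[OF assms] by (auto simp: one_ereal_def)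

section \<open>Dimensions\<close>

text \<open>If the whole line stayed in the locally affine set, connectedness would make the slope
  along it constant and the envelope affine on it, up to the end on the face
  \<open>x $ j = 0\<close>, where the slope is infinite.\<close>

lemma generic_line_meets_bend:
  assumes x: "x \<in> open_unit_cube"
  shows "\<exists>t. x + t *\<^sub>R axis j 1 \<in> open_unit_cube \<and> \<not> locally_affine \<phi> (x + t *\<^sub>R axis j 1)"
proof (rule ccontr)
  assume contra: "\<not> ?thesis"
  define S where "S = {- x $ j <..< 1 - x $ j}"
  let ?l = "\<lambda>s. x + s *\<^sub>R axis j (1::real)"
  have l: "?l s \<in> open_unit_cube \<longleftrightarrow> s \<in> S" for s
  proof
    assume "?l s \<in> open_unit_cube"
    then have "0 < ?l s $ j \<and> ?l s $ j < 1" unfolding mem_box_cart by (metis one_index zero_index)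
    then show "s \<in> S" by (simp add: S_def)
  next
    assume s: "s \<in> S"
    show "?l s \<in> open_unit_cube"
      unfolding mem_box_cart
    proof
      fix i
      have "0 < x $ i" "x $ i < 1" using x by (simp_all add: mem_box_cart)
      then show "0 $ i < ?l s $ i \<and> ?l s $ i < 1 $ i" using s by (auto simp: S_def axis_def)
    qed
  qed
  have xj: "0 < x $ j" "x $ j < 1" using x by (simp_all add: mem_box_cart)
  then have S0: "0 \<in> S" by (simp add: S_def)
  obtain D where D: "\<And>x. x \<in> open_unit_cube \<Longrightarrow> supergradient unit_cube \<phi> x (D x)"
    using generic_supergradient_function by metis
  have const: "D (?l s) $ j = D (?l 0) $ j" if "s \<in> S" for s
  proof (rule connected_local_const[of S s 0 "\<lambda>s. D (?l s) $ j"])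
    show "\<forall>s\<in>S. \<forall>\<^sub>F t in at s within S. D (?l s) $ j = D (?l t) $ j"
    proof
      fix s assume s: "s \<in> S"
      then have "locally_affine \<phi> (?l s)" using contra l by blast
      then obtain \<rho> c a where \<rho>: "\<rho> > 0" "ball (?l s) \<rho> \<subseteq> unit_cube" "\<And>z. z \<in> ball (?l s) \<rho> \<Longrightarrow> \<phi> z = c + a \<bullet> z"
        unfolding locally_affine_def by blast
      have Da: "D z = a" if z: "z \<in> ball (?l s) \<rho>" "z \<in> open_unit_cube" for z
      proof -
        obtain e where e: "e > 0" "ball z e \<subseteq> ball (?l s) \<rho>" using z(1) open_ball open_contains_ball by metis
        have "\<phi> z + a \<bullet> (y - z) \<le> \<phi> z + D z \<bullet> (y - z)" if "dist z y < e" for y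
        proof -
          have y: "y \<in> ball (?l s) \<rho>" using e that by auto
          then have "\<phi> y \<le> \<phi> z + D z \<bullet> (y - z)" using supergradientD[OF D[OF z(2)]] \<rho>(2) by blast
          then show ?thesis using \<rho>(3)[OF y] \<rho>(3)[OF z(1)] by (simp add: inner_diff_right)
        qed
        then show ?thesis using affine_contact_imp_eq[OF e(1), of z "\<phi> z" a "\<phi> z" "D z"] by auto
      qed
      have "\<forall>\<^sub>F t in at s within S. t \<in> S \<and> dist t s < \<rho>"
        using \<rho>(1) by (auto simp: eventually_at intro!: exI[of _ \<rho>])
      then show "\<forall>\<^sub>F t in at s within S. D (?l s) $ j = D (?l t) $ j"
      proof (rule eventually_mono)
        fix t assume t: "t \<in> S \<and> dist t s < \<rho>"
        have "dist (?l s) (?l t) = norm ((s - t) *\<^sub>R axis j (1::real))"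
          by (simp add: dist_norm algebra_simps)
        also have "\<dots> < \<rho>" using t by (simp add: norm_axis_1 dist_norm abs_minus_commute)
        finally have "?l t \<in> ball (?l s) \<rho>" by simp
        then show "D (?l s) $ j = D (?l t) $ j" using Da[of "?l s"] Da[of "?l t"] t s l \<rho>(1) by simp
      qed
    qed
  qed (use that S0 in \<open>auto simp: S_def\<close>)
  define \<alpha> where "\<alpha> = D (?l 0) $ j"
  have aff: "\<phi> (?l s) = \<phi> x + \<alpha> * s" if s: "s \<in> S" for s
  proof -
    have "\<phi> (?l s) \<le> \<phi> (?l 0) + D (?l 0) \<bullet> (?l s - ?l 0)" "\<phi> (?l 0) \<le> \<phi> (?l s) + D (?l s) \<bullet> (?l 0 - ?l s)"
      using supergradientD[OF D] l s S0 box_subset_cbox by blast+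
    then show ?thesis using const[OF s] by (simp add: inner_axis \<alpha>_def mult.commute)
  qed
  let ?p = "?l (- x $ j)"
  have xQ: "x \<in> unit_cube" using x box_subset_cbox by blast
  have pQ: "?p \<in> unit_cube" "?p $ j = 0"
    using xQ by (auto simp: mem_box_cart axis_def)
  \<comment> \<open>Parameters inside the line tending to its end. Closedness of the hull carries
    the affine values to the limit and gives upper semicontinuity there, the direction that is
    needed.\<close>
  define s where "s k = - x $ j + inverse (real (Suc k)) * x $ j" for k
  have sS: "s k \<in> S" for k
  proof -
    have "inverse (real (Suc k)) * x $ j \<le> 1 * x $ j"
      using xj by (intro mult_right_mono) (auto simp: field_simps)
    moreover have "inverse (real (Suc k)) * x $ j > 0" using xj by simp
    ultimately show ?thesis using xj unfolding S_def s_def greaterThanLessThan_iff by linarith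
  qed
  have slim: "s \<longlonglongrightarrow> - x $ j + 0 * x $ j"
    unfolding s_def by (intro tendsto_intros LIMSEQ_inverse_real_of_nat)
  have lim: "(\<lambda>k. (?l (s k), \<phi> x + \<alpha> * s k)) \<longlonglongrightarrow> (?l (- x $ j + 0 * x $ j), \<phi> x + \<alpha> * (- x $ j + 0 * x $ j))"
    by (intro tendsto_intros slim)
  have mem: "(?l (s k), \<phi> x + \<alpha> * s k) \<in> envelope_hull unit_cube f" for k
    using cenv_mem[OF compact_cbox generic_continuous, of "?l (s k)"] aff[OF sS] l sS box_subset_cbox by force
  have "(?l (- x $ j + 0 * x $ j), \<phi> x + \<alpha> * (- x $ j + 0 * x $ j)) \<in> envelope_hull unit_cube f"
    by (rule closed_sequentially[OF compact_imp_closed[OF compact_envelope_hull[OF compact_cbox generic_continuous]] mem lim])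
  then have usc: "\<phi> x - \<alpha> * x $ j \<le> \<phi> ?p"
    using cenv_upper[OF compact_cbox generic_continuous] by simp
  have "\<forall>\<^sub>F t in at_right 0. \<alpha> < (\<phi> (?p + (1 * t) *\<^sub>R axis j 1) - \<phi> ?p) / t"
    by (rule generic_quotient[OF _ pQ]) simp
  then have "\<forall>\<^sub>F t in at_right 0. \<alpha> < (\<phi> (?p + (1 * t) *\<^sub>R axis j 1) - \<phi> ?p) / t \<and> 0 < t \<and> t < 1"
    by (intro eventually_conj eventually_at_right_less) (auto simp: eventually_at_right_field intro: exI[of _ 1])
  then obtain t where t: "\<alpha> < (\<phi> (?p + (1 * t) *\<^sub>R axis j 1) - \<phi> ?p) / t" "0 < t" "t < 1"
    using eventually_happens[of _ "at_right (0::real)"] by (metis (no_types, lifting) trivial_limit_at_right_real)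
  have "?p + (1 * t) *\<^sub>R axis j 1 = ?l (t - x $ j)" by (simp add: algebra_simps)
  moreover have "\<phi> (?l (t - x $ j)) = \<phi> x + \<alpha> * (t - x $ j)"
    using t by (intro aff) (simp add: S_def)
  ultimately have "\<alpha> * t < \<phi> x + \<alpha> * (t - x $ j) - \<phi> ?p" using t by (simp add: field_simps)
  then show False using usc by (simp add: right_diff_distrib)
qed

lemma generic_bend_dim: "hausdorff_dim {x \<in> open_unit_cube. \<not> locally_affine \<phi> x} = ereal (real CARD('n) - 1)"
proof (rule antisym)
  have "coverable (CARD('n) - 1) n {x \<in> open_unit_cube. \<not> locally_affine \<phi> x}" for n
  proof -
    have "almost_polyhedral n f" using gen by (simp add: generic_def)
    then obtain N where "coverable (CARD('n) - 1) n N" "\<forall>x\<in>unit_cube. locally_affine \<phi> x \<or> x \<in> N"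
      unfolding almost_polyhedral_def by blast
    then show ?thesis using box_subset_cbox by (elim coverable_mono) blast
  qed
  then have "hausdorff_dim {x \<in> open_unit_cube. \<not> locally_affine \<phi> x} \<le> ereal (real (CARD('n) - 1))"
    by (rule hausdorff_dim_le)
  then show "hausdorff_dim {x \<in> open_unit_cube. \<not> locally_affine \<phi> x} \<le> ereal (real CARD('n) - 1)"
    by (simp add: of_nat_diff)
  show "ereal (real CARD('n) - 1) \<le> hausdorff_dim {x \<in> open_unit_cube. \<not> locally_affine \<phi> x}"
    by (rule hausdorff_dim_ge_lines[where j = undefined]) (use generic_line_meets_bend in blast)
qed

lemma generic_affine_dim: "hausdorff_dim {x \<in> open_unit_cube. locally_affine \<phi> x} = ereal (real CARD('n))"
proof (rule antisym)
  let ?A = "{x \<in> open_unit_cube. locally_affine \<phi> x}"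
  have "coverable CARD('n) n ?A" for n
    using box_covered_imp_coverable[OF box_covered_cube] by (rule coverable_mono) (use box_subset_cbox in blast)
  then show "hausdorff_dim ?A \<le> ereal (real CARD('n))" by (rule hausdorff_dim_le)
  have "open ?A"
    unfolding open_contains_ball
  proof
    fix x assume x: "x \<in> ?A"
    then obtain \<rho> c a where \<rho>: "\<rho> > 0" "ball x \<rho> \<subseteq> unit_cube" "\<forall>z\<in>ball x \<rho>. \<phi> z = c + a \<bullet> z"
      unfolding locally_affine_def by blast
    have "y \<in> ?A" if y: "y \<in> ball x \<rho>" for y
    proof -
      obtain e where e: "e > 0" "ball y e \<subseteq> ball x \<rho>" using y open_ball open_contains_ball by metis
      then have "locally_affine \<phi> y" unfolding locally_affine_def using \<rho> by blast
      moreover have "ball x \<rho> \<subseteq> interior unit_cube" using \<rho>(2) open_ball by (rule interior_maximal)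
      ultimately show ?thesis using y by (auto simp: interior_cbox)
    qed
    then show "\<exists>e>0. ball x e \<subseteq> ?A" using \<rho>(1) by blast
  qed
  \<comment> \<open>Otherwise the whole open cube would be the set of bends, whose dimension is only
    \<open>CARD('n) - 1\<close>.\<close>
  moreover have "?A \<noteq> {}"
  proof
    assume "?A = {}"
    then have *: "{x \<in> open_unit_cube. \<not> locally_affine \<phi> x} = open_unit_cube" by blast
    have "(\<chi> i. 1/2) \<in> (open_unit_cube :: (real^'n) set)" by (simp add: mem_box_cart)
    then have "ereal (real CARD('n)) \<le> hausdorff_dim (open_unit_cube :: (real^'n) set)"
      by (intro hausdorff_dim_ge_open[of open_unit_cube]) auto
    then show False using generic_bend_dim unfolding * by simp
  qed
  ultimately show "ereal (real CARD('n)) \<le> hausdorff_dim ?A" by (rule hausdorff_dim_ge_open) simp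
qed

lemma generic_contact_dim: "hausdorff_dim {x \<in> unit_cube. \<phi> x = f x} = 0"
proof (rule antisym)
  have "coverable 0 n {x \<in> unit_cube. \<phi> x = f x}" for n
    using gen by (simp add: generic_def almost_polyhedral_def)
  then have "hausdorff_dim {x \<in> unit_cube. \<phi> x = f x} \<le> ereal (real 0)" by (rule hausdorff_dim_le)
  then show "hausdorff_dim {x \<in> unit_cube. \<phi> x = f x} \<le> 0" by (simp add: zero_ereal_def)
  have "(0 :: real^'n) \<in> unit_cube" by (simp add: mem_box_cart)
  then have "(unit_cube :: (real^'n) set) \<noteq> {}" by blast
  \<comment> \<open>A maximum point of \<open>f\<close> is a contact point, witnessed by a
    horizontal plane; this excludes the dimension of the empty set.\<close>
  then obtain x where x: "x \<in> unit_cube" "\<forall>y\<in>unit_cube. f y \<le> f x"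
    using continuous_attains_sup[OF compact_cbox _ generic_continuous] by blast
  have "\<phi> x \<le> f x + 0 \<bullet> (x - x)" by (rule cenv_le_affine[OF compact_cbox generic_continuous]) (use x in auto)
  moreover have "f x \<le> \<phi> x" by (rule cenv_ge[OF compact_cbox generic_continuous x(1)])
  ultimately have "x \<in> {x \<in> unit_cube. \<phi> x = f x}" using x(1) by simp
  then show "0 \<le> hausdorff_dim {x \<in> unit_cube. \<phi> x = f x}" by (intro hausdorff_dim_ge_0) blast
qed

end

section \<open>Robust density of the generic conditions\<close>

text \<open>Expresses that the functions with \<open>P\<close> have dense interior, in terms free of
  extensional representatives and of the metric of the function space.\<close>

definition robustly_dense :: "((real^'n::finite \<Rightarrow> real) \<Rightarrow> bool) \<Rightarrow> bool" where
  "robustly_dense P \<longleftrightarrow>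
     (\<forall>f \<epsilon>. continuous_on unit_cube f \<longrightarrow> \<epsilon> > 0 \<longrightarrow>
        (\<exists>f' \<delta>. continuous_on unit_cube f' \<and> (\<forall>x\<in>unit_cube. \<bar>f x - f' x\<bar> \<le> \<epsilon>) \<and> \<delta> > 0 \<and>
           (\<forall>f''. continuous_on unit_cube f'' \<longrightarrow> (\<forall>x\<in>unit_cube. \<bar>f' x - f'' x\<bar> \<le> \<delta>) \<longrightarrow> P f'')))"

lemma robustly_denseE:
  assumes "robustly_dense P" "continuous_on unit_cube f" "\<epsilon> > 0"
  obtains f' \<delta> where "continuous_on unit_cube f'" "\<And>x. x \<in> unit_cube \<Longrightarrow> \<bar>f x - f' x\<bar> \<le> \<epsilon>" "\<delta> > 0"
    "\<And>f''. continuous_on unit_cube f'' \<Longrightarrow> (\<And>x. x \<in> unit_cube \<Longrightarrow> \<bar>f' x - f'' x\<bar> \<le> \<delta>) \<Longrightarrow> P f''"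
proof -
  from assms(1)[unfolded robustly_dense_def, rule_format, OF assms(2,3)]
  obtain f' \<delta> where *: "continuous_on unit_cube f' \<and> (\<forall>x\<in>unit_cube. \<bar>f x - f' x\<bar> \<le> \<epsilon>) \<and> \<delta> > 0 \<and>
     (\<forall>f''. continuous_on unit_cube f'' \<longrightarrow> (\<forall>x\<in>unit_cube. \<bar>f' x - f'' x\<bar> \<le> \<delta>) \<longrightarrow> P f'')"
    by (elim exE)
  show ?thesis by (rule that[of f' \<delta>]) (simp_all add: *)
qed

lemma uniform_modulus:
  fixes f :: "real^'n::finite \<Rightarrow> real"
  assumes "continuous_on unit_cube f" "\<epsilon> > 0"
  obtains \<rho> where "\<rho> > 0" "\<And>x y. x \<in> unit_cube \<Longrightarrow> y \<in> unit_cube \<Longrightarrow> dist x y < \<rho> \<Longrightarrow> \<bar>f x - f y\<bar> < \<epsilon>"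
proof -
  have "uniformly_continuous_on unit_cube f"
    by (rule compact_uniformly_continuous) (use assms in auto)
  then obtain \<rho> where "\<rho> > 0" "\<forall>x\<in>unit_cube. \<forall>x'\<in>unit_cube. dist x' x < \<rho> \<longrightarrow> dist (f x') (f x) < \<epsilon>"
    using assms(2) unfolding uniformly_continuous_on_def by meson
  then show ?thesis using that[of \<rho>] by (simp add: dist_real_def)
qed

text \<open>Subtracting steep ridges along the faces creates the boundary increments.\<close>

lemma robustly_dense_boundary_steep:
  "robustly_dense (boundary_steep n :: (real^'n::finite \<Rightarrow> real) \<Rightarrow> bool)"
  unfolding robustly_dense_def
proof (intro allI impI)
  fix f :: "real^'n \<Rightarrow> real" and \<epsilon> :: real
  assume f: "continuous_on unit_cube f" and \<epsilon>: "\<epsilon> > 0"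
  define \<eta> where "\<eta> = \<epsilon> / CARD('n)"
  have \<eta>: "\<eta> > 0" using \<epsilon> by (simp add: \<eta>_def)
  obtain \<rho> where \<rho>: "\<rho> > 0" "\<And>x y. x \<in> unit_cube \<Longrightarrow> y \<in> unit_cube \<Longrightarrow> dist x y < \<rho> \<Longrightarrow> \<bar>f x - f y\<bar> < \<eta> / 4"
    using uniform_modulus[OF f, of "\<eta> / 4"] \<eta> by auto
  \<comment> \<open>The three entries serve the modulus of continuity of \<open>f\<close>, the scale
    below \<open>1 / Suc n\<close>, and \<open>t powr (1 / Suc n) \<le> \<eta> / 4\<close>.\<close>
  define t where "t = min (min (\<rho> / 2) (1 / (2 * real (Suc n)))) ((\<eta> / 4) powr real (Suc n))"
  have t: "t > 0" "t < \<rho>" "t < 1 / Suc n" "t \<le> (\<eta> / 4) powr real (Suc n)"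
    using \<rho>(1) \<eta> unfolding t_def by (auto simp: min_less_iff_disj field_simps)
  have "t \<le> 1 / (2 * real (Suc n))" by (simp add: t_def)
  also have "\<dots> \<le> 1 / 2" by (simp add: field_simps)
  finally have t2: "t \<le> 1 / 2" .
  have tp: "t powr (1 / Suc n) \<le> \<eta> / 4"
  proof -
    have "t powr (1 / Suc n) \<le> ((\<eta> / 4) powr real (Suc n)) powr (1 / Suc n)"
      using t by (intro powr_mono2) auto
    then show ?thesis using \<eta> by (simp add: powr_powr)
  qed
  \<comment> \<open>A tent equal to 1 at both ends of the unit interval and 0 at distance at least
    \<open>t\<close> from them.\<close>
  define b where "b s = max 0 (1 - min s (1 - s) / t)" for s :: real
  have b: "0 \<le> b s" "b s \<le> 1" if "0 \<le> s" "s \<le> 1" for s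
    using that t(1) by (auto simp: b_def min_def)
  have bt: "b 0 = 1" "b 1 = 1" "b t = 0" "b (1 - t) = 0"
    using t(1) t2 by (auto simp: b_def min_def)
  define f' where "f' x = f x - (\<Sum>j\<in>UNIV. \<eta> * b (x $ j))" for x
  have "continuous_on unit_cube f'"
    unfolding f'_def b_def using t(1) by (intro continuous_intros f) auto
  moreover have "\<bar>f x - f' x\<bar> \<le> \<epsilon>" if x: "x \<in> unit_cube" for x
  proof -
    have xj: "0 \<le> x $ j" "x $ j \<le> 1" for j using x by (simp_all add: mem_box_cart)
    have "(\<Sum>j\<in>UNIV. \<eta> * b (x $ j)) \<ge> 0" using \<eta> b xj by (intro sum_nonneg) simp
    moreover have "(\<Sum>j\<in>(UNIV::'n set). \<eta> * b (x $ j)) \<le> (\<Sum>j\<in>(UNIV::'n set). \<eta> * 1)"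
      using \<eta> b xj by (intro sum_mono mult_left_mono) auto
    then have "(\<Sum>j\<in>(UNIV::'n set). \<eta> * b (x $ j)) \<le> \<epsilon>" by (simp add: \<eta>_def)
    ultimately show ?thesis by (simp add: f'_def)
  qed
  moreover have "boundary_steep n g" if g: "\<forall>x\<in>unit_cube. \<bar>f' x - g x\<bar> \<le> \<eta> / 4" for g
    unfolding boundary_steep_def
  proof (intro exI[of _ t] conjI allI impI ballI)
    fix j a \<sigma> and w :: "real^'n"
    assume a: "(a, \<sigma>) \<in> {(0::real, 1::real), (1, -1)}" and w: "w \<in> unit_cube" "w $ j = a"
    define w' where "w' = w + (\<sigma> * t) *\<^sub>R axis j 1"
    have w': "w' \<in> unit_cube" unfolding w'_def using face_inward_mem[OF a w] t t2 by simp
    have "dist w' w = t" using a t(1) by (auto simp: w'_def dist_norm norm_axis_1)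
    then have "\<bar>f w' - f w\<bar> < \<eta> / 4" using \<rho>(2)[OF w' w(1)] t by simp
    moreover have "(\<Sum>i\<in>UNIV. \<eta> * b (w $ i)) = \<eta> + (\<Sum>i\<in>UNIV - {j}. \<eta> * b (w $ i))"
      using a w(2) bt by (subst sum.remove[of _ j]) auto
    moreover have "(\<Sum>i\<in>UNIV. \<eta> * b (w' $ i)) = (\<Sum>i\<in>UNIV - {j}. \<eta> * b (w' $ i))"
    proof -
      have "w' $ j = t \<or> w' $ j = 1 - t" using a w(2) by (auto simp: w'_def)
      then show ?thesis using bt by (subst sum.remove[of _ j]) auto
    qed
    moreover have "(\<Sum>i\<in>UNIV - {j}. \<eta> * b (w' $ i)) = (\<Sum>i\<in>UNIV - {j}. \<eta> * b (w $ i))"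
      by (rule sum.cong) (auto simp: w'_def axis_def)
    \<comment> \<open>The ridge contributes \<eta> and \<open>f\<close> costs at most a quarter of
      it; the two values of \<open>g\<close> cost a quarter each, and the last quarter is the
      increment.\<close>
    ultimately have "f' w' - f' w \<ge> \<eta> * 3 / 4" unfolding f'_def by linarith
    moreover have "\<bar>f' w - g w\<bar> \<le> \<eta> / 4" "\<bar>f' w' - g w'\<bar> \<le> \<eta> / 4" using g w(1) w' by blast+
    ultimately have "g w' - g w \<ge> \<eta> / 4" by linarith
    then show "t powr (1 / real (Suc n)) \<le> g (w + (\<sigma> * t) *\<^sub>R axis j 1) - g w"
      using tp by (simp add: w'_def)
  qed (use t in auto)
  ultimately show "\<exists>f' \<delta>. continuous_on unit_cube f' \<and> (\<forall>x\<in>unit_cube. \<bar>f x - f' x\<bar> \<le> \<epsilon>) \<and> \<delta> > 0 \<and>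
     (\<forall>f''. continuous_on unit_cube f'' \<longrightarrow> (\<forall>x\<in>unit_cube. \<bar>f' x - f'' x\<bar> \<le> \<delta>) \<longrightarrow> boundary_steep n f'')"
    using \<eta> by (intro exI[of _ f'] exI[of _ "\<eta> / 4"]) simp
qed

text \<open>Polynomials are dense and their second differences are quadratic in the step, hence far
  above the allowed \<open>- (t / Suc n)\<close> at a small scale; the rest is slack for the
  perturbation.\<close>

lemma robustly_dense_almost_smooth:
  "robustly_dense (almost_smooth n :: (real^'n::finite \<Rightarrow> real) \<Rightarrow> bool)"
  unfolding robustly_dense_def
proof (intro allI impI)
  fix f :: "real^'n \<Rightarrow> real" and \<epsilon> :: real
  assume f: "continuous_on unit_cube f" and \<epsilon>: "\<epsilon> > 0"
  obtain p where p: "real_polynomial_function p" "\<And>x. x \<in> unit_cube \<Longrightarrow> \<bar>f x - p x\<bar> < \<epsilon>"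
    using Stone_Weierstrass_real_polynomial_function[OF compact_cbox f \<epsilon>] by metis
  obtain B where B: "\<And>x. x \<in> unit_cube \<Longrightarrow> norm (x::real^'n) \<le> B"
    using bounded_cbox[of "0::real^'n" 1] unfolding bounded_iff by metis
  obtain K where "taylor_bounded B p K" by (rule real_polynomial_function_taylor_bounded[OF p(1)])
  note K = taylor_boundedD(1,4)[OF this]
  \<comment> \<open>Makes the quadratic bound at most half of \<open>t / Suc n\<close>. The other
    half is four times \<open>t / (8 * Suc n)\<close>, the errors entering with weights 1, 1 and
    2.\<close>
  define t where "t = 1 / (2 * real (Suc n)) / (K + 1)"
  have t: "t > 0" using K(1) by (simp add: t_def)
  have Kt: "(K + 1) * t = 1 / (2 * real (Suc n))" using K(1) unfolding t_def by (simp del: of_nat_Suc)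
  have tn: "t < 1 / Suc n"
  proof -
    have "1 * t \<le> (K + 1) * t" using K(1) t by (intro mult_right_mono) auto
    then have "t \<le> 1 / (2 * real (Suc n))" using Kt by simp
    also have "\<dots> < 1 / Suc n" by (simp add: field_simps)
    finally show ?thesis .
  qed
  have Kt2: "K * t\<^sup>2 \<le> t / (2 * real (Suc n))"
  proof -
    have "K * t\<^sup>2 \<le> ((K + 1) * t) * t" using t by (simp add: power2_eq_square algebra_simps)
    then show ?thesis unfolding Kt by simp
  qed
  have "almost_smooth n g" if g: "\<forall>x\<in>unit_cube. \<bar>p x - g x\<bar> \<le> t / (8 * real (Suc n))" for g
    unfolding almost_smooth_def
  proof (intro exI[of _ t] conjI allI impI)
    fix x u :: "real^'n"
    assume u: "norm u = t" and x: "x \<in> unit_cube" "x + u \<in> unit_cube" "x - u \<in> unit_cube"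
    define q where "q = t / (8 * real (Suc n))"
    have "t / (2 * m) = 4 * (t / (8 * m))" "t / m = 8 * (t / (8 * m))" for m :: real by simp_all
    then have q: "t / (2 * real (Suc n)) = 4 * q" "t / real (Suc n) = 8 * q" unfolding q_def by blast+
    have "\<bar>p (x + u) + p (x - u) - 2 * p x\<bar> \<le> 4 * q"
      using K(2)[of x u] B x u Kt2 unfolding q by fastforce
    moreover have "\<bar>p x - g x\<bar> \<le> q" "\<bar>p (x + u) - g (x + u)\<bar> \<le> q" "\<bar>p (x - u) - g (x - u)\<bar> \<le> q"
      using g x unfolding q_def by blast+
    ultimately show "- (t / real (Suc n)) \<le> g (x + u) + g (x - u) - 2 * g x"
      unfolding q abs_le_iff by linarith
  qed (use t tn in auto)
  moreover have "continuous_on unit_cube p"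
    using continuous_on_polymonial_function p(1) real_polynomial_function_eq by blast
  ultimately show "\<exists>f' \<delta>. continuous_on unit_cube f' \<and> (\<forall>x\<in>unit_cube. \<bar>f x - f' x\<bar> \<le> \<epsilon>) \<and> \<delta> > 0 \<and>
     (\<forall>f''. continuous_on unit_cube f'' \<longrightarrow> (\<forall>x\<in>unit_cube. \<bar>f' x - f'' x\<bar> \<le> \<delta>) \<longrightarrow> almost_smooth n f'')"
    using p(2) t by (intro exI[of _ p] exI[of _ "t / (8 * real (Suc n))"]) (auto intro: less_imp_le)
qed

section \<open>Fine point sets and general position\<close>

text \<open>Takes finite spanning sets of the boxes of a gauge-fine tagged division. A point of the
  cube lies in the hull of such a set, and both are within \<open>\<rho> / 2\<close> of the
  tag.\<close>

lemma fine_finite_subset_cube: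
  assumes "\<rho> > 0"
  obtains Z :: "(real^'n::finite) set" where "finite Z" "Z \<subseteq> unit_cube"
    "\<And>x. x \<in> unit_cube \<Longrightarrow> x \<in> convex hull (Z \<inter> ball x \<rho>)"
proof -
  have "gauge (\<lambda>x::real^'n. ball x (\<rho> / 2))" using assms by (simp add: gauge_ball)
  then obtain D where D: "D tagged_division_of (unit_cube :: (real^'n) set)" "(\<lambda>x. ball x (\<rho> / 2)) fine D"
    using fine_division_exists by blast
  have "\<exists>S. finite S \<and> k = convex hull S" if xk: "(x, k) \<in> D" for x k
  proof -
    obtain a b where "k = cbox a b" using tagged_division_ofD(4)[OF D(1) xk] by blast
    then show ?thesis using closed_interval_as_convex_hull[of a b] by metis
  qed
  then obtain S where S: "\<And>x k. (x, k) \<in> D \<Longrightarrow> finite (S x k) \<and> k = convex hull (S x k)"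
    by metis
  define Z where "Z = (\<Union>(x, k)\<in>D. S x k)"
  have sub: "S x k \<subseteq> k" if "(x, k) \<in> D" for x k using S[OF that] hull_subset by metis
  show ?thesis
  proof (rule that)
    show "finite Z" unfolding Z_def using tagged_division_ofD(1)[OF D(1)] S by auto
    show "Z \<subseteq> unit_cube"
      unfolding Z_def using sub tagged_division_ofD(3)[OF D(1)] by blast
    fix x :: "real^'n" assume "x \<in> unit_cube"
    then have "x \<in> \<Union>{k. \<exists>x. (x, k) \<in> D}" using tagged_division_ofD(6)[OF D(1)] by simp
    then obtain t k where tk: "(t, k) \<in> D" "x \<in> k" by blast
    have k: "k \<subseteq> ball t (\<rho> / 2)" using D(2) tk(1) by (auto simp: fine_def)
    have "S t k \<subseteq> ball x \<rho>"
    proof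
      fix z assume "z \<in> S t k"
      then have "dist t z < \<rho> / 2" "dist t x < \<rho> / 2" using sub[OF tk(1)] k tk(2) by auto
      then show "z \<in> ball x \<rho>" using dist_triangle_half_r[of t x \<rho> z] by (simp add: dist_commute)
    qed
    then have "S t k \<subseteq> Z \<inter> ball x \<rho>" using tk(1) by (auto simp: Z_def)
    then show "x \<in> convex hull (Z \<inter> ball x \<rho>)" using S[OF tk(1)] tk(2) hull_mono by blast
  qed
qed

text \<open>Induction over the hyperplanes: a small change of one height with non-zero coefficient
  leaves the new hyperplane, and the inequalities already obtained survive if the change is small
  enough.\<close>

lemma avoid_hyperplanes:
  fixes c :: "'i \<Rightarrow> 'a \<Rightarrow> real"
  assumes Z: "finite Z" and I: "finite I" "\<And>i. i \<in> I \<Longrightarrow> \<exists>z\<in>Z. c i z \<noteq> 0" and e: "e > 0"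
  shows "\<exists>y'. (\<forall>z\<in>Z. \<bar>y' z - y z\<bar> \<le> e) \<and> (\<forall>i\<in>I. (\<Sum>z\<in>Z. c i z * y' z) \<noteq> 0)"
  using I(1) I(2) e
proof (induction I arbitrary: e rule: finite_induct)
  case empty
  then show ?case by (intro exI[of _ y]) auto
next
  case (insert i I)
  then obtain y' where y': "\<forall>z\<in>Z. \<bar>y' z - y z\<bar> \<le> e / 2" "\<forall>i\<in>I. (\<Sum>z\<in>Z. c i z * y' z) \<noteq> 0"
    using insert.IH[of "e / 2"] by auto
  obtain z0 where z0: "z0 \<in> Z" "c i z0 \<noteq> 0" using insert.prems(1) by blast
  define Y where "Y s = y'(z0 := y' z0 + s)" for s
  have Y: "(\<Sum>z\<in>Z. c k z * Y s z) = (\<Sum>z\<in>Z. c k z * y' z) + c k z0 * s" for k s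
  proof -
    have "c k z * Y s z = c k z * y' z + (if z = z0 then c k z0 * s else 0)" for z
      by (simp add: Y_def distrib_left)
    then show ?thesis using Z z0(1) by (simp add: sum.distrib sum.delta)
  qed
  have ev: "\<forall>\<^sub>F s in at_right 0. (\<Sum>z\<in>Z. c k z * y' z) + c k z0 * s \<noteq> 0"
    if nz: "(\<Sum>z\<in>Z. c k z * y' z) \<noteq> 0 \<or> c k z0 \<noteq> 0" for k
  proof (cases "(\<Sum>z\<in>Z. c k z * y' z) = 0")
    case True
    then show ?thesis using nz eventually_at_right_less[of "0::real"] by (auto elim: eventually_mono)
  next
    case False
    have "((\<lambda>s. (\<Sum>z\<in>Z. c k z * y' z) + c k z0 * s) \<longlongrightarrow> (\<Sum>z\<in>Z. c k z * y' z) + c k z0 * 0) (at_right 0)"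
      by (intro tendsto_intros)
    then show ?thesis using False by (intro tendsto_imp_eventually_ne) auto
  qed
  have "\<forall>\<^sub>F s in at_right (0::real). \<forall>k\<in>insert i I. (\<Sum>z\<in>Z. c k z * y' z) + c k z0 * s \<noteq> 0"
  proof (rule eventually_ball_finite)
    show "\<forall>k\<in>insert i I. \<forall>\<^sub>F s in at_right 0. (\<Sum>z\<in>Z. c k z * y' z) + c k z0 * s \<noteq> 0"
      using ev y'(2) z0(2) by blast
  qed (use insert.hyps(1) in simp)
  moreover have "\<forall>\<^sub>F s in at_right (0::real). 0 < s \<and> s < e / 2"
    using insert.prems(2) by (auto simp: eventually_at_right_field intro!: exI[of _ "e / 2"])
  ultimately have "\<forall>\<^sub>F s in at_right (0::real). (\<forall>k\<in>insert i I. (\<Sum>z\<in>Z. c k z * y' z) + c k z0 * s \<noteq> 0) \<and> 0 < s \<and> s < e / 2"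
    by (rule eventually_conj)
  from eventually_happens'[OF trivial_limit_at_right_real this]
  obtain s where s: "\<forall>k\<in>insert i I. (\<Sum>z\<in>Z. c k z * y' z) + c k z0 * s \<noteq> 0" "0 < s" "s < e / 2"
    by blast
  have "\<bar>Y s z - y z\<bar> \<le> e" if "z \<in> Z" for z
  proof -
    have "\<bar>y' z - y z\<bar> \<le> e / 2" using y'(1) that by blast
    then have "\<bar>y' z + s - y z\<bar> \<le> e" "\<bar>y' z - y z\<bar> \<le> e" using s(2,3) by linarith+
    then show ?thesis by (auto simp: Y_def)
  qed
  then show ?case using s(1) by (intro exI[of _ "Y s"]) (auto simp: Y)
qed

text \<open>An affine dependence of \<open>T\<close> is a linear equation satisfied by all heights
  that agree on \<open>T\<close> with an affine function. Finitely many dependent \<open>T\<close>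
  exclude finitely many hyperplanes of heights, so the vertices over a common plane always form a
  simplex.\<close>

lemma general_position:
  fixes Z :: "'a::euclidean_space set"
  assumes Z: "finite Z" and e: "e > 0"
  obtains y' where "\<And>z. z \<in> Z \<Longrightarrow> \<bar>y' z - y z\<bar> \<le> e"
    "\<And>c a. \<not> affine_dependent {z \<in> Z. y' z = c + a \<bullet> z}"
proof -
  define I where "I = {T. T \<subseteq> Z \<and> affine_dependent T}"
  have fin: "finite T" if "T \<in> I" for T using that Z finite_subset by (auto simp: I_def)
  have "\<exists>U. sum U T = 0 \<and> (\<exists>v\<in>T. U v \<noteq> 0) \<and> (\<Sum>v\<in>T. U v *\<^sub>R v) = 0" if "T \<in> I" for T
    using affine_dependent_explicit_finite[OF fin[OF that]] that by (simp add: I_def)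
  then obtain U where U: "\<And>T. T \<in> I \<Longrightarrow> sum (U T) T = 0 \<and> (\<exists>v\<in>T. U T v \<noteq> 0) \<and> (\<Sum>v\<in>T. U T v *\<^sub>R v) = 0"
    by metis
  have "\<exists>y'. (\<forall>z\<in>Z. \<bar>y' z - y z\<bar> \<le> e) \<and> (\<forall>T\<in>I. (\<Sum>z\<in>Z. (if z \<in> T then U T z else 0) * y' z) \<noteq> 0)"
  proof (rule avoid_hyperplanes[OF Z _ _ e])
    show "finite I" using Z by (simp add: I_def)
    show "\<exists>z\<in>Z. (if z \<in> T then U T z else 0) \<noteq> 0" if "T \<in> I" for T
      using U[OF that] that by (auto simp: I_def)
  qed
  then obtain y' where y': "\<forall>z\<in>Z. \<bar>y' z - y z\<bar> \<le> e"
    "\<And>T. T \<in> I \<Longrightarrow> (\<Sum>z\<in>Z. (if z \<in> T then U T z else 0) * y' z) \<noteq> 0" by blast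
  have "\<not> affine_dependent {z \<in> Z. y' z = c + a \<bullet> z}" for c a
  proof
    let ?T = "{z \<in> Z. y' z = c + a \<bullet> z}"
    assume "affine_dependent ?T"
    then have T: "?T \<in> I" by (simp add: I_def)
    have "(\<Sum>z\<in>Z. (if z \<in> ?T then U ?T z else 0) * y' z) = (\<Sum>z\<in>Z. if z \<in> ?T then U ?T z * (c + a \<bullet> z) else 0)"
      by (rule sum.cong) auto
    also have "\<dots> = (\<Sum>z\<in>?T. U ?T z * (c + a \<bullet> z))"
      using Z by (subst sum.inter_filter[symmetric]) (auto intro: sum.cong)
    also have "\<dots> = c * sum (U ?T) ?T + a \<bullet> (\<Sum>z\<in>?T. U ?T z *\<^sub>R z)"
      by (simp add: inner_sum_right sum_distrib_left sum.distrib[symmetric] algebra_simps)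
    also have "\<dots> = 0" using U[OF T] by simp
    finally show False using y'(2)[OF T] by simp
  qed
  then show ?thesis using that y'(1) by blast
qed

section \<open>Polyhedral approximations\<close>

lemma concave_ge_affine_hull:
  fixes h :: "'a::euclidean_space \<Rightarrow> real"
  assumes h: "concave_on S h" and W: "W \<subseteq> S" "\<And>w. w \<in> W \<Longrightarrow> c + a \<bullet> w \<le> h w"
    and p: "p \<in> convex hull W"
  shows "c + a \<bullet> p \<le> h p"
proof -
  have S: "convex S" using h by (simp add: concave_on_iff)
  have "convex {p \<in> S. c + a \<bullet> p \<le> h p}"
  proof (rule convexI, clarify, intro conjI)
    fix x y and u v :: real
    assume *: "x \<in> S" "c + a \<bullet> x \<le> h x" "y \<in> S" "c + a \<bullet> y \<le> h y" "0 \<le> u" "0 \<le> v" "u + v = 1"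
    then show "u *\<^sub>R x + v *\<^sub>R y \<in> S" using S by (simp add: convexD)
    have "c + a \<bullet> (u *\<^sub>R x + v *\<^sub>R y) = (u + v) * c + u * (a \<bullet> x) + v * (a \<bullet> y)"
      using * by (simp add: inner_add_right)
    also have "\<dots> = u * (c + a \<bullet> x) + v * (c + a \<bullet> y)" by (simp add: algebra_simps)
    also have "\<dots> \<le> u * h x + v * h y" using * by (intro add_mono mult_left_mono)
    also have "\<dots> \<le> h (u *\<^sub>R x + v *\<^sub>R y)" using h * unfolding concave_on_iff by blast
    finally show "c + a \<bullet> (u *\<^sub>R x + v *\<^sub>R y) \<le> h (u *\<^sub>R x + v *\<^sub>R y)" .
  qed
  then have "convex hull W \<subseteq> {p \<in> S. c + a \<bullet> p \<le> h p}" using W by (intro hull_minimal) auto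
  then show ?thesis using p by blast
qed

lemma convex_hull_near:
  fixes A W :: "'a::euclidean_space set"
  assumes "\<And>w. w \<in> W \<Longrightarrow> \<exists>v\<in>A. dist w v < r" and x: "x \<in> convex hull W"
  shows "\<exists>q\<in>convex hull A. dist x q < r"
proof -
  have "convex {x. \<exists>q\<in>convex hull A. dist x q < r}"
  proof (rule convexI, clarify)
    fix x y p q and u v :: real
    assume *: "p \<in> convex hull A" "dist x p < r" "q \<in> convex hull A" "dist y q < r" "0 \<le> u" "0 \<le> v" "u + v = 1"
    have "dist (u *\<^sub>R x + v *\<^sub>R y) (u *\<^sub>R p + v *\<^sub>R q) = norm (u *\<^sub>R (x - p) + v *\<^sub>R (y - q))"
      by (simp add: dist_norm algebra_simps)
    also have "\<dots> \<le> u * dist x p + v * dist y q"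
      using norm_triangle_ineq[of "u *\<^sub>R (x - p)" "v *\<^sub>R (y - q)"] * by (simp add: dist_norm)
    also have "\<dots> < r" using * by (intro convex_bound_lt) auto
    finally show "\<exists>s\<in>convex hull A. dist (u *\<^sub>R x + v *\<^sub>R y) s < r"
      using * by (intro bexI[of _ "u *\<^sub>R p + v *\<^sub>R q"]) (auto intro: convexD)
  qed
  moreover have "W \<subseteq> {x. \<exists>q\<in>convex hull A. dist x q < r}"
    using assms(1) hull_inc[of _ A convex] by blast
  ultimately have "convex hull W \<subseteq> {x. \<exists>q\<in>convex hull A. dist x q < r}" by (intro hull_minimal)
  then show ?thesis using x by blast
qed

text \<open>Separation avoids any bookkeeping of barycentric coordinates.\<close>

lemma ball_subset_perturbed_hull:
  fixes T W :: "'a::euclidean_space set"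
  assumes \<eta>: "\<eta> > 0" and T: "ball x \<eta> \<subseteq> convex hull T" and W: "compact W"
    and near: "\<And>v. v \<in> T \<Longrightarrow> \<exists>w\<in>W. dist w v < \<eta> / 2"
  shows "ball x (\<eta> / 2) \<subseteq> convex hull W"
proof (rule subsetI, rule ccontr)
  fix p assume p: "p \<in> ball x (\<eta> / 2)" "p \<notin> convex hull W"
  have "closed (convex hull W)" using W compact_convex_hull compact_imp_closed by blast
  then obtain a b where ab: "a \<bullet> p < b" "\<forall>y\<in>convex hull W. b < a \<bullet> y"
    using separating_hyperplane_closed_point[OF convex_convex_hull _ p(2)] by blast
  have v: "v \<in> {z. a \<bullet> z \<ge> a \<bullet> p - norm a * (\<eta> / 2)}" if "v \<in> T" for v
  proof -
    obtain w where w: "w \<in> W" "dist w v < \<eta> / 2" using near \<open>v \<in> T\<close> by blast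
    have "a \<bullet> w > a \<bullet> p" using ab w(1) hull_inc[of w W convex] by force
    moreover have "a \<bullet> (w - v) \<le> norm a * norm (w - v)" by (rule norm_cauchy_schwarz)
    moreover have "norm a * norm (w - v) \<le> norm a * (\<eta> / 2)"
      using w(2) by (intro mult_left_mono) (auto simp: dist_norm)
    ultimately show ?thesis by (simp add: inner_diff_right)
  qed
  have "convex hull T \<subseteq> {z. a \<bullet> z \<ge> a \<bullet> p - norm a * (\<eta> / 2)}"
    by (rule hull_minimal) (use v in \<open>auto intro: convex_halfspace_ge\<close>)
  then have half: "a \<bullet> z \<ge> a \<bullet> p - norm a * (\<eta> / 2)" if "dist x z < \<eta>" for z
    using T that by auto
  have a0: "a \<noteq> 0"
  proof
    assume a0: "a = 0"
    obtain t where "t \<in> T" using T \<eta> by (metis centre_in_ball convex_hull_empty empty_iff ex_in_conv subsetD)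
    then obtain w where "w \<in> W" using near by blast
    then show False using ab a0 hull_inc[of w W convex] by force
  qed
  \<comment> \<open>The midpoint between \<open>\<eta> / 2\<close> and
    \<open>\<eta> - dist x p\<close>: long enough to violate the half-space bound, short enough to
    stay in \<open>ball x \<eta>\<close>.\<close>
  define s where "s = (\<eta> / 2 + (\<eta> - dist x p)) / 2"
  have s: "\<eta> / 2 < s" "dist x p + s < \<eta>" using p(1) \<eta> by (simp_all add: s_def field_simps)
  have "dist x (p - s *\<^sub>R sgn a) \<le> dist x p + norm (s *\<^sub>R sgn a)"
    using dist_triangle[of x "p - s *\<^sub>R sgn a" p] by (simp add: dist_norm)
  also have "\<dots> < \<eta>" using s \<eta> a0 by (simp add: norm_sgn)
  finally have "a \<bullet> p - norm a * (\<eta> / 2) \<le> a \<bullet> p - s * norm a"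
    using half by (force simp: inner_diff_right inner_sgn_self)
  then have "norm a * s \<le> norm a * (\<eta> / 2)" by (simp add: mult.commute)
  then show False using a0 s(1) by simp
qed

text \<open>Interior points of a simplex have strictly positive barycentric coordinates. A
  representation without \<open>v\<close> would differ from these and yield an affine
  dependence.\<close>

lemma convex_hull_remove_not_interior:
  fixes T :: "'a::euclidean_space set"
  assumes T: "\<not> affine_dependent T" and v: "v \<in> T" and p: "p \<in> convex hull (T - {v})"
  shows "p \<notin> interior (convex hull T)"
proof
  assume i: "p \<in> interior (convex hull T)"
  have fin: "finite T" using T aff_independent_finite by blast
  obtain u where u: "\<forall>x\<in>T. 0 < u x" "sum u T = 1" "(\<Sum>x\<in>T. u x *\<^sub>R x) = p"
    using i unfolding interior_convex_hull_explicit_minimal[OF T] by (auto split: if_splits)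
  obtain w where w: "\<forall>x\<in>T - {v}. 0 \<le> w x" "sum w (T - {v}) = 1" "(\<Sum>x\<in>T - {v}. w x *\<^sub>R x) = p"
    using p fin by (auto simp: convex_hull_finite)
  define U where "U x = u x - (if x = v then 0 else w x)" for x
  have r: "sum u T = u v + sum u (T - {v})" "(\<Sum>x\<in>T. u x *\<^sub>R x) = u v *\<^sub>R v + (\<Sum>x\<in>T - {v}. u x *\<^sub>R x)"
    "sum U T = U v + sum U (T - {v})" "(\<Sum>x\<in>T. U x *\<^sub>R x) = U v *\<^sub>R v + (\<Sum>x\<in>T - {v}. U x *\<^sub>R x)"
    using fin v by (simp_all add: sum.remove)
  have "sum U (T - {v}) = sum u (T - {v}) - sum w (T - {v})"
    unfolding sum_subtractf[symmetric] by (rule sum.cong) (auto simp: U_def)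
  then have "sum U T = 0" using r u(2) w(2) by (simp add: U_def)
  moreover have "(\<Sum>x\<in>T - {v}. U x *\<^sub>R x) = (\<Sum>x\<in>T - {v}. u x *\<^sub>R x) - (\<Sum>x\<in>T - {v}. w x *\<^sub>R x)"
    unfolding sum_subtractf[symmetric] by (rule sum.cong) (auto simp: U_def scaleR_diff_left)
  then have "(\<Sum>x\<in>T. U x *\<^sub>R x) = 0" using r u(3) w(3) by (simp add: U_def)
  moreover have "U v \<noteq> 0" using u(1) v by (force simp: U_def)
  ultimately have "affine_dependent T" using affine_dependent_explicit_finite[OF fin] v by blast
  then show False using T by blast
qed

text \<open>If \<open>C\<close> has empty interior it lies in a hyperplane, whose normal works;
  otherwise separate \<open>k\<close> from the interior, whose closure contains
  \<open>C\<close>.\<close>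

lemma convex_not_interior_support:
  fixes C :: "'a::euclidean_space set"
  assumes C: "convex C" "k \<in> C" "k \<notin> interior C"
  obtains u where "u \<noteq> 0" "\<And>z. z \<in> C \<Longrightarrow> u \<bullet> (z - k) \<ge> 0"
proof (cases "interior C = {}")
  case True
  then obtain a b where "a \<noteq> 0" "C \<subseteq> {x. a \<bullet> x = b}"
    using empty_interior_subset_hyperplane[OF C(1)] by metis
  then have "a \<noteq> 0" "a \<bullet> z = b" if "z \<in> C" for z using that by auto
  then show ?thesis using that[of a] C(2) by (simp add: inner_diff_right)
next
  case False
  have "{k} \<inter> interior C = {}" using C(3) by blast
  then obtain a b where ab: "a \<noteq> 0" "\<forall>x\<in>{k}. a \<bullet> x \<le> b" "\<forall>x\<in>interior C. a \<bullet> x \<ge> b"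
    using separating_hyperplane_sets[of "{k}" "interior C"] False C(1) by auto
  have "interior C \<subseteq> {x. b \<le> a \<bullet> x}" using ab(3) by blast
  then have "closure (interior C) \<subseteq> {x. b \<le> a \<bullet> x}"
    by (rule closure_minimal) (rule closed_halfspace_ge)
  moreover have "closure (interior C) = closure C" by (rule convex_closure_interior[OF C(1) False])
  ultimately have "C \<subseteq> {x. b \<le> a \<bullet> x}" using closure_subset by blast
  then show ?thesis using that[of a] ab by (force simp: inner_diff_right)
qed

text \<open>\<open>f\<close> shares its envelope with the vertices and touches it only at them. The
  gap grows with the distance to \<open>Z\<close>, so that contact points stay localised under
  perturbation; the cut-off at 1 keeps the gap at most \<open>e\<close>.\<close>

locale polyhedral_approximation =
  fixes Z :: "(real^'n::finite) set" and y f :: "real^'n \<Rightarrow> real" and e :: real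
  assumes Z: "finite Z" "convex hull Z = unit_cube"
    and gp: "\<And>c a. \<not> affine_dependent {z \<in> Z. y z = c + a \<bullet> z}"
    and e: "e > 0"
    and f: "continuous_on unit_cube f" "\<And>z. z \<in> Z \<Longrightarrow> f z = y z"
    and f_le: "\<And>x. x \<in> unit_cube \<Longrightarrow> f x \<le> cenv Z y x - e * min 1 (infdist x Z)"
begin

abbreviation "g \<equiv> cenv Z y"

definition touching :: "real \<Rightarrow> real^'n \<Rightarrow> (real^'n) set" where
  "touching c a = {z \<in> Z. y z = c + a \<bullet> z}"

text \<open>Indexed by affine functions rather than by vertex sets, so that two facets can be
  compared through the values of \<open>g\<close>.\<close>

definition facets :: "(real \<times> (real^'n)) set" where
  "facets = {(c, a). (\<forall>z\<in>Z. y z \<le> c + a \<bullet> z) \<and> interior (convex hull touching c a) \<noteq> {}}"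

text \<open>Contains the frontier of the cube as well as the walls between facets.\<close>

definition skeleton :: "(real^'n) set" where
  "skeleton = unit_cube - (\<Union>(c, a)\<in>facets. interior (convex hull touching c a))"

section \<open>Facets and skeleton of the polyhedral envelope\<close>

lemma y_cont: "continuous_on Z y" and Z_compact: "compact Z" and Z_cube: "Z \<subseteq> unit_cube"
  using Z hull_subset[of Z convex] by (auto simp: finite_imp_compact intro: continuous_on_finite)

lemma Z_ne: "Z \<noteq> {}"
proof
  assume "Z = {}"
  moreover have "(0::real^'n) \<in> unit_cube" by (simp add: mem_box_cart)
  ultimately show False using Z(2) by simp
qed

lemma g_concave: "concave_on unit_cube g"
  using concave_cenv[OF Z_compact y_cont] Z(2) by simp

lemma g_continuous: "continuous_on unit_cube g"
  using continuous_on_cenv_finite[OF Z(1)] Z(2) by metis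

lemma f_le_g: "x \<in> unit_cube \<Longrightarrow> f x \<le> g x"
  using f_le[of x] e infdist_nonneg[of x Z] by (smt (verit) mult_nonneg_nonneg)

lemma cenv_f: "x \<in> unit_cube \<Longrightarrow> cenv unit_cube f x = g x"
proof (rule antisym)
  assume x: "x \<in> unit_cube"
  show "cenv unit_cube f x \<le> g x"
    by (rule cenv_least[OF compact_cbox f(1)]) (use x g_concave f_le_g in auto)
  have "concave_on (convex hull Z) (cenv unit_cube f)"
    using concave_cenv[OF compact_cbox f(1)] Z(2) by simp
  then show "g x \<le> cenv unit_cube f x"
    by (rule cenv_least[OF Z_compact y_cont]) (use x Z Z_cube f(2) cenv_ge[OF compact_cbox f(1)] in \<open>auto simp flip: f(2)\<close>)
qed

lemma cenv_near_g:
  assumes "continuous_on unit_cube h" "\<forall>x\<in>unit_cube. \<bar>f x - h x\<bar> \<le> \<delta>" "x \<in> unit_cube"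
  shows "\<bar>cenv unit_cube h x - g x\<bar> \<le> \<delta>"
  using cenv_close[OF compact_cbox f(1) assms(1), of \<delta> x] assms cenv_f[OF assms(3)]
  by (simp add: abs_minus_commute)

lemma touching_subset: "touching c a \<subseteq> Z" "finite (touching c a)"
  using Z(1) by (auto simp: touching_def)

lemma hull_touching_cube: "convex hull touching c a \<subseteq> unit_cube"
  using hull_mono[OF touching_subset(1)] Z(2) by metis

lemma g_le_affine:
  assumes "\<And>z. z \<in> Z \<Longrightarrow> y z \<le> c + a \<bullet> z" "p \<in> unit_cube"
  shows "g p \<le> c + a \<bullet> p"
  using cenv_le_affine[OF Z_compact y_cont, of c a 0 p] assms Z(2) by simp

lemma g_eq_on_hull:
  assumes "\<And>z. z \<in> Z \<Longrightarrow> y z \<le> c + a \<bullet> z" "p \<in> convex hull touching c a"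
  shows "g p = c + a \<bullet> p"
proof (rule antisym)
  show "g p \<le> c + a \<bullet> p" using g_le_affine assms hull_touching_cube by blast
  show "c + a \<bullet> p \<le> g p"
    by (rule concave_ge_affine_hull[OF g_concave _ _ assms(2)])
      (use Z_cube cenv_ge[OF Z_compact y_cont] in \<open>force simp: touching_def\<close>)+
qed

text \<open>Together with \<open>g_eq_on_hull\<close> this identifies the contact region of a
  dominating affine function with the hull of its vertices, a simplex by general position.\<close>

lemma mem_hull_touching:
  assumes "\<And>z. z \<in> Z \<Longrightarrow> y z \<le> c + a \<bullet> z" "p \<in> unit_cube" "g p = c + a \<bullet> p"
  shows "p \<in> convex hull touching c a"
proof -
  have "supergradient (convex hull Z) g p a"
    by (rule supergradient_cenvI[OF Z_compact y_cont]) (use assms in \<open>simp add: inner_diff_right\<close>)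
  then have "p \<in> convex hull {z \<in> Z. y z = g p + a \<bullet> (z - p)}"
    by (rule cenv_contact_hull[OF Z_compact y_cont]) (simp add: Z assms)
  then show ?thesis using assms(3) by (simp add: touching_def inner_diff_right)
qed

text \<open>Around \<open>p\<close> the first affine function equals \<open>g\<close>, so it lies
  below the second, with equality at \<open>p\<close>; this forces equal slopes. Hence an open facet
  meets no other facet.\<close>

lemma facets_eq:
  assumes F: "(c, a) \<in> facets" "(c', a') \<in> facets"
    and p: "p \<in> interior (convex hull touching c a)" "p \<in> convex hull touching c' a'"
  shows "c = c' \<and> a = a'"
proof -
  have y: "y z \<le> c + a \<bullet> z" "y z \<le> c' + a' \<bullet> z" if "z \<in> Z" for z
    using F that by (auto simp: facets_def)
  obtain r where r: "r > 0" "ball p r \<subseteq> convex hull touching c a"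
    using p(1) mem_interior by blast
  have p': "p \<in> convex hull touching c a" using p(1) interior_subset by blast
  have eq: "c + a \<bullet> p = c' + a' \<bullet> p"
    using g_eq_on_hull[OF y(1) p'] g_eq_on_hull[OF y(2) p(2)] by simp
  have "(c + a \<bullet> p) + a \<bullet> (q - p) \<le> (c' + a' \<bullet> p) + a' \<bullet> (q - p)" if "dist p q < r" for q
  proof -
    have q: "q \<in> convex hull touching c a" using r(2) that by auto
    have "c + a \<bullet> q = g q" using g_eq_on_hull[OF y(1) q] by simp
    also have "\<dots> \<le> c' + a' \<bullet> q" using g_le_affine[OF y(2)] q hull_touching_cube by blast
    finally show ?thesis by (simp add: inner_diff_right)
  qed
  then have "a = a'" using affine_contact_imp_eq[OF r(1), of p "c + a \<bullet> p" a "c' + a' \<bullet> p" a'] eq by blast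
  then show ?thesis using eq by simp
qed

lemma finite_facets: "finite facets"
proof -
  have "inj_on (\<lambda>(c, a). touching c a) facets"
  proof (rule inj_onI, clarify)
    fix c a c' a'
    assume F: "(c, a) \<in> facets" "(c', a') \<in> facets" "touching c a = touching c' a'"
    then obtain p where "p \<in> interior (convex hull touching c a)" by (auto simp: facets_def)
    then show "c = c' \<and> a = a'" using facets_eq[OF F(1,2)] subsetD[OF interior_subset] unfolding F(3) by blast
  qed
  moreover have "(\<lambda>(c, a). touching c a) ` facets \<subseteq> Pow Z" using touching_subset by auto
  ultimately show ?thesis using Z(1) by (meson finite_Pow_iff finite_imageD finite_subset)
qed

lemma compact_skeleton: "compact skeleton"
proof -
  have "open (\<Union>(c, a)\<in>facets. interior (convex hull touching c a))" by auto
  then show ?thesis unfolding skeleton_def by (simp add: compact_diff)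
qed

text \<open>A point interior to some facet would be interior to the given one by
  \<open>facets_eq\<close>, but a simplex has no interior points spanned without one of its
  vertices.\<close>

lemma hull_remove_subset_skeleton:
  assumes F: "(c, a) \<in> facets" and v: "v \<in> touching c a"
  shows "convex hull (touching c a - {v}) \<subseteq> skeleton"
proof
  fix p assume p: "p \<in> convex hull (touching c a - {v})"
  then have p': "p \<in> convex hull touching c a" using hull_mono[of "touching c a - {v}" "touching c a"] by blast
  have "p \<notin> interior (convex hull touching c' a')" if F': "(c', a') \<in> facets" for c' a'
  proof
    assume i: "p \<in> interior (convex hull touching c' a')"
    then have "c' = c \<and> a' = a" using facets_eq[OF F' F i p'] by simp
    then show False
      using convex_hull_remove_not_interior[OF _ v p] i gp[of c a] by (simp add: touching_def)
  qed
  then show "p \<in> skeleton" using subsetD[OF hull_touching_cube p'] by (auto simp: skeleton_def)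
qed

lemma supergradient_affine:
  assumes "supergradient unit_cube g x a" "x \<in> unit_cube" "z \<in> Z"
  shows "y z \<le> (g x - a \<bullet> x) + a \<bullet> z"
  using supergradientD[OF assms(1), of z] cenv_ge[OF Z_compact y_cont assms(3)] Z_cube assms
  by (auto simp: inner_diff_right)

lemma g_supergradient:
  assumes "x \<in> open_unit_cube"
  obtains a where "supergradient unit_cube g x a"
  using concave_supergradient_exists[OF g_concave, of x] assms by (metis interior_cbox)

lemma skeleton_not_interior:
  assumes "x \<in> skeleton" "\<And>z. z \<in> Z \<Longrightarrow> y z \<le> c + a \<bullet> z"
  shows "x \<notin> interior (convex hull touching c a)"
proof
  assume x: "x \<in> interior (convex hull touching c a)"
  then have "(c, a) \<in> facets" using assms(2) by (auto simp: facets_def)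
  then show False using x assms(1) by (auto simp: skeleton_def)
qed

lemma skeleton_subset:
  "skeleton \<subseteq> frontier unit_cube \<union> (\<Union>S\<in>{S. S \<subseteq> Z \<and> S \<noteq> {} \<and> card S \<le> CARD('n)}. convex hull S)"
proof
  fix x assume x: "x \<in> skeleton"
  have xQ: "x \<in> unit_cube" using x by (simp add: skeleton_def)
  show "x \<in> frontier unit_cube \<union> (\<Union>S\<in>{S. S \<subseteq> Z \<and> S \<noteq> {} \<and> card S \<le> CARD('n)}. convex hull S)"
  proof (cases "x \<in> open_unit_cube")
    case False
    then show ?thesis using xQ by (simp add: frontier_cbox)
  next
    case True
    then obtain a where a: "supergradient unit_cube g x a" using g_supergradient by blast
    define c where "c = g x - a \<bullet> x"
    have y: "y z \<le> c + a \<bullet> z" if "z \<in> Z" for z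
      unfolding c_def using supergradient_affine[OF a xQ that] .
    let ?T = "touching c a"
    have xT: "x \<in> convex hull ?T" by (rule mem_hull_touching[OF y xQ]) (simp_all add: c_def)
    have ind: "\<not> affine_dependent ?T" using gp by (simp add: touching_def)
    have ni: "x \<notin> interior (convex hull ?T)" by (rule skeleton_not_interior[OF x y])
    show ?thesis
    proof (cases "card ?T \<le> CARD('n)")
      case True
      moreover have "?T \<noteq> {}" using xT by auto
      ultimately show ?thesis using xT touching_subset(1) by blast
    next
      case False
      have "int (card ?T) \<le> int CARD('n) + 1"
        using aff_dim_affine_independent[OF ind] aff_dim_le_DIM[of ?T] by simp
      then have card: "card ?T = CARD('n) + 1" using False by linarith
      obtain u where u: "\<forall>z\<in>?T. 0 \<le> u z" "sum u ?T = 1" "(\<Sum>z\<in>?T. u z *\<^sub>R z) = x"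
        using xT touching_subset(2) by (auto simp: convex_hull_finite)
      \<comment> \<open>A point of a full simplex that is not interior has a vanishing barycentric
        coordinate.\<close>
      then obtain v where v: "v \<in> ?T" "u v = 0"
        using ni False unfolding interior_convex_hull_explicit_minimal[OF ind] by force
      have "sum u (?T - {v}) = 1" "(\<Sum>z\<in>?T - {v}. u z *\<^sub>R z) = x"
        using u v touching_subset(2)[of c a] by (simp_all add: sum.remove[of ?T v])
      then have "x \<in> convex hull (?T - {v})"
        using u(1) touching_subset(2)[of c a] by (auto simp: convex_hull_finite)
      moreover have card': "card (?T - {v}) = CARD('n)" using card v(1) touching_subset(2)[of c a] by simp
      moreover have "?T - {v} \<noteq> {}"
        using card' zero_less_card_finite[where 'a = 'n] by (metis card.empty less_irrefl)
      moreover have "?T - {v} \<subseteq> Z" using touching_subset(1)[of c a] by blast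
      ultimately show ?thesis by (intro UnI2 UN_I[of "?T - {v}"]) simp_all
    qed
  qed
qed

lemma box_covered_skeleton: "box_covered (CARD('n) - 1) skeleton"
proof (rule box_covered_mono[OF _ skeleton_subset], rule box_covered_Un[OF box_covered_frontier_cube], rule box_covered_Union)
  show "finite {S. S \<subseteq> Z \<and> S \<noteq> {} \<and> card S \<le> CARD('n)}" using Z(1) by simp
  fix S assume S: "S \<in> {S. S \<subseteq> Z \<and> S \<noteq> {} \<and> card S \<le> CARD('n)}"
  then have "finite S" using Z(1) finite_subset by blast
  then show "box_covered (CARD('n) - 1) (convex hull S)"
    using S by (intro box_covered_mono_dim[OF box_covered_convex_hull]) auto
qed

text \<open>On the compact set at distance at least \<eta> from the vertices of a facet, its affine
  function stays strictly above \<open>f\<close>, since equality would force a vertex of that facet.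
  Finiteness of the facets gives a common \<gamma>.\<close>

lemma facet_gap:
  assumes \<eta>: "\<eta> > 0"
  obtains \<gamma> where "\<gamma> > 0"
    "\<And>c a w. (c, a) \<in> facets \<Longrightarrow> w \<in> unit_cube \<Longrightarrow> c + a \<bullet> w - f w < \<gamma> \<Longrightarrow> \<exists>v\<in>touching c a. dist w v < \<eta>"
proof -
  define good where "good \<gamma> F \<longleftrightarrow> (\<forall>w\<in>unit_cube. fst F + snd F \<bullet> w - f w < \<gamma> \<longrightarrow>
      (\<exists>v\<in>touching (fst F) (snd F). dist w v < \<eta>))" for \<gamma> F
  have "\<exists>\<gamma>>0. good \<gamma> F" if "F \<in> facets" for F
  proof -
    obtain c a where F: "F = (c, a)" by (cases F)
    have y: "y z \<le> c + a \<bullet> z" if "z \<in> Z" for z using \<open>F \<in> facets\<close> that by (auto simp: facets_def F)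
    define S where "S = unit_cube \<inter> (\<Inter>v\<in>touching c a. {w. \<eta> \<le> dist w v})"
    have "compact S"
      unfolding S_def by (intro compact_Int_closed compact_cbox closed_INT ballI closed_Collect_le continuous_intros)
    show ?thesis
    proof (cases "S = {}")
      case True
      then have "good 1 F" by (force simp: good_def F S_def)
      then show ?thesis by (intro exI[of _ 1]) simp
    next
      case False
      have "continuous_on S (\<lambda>w. c + a \<bullet> w - f w)"
        by (intro continuous_intros continuous_on_subset[OF f(1)]) (auto simp: S_def)
      then obtain w0 where w0: "w0 \<in> S" "\<forall>w\<in>S. c + a \<bullet> w0 - f w0 \<le> c + a \<bullet> w - f w"
        using continuous_attains_inf[OF \<open>compact S\<close> False] by blast
      have w0Q: "w0 \<in> unit_cube" using w0 by (simp add: S_def)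
      have "f w0 < c + a \<bullet> w0"
      proof (rule ccontr)
        assume "\<not> f w0 < c + a \<bullet> w0"
        then have "f w0 = g w0" "g w0 = c + a \<bullet> w0"
          using f_le_g[OF w0Q] g_le_affine[OF y w0Q] by auto
        then have "e * min 1 (infdist w0 Z) \<le> 0" using f_le[OF w0Q] by simp
        then have "infdist w0 Z = 0" using e infdist_nonneg[of w0 Z] by (simp add: mult_le_0_iff min_def split: if_splits)
        then have "w0 \<in> Z" using in_closed_iff_infdist_zero[OF compact_imp_closed[OF Z_compact] Z_ne] by blast
        then have "w0 \<in> touching c a" using f(2) \<open>f w0 = g w0\<close> \<open>g w0 = c + a \<bullet> w0\<close> by (simp add: touching_def)
        then show False using w0(1) \<eta> by (force simp: S_def)
      qed
      moreover have "good (c + a \<bullet> w0 - f w0) F"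
        using w0(2) by (force simp: good_def F S_def)
      ultimately show ?thesis by (intro exI[of _ "c + a \<bullet> w0 - f w0"]) simp
    qed
  qed
  then obtain \<Gamma> where \<Gamma>: "\<And>F. F \<in> facets \<Longrightarrow> \<Gamma> F > 0 \<and> good (\<Gamma> F) F" by metis
  define \<gamma> where "\<gamma> = Min (insert 1 (\<Gamma> ` facets))"
  have \<gamma>: "\<gamma> > 0" "\<And>F. F \<in> facets \<Longrightarrow> \<gamma> \<le> \<Gamma> F"
    using finite_facets \<Gamma> by (auto simp: \<gamma>_def)
  show ?thesis
  proof (rule that[OF \<gamma>(1)])
    fix c a w assume F: "(c, a) \<in> facets" and w: "w \<in> unit_cube" "c + a \<bullet> w - f w < \<gamma>"
    then have "c + a \<bullet> w - f w < \<Gamma> (c, a)" using \<gamma>(2)[OF F] by linarith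
    then show "\<exists>v\<in>touching c a. dist w v < \<eta>" using \<Gamma>[OF F] w(1) by (auto simp: good_def)
  qed
qed

text \<open>A ball that meets an open facet without lying in it contains a frontier point of the
  facet by connectedness. Off the skeleton this point would lie in another open facet overlapping
  the first.\<close>

lemma ball_subset_facet:
  assumes x: "x \<in> unit_cube" and \<eta>: "\<eta> > 0" and far: "\<And>k. k \<in> skeleton \<Longrightarrow> \<eta> \<le> dist x k"
  obtains c a where "(c, a) \<in> facets" "ball x \<eta> \<subseteq> interior (convex hull touching c a)"
proof -
  have "x \<notin> skeleton" using far[of x] \<eta> by auto
  then obtain c a where F: "(c, a) \<in> facets" and xi: "x \<in> interior (convex hull touching c a)"
    using x by (auto simp: skeleton_def)
  let ?S = "interior (convex hull touching c a)"
  have "ball x \<eta> \<subseteq> ?S"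
  proof (rule ccontr)
    assume "\<not> ball x \<eta> \<subseteq> ?S"
    moreover have "ball x \<eta> \<inter> ?S \<noteq> {}" using xi \<eta> by (auto intro: centre_in_ball[THEN iffD2])
    ultimately obtain q where q: "q \<in> ball x \<eta>" "q \<in> frontier ?S"
      using connected_Int_frontier[OF connected_ball, of x \<eta> ?S] by blast
    have qc: "q \<in> closure ?S" "q \<notin> ?S" using q(2) by (auto simp: frontier_def)
    have "closed (convex hull touching c a)"
      using finite_imp_compact_convex_hull[OF touching_subset(2)] compact_imp_closed by blast
    then have "closure ?S \<subseteq> convex hull touching c a" by (intro closure_minimal interior_subset)
    then have "q \<in> unit_cube" using qc(1) hull_touching_cube by blast
    moreover have "q \<notin> skeleton" using far[of q] q(1) by auto
    ultimately obtain c' a' where F': "(c', a') \<in> facets" "q \<in> interior (convex hull touching c' a')"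
      by (auto simp: skeleton_def)
    then have "interior (convex hull touching c' a') \<inter> ?S \<noteq> {}"
      using qc(1) open_interior closure_iff_nhds_not_empty by (metis inf_commute open_Int_closure_eq_empty disjoint_iff)
    then obtain r where r: "r \<in> interior (convex hull touching c' a')" "r \<in> ?S" by blast
    then have "c' = c \<and> a' = a" using facets_eq[OF F'(1) F r(1)] interior_subset by blast
    then show False using F'(2) qc(2) by simp
  qed
  then show ?thesis using that F by blast
qed

text \<open>Away from the skeleton the envelope of a nearby function has a supergradient close to
  the facet, so its contact points cluster at the vertices of the facet. By general position every
  vertex is used: otherwise the point would be close to a hull of fewer vertices, which lies in the
  skeleton.\<close>

lemma locally_affine_off_skeleton:
  assumes \<eta>: "\<eta> > 0"
  obtains \<delta> where "\<delta> > 0"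
    "\<And>h x. continuous_on unit_cube h \<Longrightarrow> \<forall>x\<in>unit_cube. \<bar>f x - h x\<bar> \<le> \<delta> \<Longrightarrow> x \<in> unit_cube \<Longrightarrow>
       (\<And>k. k \<in> skeleton \<Longrightarrow> \<eta> \<le> dist x k) \<Longrightarrow> locally_affine (cenv unit_cube h) x"
proof -
  obtain \<gamma> where \<gamma>: "\<gamma> > 0" "\<And>c a w. (c, a) \<in> facets \<Longrightarrow> w \<in> unit_cube \<Longrightarrow> c + a \<bullet> w - f w < \<gamma> \<Longrightarrow>
      \<exists>v\<in>touching c a. dist w v < \<eta> / 2"
    using facet_gap[of "\<eta> / 2"] \<eta> by (metis half_gt_zero)
  obtain B where B: "B > 0" "\<And>p q. p \<in> unit_cube \<Longrightarrow> q \<in> unit_cube \<Longrightarrow> norm (p - q :: real^'n) \<le> B"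
  proof -
    obtain b where b: "\<And>x. x \<in> unit_cube \<Longrightarrow> norm (x::real^'n) \<le> b"
      using bounded_cbox[of "0::real^'n" 1] unfolding bounded_iff by metis
    have "norm (p - q :: real^'n) \<le> 2 * \<bar>b\<bar> + 1" if "p \<in> unit_cube" "q \<in> unit_cube" for p q
      using b[OF that(1)] b[OF that(2)] norm_triangle_ineq4[of p q] by linarith
    then show ?thesis using that[of "2 * \<bar>b\<bar> + 1"] by simp
  qed
  \<comment> \<open>\<open>\<delta> * M\<close> is the total error below: \<delta> twice for values,
    and the slope error \<open>4 * \<delta> / \<eta>\<close> over a distance of at most
    \<open>B\<close>.\<close>
  define M where "M = 2 + 4 * B / \<eta>"
  have M: "M > 0" using B(1) \<eta> by (simp add: M_def add_pos_pos)
  define \<delta> where "\<delta> = \<gamma> / (2 * M)"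
  have \<delta>: "\<delta> > 0" "\<delta> * M < \<gamma>" using \<gamma>(1) M by (simp_all add: \<delta>_def)
  show ?thesis
  proof (rule that[OF \<delta>(1)])
    fix h x
    assume h: "continuous_on unit_cube h" and fh: "\<forall>x\<in>unit_cube. \<bar>f x - h x\<bar> \<le> \<delta>"
      and x: "x \<in> unit_cube" and far: "\<And>k. k \<in> skeleton \<Longrightarrow> \<eta> \<le> dist x k"
    let ?\<phi> = "cenv unit_cube h"
    have \<phi>conc: "concave_on unit_cube ?\<phi>" using concave_cenv[OF compact_cbox h] by simp
    have \<phi>g: "\<bar>?\<phi> z - g z\<bar> \<le> \<delta>" if "z \<in> unit_cube" for z using cenv_near_g[OF h fh that] .
    obtain c a where F: "(c, a) \<in> facets" and ball: "ball x \<eta> \<subseteq> interior (convex hull touching c a)"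
      using ball_subset_facet[OF x \<eta> far] by blast
    let ?T = "touching c a"
    have y: "y z \<le> c + a \<bullet> z" if "z \<in> Z" for z using F that by (auto simp: facets_def)
    have ballT: "ball x \<eta> \<subseteq> convex hull ?T" using ball interior_subset by blast
    then have ballQ: "ball x \<eta> \<subseteq> unit_cube" using hull_touching_cube by blast
    have g_ball: "g z = c + a \<bullet> z" if "z \<in> ball x \<eta>" for z using g_eq_on_hull[OF y] ballT that by blast
    have "x \<in> interior unit_cube" using ballQ \<eta> mem_interior by blast
    then obtain b where b: "supergradient unit_cube ?\<phi> x b"
      using concave_supergradient_exists[OF \<phi>conc] by blast
    \<comment> \<open>Both affine functions are compared at a step of length
      \<open>\<eta> / 2\<close> along \<open>a - b\<close>, which stays in the ball where
      \<open>g\<close> is affine.\<close>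
    have ab: "norm (a - b) \<le> 4 * \<delta> / \<eta>"
    proof -
      let ?p = "x + (\<eta> / 2) *\<^sub>R sgn (a - b)"
      have "norm ((\<eta> / 2) *\<^sub>R sgn (a - b)) \<le> \<eta> / 2" using \<eta> by (simp add: norm_sgn)
      then have p: "?p \<in> ball x \<eta>" using \<eta> by (simp add: dist_norm)
      then have pQ: "?p \<in> unit_cube" using ballQ by blast
      have "g ?p \<le> ?\<phi> ?p + \<delta>" "?\<phi> x \<le> g x + \<delta>" using \<phi>g[OF pQ] \<phi>g[OF x] by linarith+
      moreover have "?\<phi> ?p \<le> ?\<phi> x + b \<bullet> (?p - x)" by (rule supergradientD[OF b pQ])
      moreover have "g ?p = g x + a \<bullet> (?p - x)"
        using g_ball[OF p] g_ball[of x] \<eta> by (simp add: inner_add_right)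
      ultimately have "a \<bullet> (?p - x) - b \<bullet> (?p - x) \<le> 2 * \<delta>" by linarith
      then have "(a - b) \<bullet> (?p - x) \<le> 2 * \<delta>" by (simp only: inner_diff_left)
      then have "(\<eta> / 2) * norm (a - b) \<le> 2 * \<delta>" by (simp add: inner_sgn_self)
      then show ?thesis using \<eta> by (simp add: field_simps)
    qed
    define W where "W = {w \<in> unit_cube. h w = ?\<phi> x + b \<bullet> (w - x)}"
    have xW: "x \<in> convex hull W"
      unfolding W_def using cenv_contact_hull[OF compact_cbox h, of x b] b x by simp
    have W_near: "\<exists>v\<in>?T. dist w v < \<eta> / 2" if w: "w \<in> W" for w
    proof (rule \<gamma>(2)[OF F])
      show wQ: "w \<in> unit_cube" using w by (simp add: W_def)
      have "\<bar>(a - b) \<bullet> (w - x)\<bar> \<le> norm (a - b) * norm (w - x)" by (rule Cauchy_Schwarz_ineq2)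
      also have "\<dots> \<le> (4 * \<delta> / \<eta>) * B" using ab B wQ x \<delta> \<eta> by (intro mult_mono) auto
      finally have 1: "(a - b) \<bullet> (w - x) \<le> (4 * \<delta> / \<eta>) * B" by linarith
      have "c + a \<bullet> w = g x + a \<bullet> (w - x)" using g_ball[of x] \<eta> by (simp add: inner_diff_right)
      moreover have "h w = ?\<phi> x + b \<bullet> (w - x)" using w by (simp add: W_def)
      moreover have "\<bar>f w - h w\<bar> \<le> \<delta>" "\<bar>?\<phi> x - g x\<bar> \<le> \<delta>" using fh wQ \<phi>g[OF x] by auto
      ultimately have "c + a \<bullet> w - f w \<le> 2 * \<delta> + (4 * \<delta> / \<eta>) * B"
        using 1 by (simp add: inner_diff_left)
      also have "\<dots> = \<delta> * M" by (simp add: M_def algebra_simps)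
      finally show "c + a \<bullet> w - f w < \<gamma>" using \<delta>(2) by linarith
    qed
    have T_near: "\<exists>w\<in>W. dist w v < \<eta> / 2" if v: "v \<in> ?T" for v
    proof (rule ccontr)
      assume "\<not> ?thesis"
      then have "\<exists>v'\<in>?T - {v}. dist w v' < \<eta> / 2" if "w \<in> W" for w using W_near[OF that] that by blast
      from convex_hull_near[OF this xW] obtain q where q: "q \<in> convex hull (?T - {v})" "dist x q < \<eta> / 2" by blast
      have "q \<in> skeleton" using q(1) hull_remove_subset_skeleton[OF F v] by blast
      then show False using far[of q] q(2) \<eta> by simp
    qed
    have "W = unit_cube \<inter> (\<lambda>w. h w - (?\<phi> x + b \<bullet> (w - x))) -` {0}" by (auto simp: W_def)
    moreover have "closed (unit_cube \<inter> (\<lambda>w. h w - (?\<phi> x + b \<bullet> (w - x))) -` {0})"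
      by (rule continuous_closed_preimage) (auto intro!: continuous_intros h)
    ultimately have "closed W" by simp
    moreover have "bounded W" by (rule bounded_subset[OF bounded_cbox[of 0 1]]) (auto simp: W_def)
    ultimately have "compact W" by (simp add: compact_eq_bounded_closed)
    then have ballW: "ball x (\<eta> / 2) \<subseteq> convex hull W"
      using ball_subset_perturbed_hull[OF \<eta> ballT _ T_near] by blast
    \<comment> \<open>From above by the supergradient; from below because the envelope dominates
      \<open>h\<close> on \<open>W\<close>, where \<open>h\<close> equals the affine function, and
      the hull of \<open>W\<close> contains the ball.\<close>
    have "?\<phi> z = (?\<phi> x - b \<bullet> x) + b \<bullet> z" if z: "z \<in> ball x (\<eta> / 2)" for z
    proof (rule antisym)
      have "z \<in> unit_cube" using z ballQ \<eta> by auto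
      then show "?\<phi> z \<le> (?\<phi> x - b \<bullet> x) + b \<bullet> z" using supergradientD[OF b] by (force simp: inner_diff_right)
      show "(?\<phi> x - b \<bullet> x) + b \<bullet> z \<le> ?\<phi> z"
      proof (rule concave_ge_affine_hull[OF \<phi>conc])
        show "W \<subseteq> unit_cube" by (auto simp: W_def)
        show "(?\<phi> x - b \<bullet> x) + b \<bullet> w \<le> ?\<phi> w" if "w \<in> W" for w
          using that cenv_ge[OF compact_cbox h, of w] by (simp add: W_def inner_diff_right)
        show "z \<in> convex hull W" using z ballW by blast
      qed
    qed
    note eq = this
    have "ball x (\<eta> / 2) \<subseteq> ball x \<eta>" using \<eta> by (intro subset_ball) simp
    then have sub: "ball x (\<eta> / 2) \<subseteq> unit_cube" using ballQ by (rule subset_trans)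
    show "locally_affine ?\<phi> x"
      unfolding locally_affine_def
    proof (intro exI conjI ballI)
      show "\<eta> / 2 > 0" using \<eta> by simp
    qed (rule sub, erule eq)
  qed
qed

text \<open>As \<open>k\<close> is not interior to the contact simplex, some direction
  \<open>u\<close> has \<open>u \<bullet> (z - k) \<ge> 0\<close> on it. Tilting by a small multiple
  of \<open>u\<close> keeps a majorant: touching vertices are on the safe side, and the other
  finitely many have slack.\<close>

lemma skeleton_two_supergradients:
  assumes k: "k \<in> skeleton" "k \<in> open_unit_cube"
  obtains a b where "a \<noteq> b" "supergradient unit_cube g k a" "supergradient unit_cube g k b"
proof -
  have kQ: "k \<in> unit_cube" using k(1) by (simp add: skeleton_def)
  obtain a where a: "supergradient unit_cube g k a" using g_supergradient[OF k(2)] by blast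
  define c where "c = g k - a \<bullet> k"
  have y: "y z \<le> c + a \<bullet> z" if "z \<in> Z" for z
    unfolding c_def using supergradient_affine[OF a kQ that] .
  have kT: "k \<in> convex hull touching c a" by (rule mem_hull_touching[OF y kQ]) (simp_all add: c_def)
  have "k \<notin> interior (convex hull touching c a)" by (rule skeleton_not_interior[OF k(1) y])
  then obtain u where u: "u \<noteq> 0" "\<And>z. z \<in> convex hull touching c a \<Longrightarrow> u \<bullet> (z - k) \<ge> 0"
    using convex_not_interior_support[OF convex_convex_hull kT] by metis
  have "\<forall>\<^sub>F s in at_right (0::real). y z \<le> c + a \<bullet> z + s * (u \<bullet> (z - k))" if z: "z \<in> Z" for z
  proof (cases "z \<in> touching c a")
    case True
    then have "u \<bullet> (z - k) \<ge> 0" using u(2) hull_inc by metis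
    then show ?thesis
      using eventually_at_right_less[of "0::real"] y[OF z] by (auto elim!: eventually_mono intro: add_increasing2)
  next
    case False
    then have "y z < c + a \<bullet> z" using y[OF z] z by (force simp: touching_def)
    moreover have "((\<lambda>s. c + a \<bullet> z + s * (u \<bullet> (z - k))) \<longlongrightarrow> c + a \<bullet> z + 0 * (u \<bullet> (z - k))) (at_right 0)"
      by (intro tendsto_intros)
    ultimately have "\<forall>\<^sub>F s in at_right (0::real). y z < c + a \<bullet> z + s * (u \<bullet> (z - k))"
      by (intro order_tendstoD(1)) auto
    then show ?thesis by (rule eventually_mono) simp
  qed
  then have "\<forall>\<^sub>F s in at_right (0::real). \<forall>z\<in>Z. y z \<le> c + a \<bullet> z + s * (u \<bullet> (z - k))"
    using Z(1) by (intro eventually_ball_finite) auto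
  then have "\<forall>\<^sub>F s in at_right (0::real). (\<forall>z\<in>Z. y z \<le> c + a \<bullet> z + s * (u \<bullet> (z - k))) \<and> 0 < s"
    by (intro eventually_conj eventually_at_right_less)
  from eventually_happens'[OF trivial_limit_at_right_real this]
  obtain s where s: "\<forall>z\<in>Z. y z \<le> c + a \<bullet> z + s * (u \<bullet> (z - k))" "s > 0" by blast
  have "supergradient (convex hull Z) g k (a + s *\<^sub>R u)"
  proof (rule supergradient_cenvI[OF Z_compact y_cont])
    fix z assume "z \<in> Z"
    then have "y z \<le> c + a \<bullet> z + s * (u \<bullet> (z - k))" using s(1) by blast
    also have "\<dots> = g k + (a + s *\<^sub>R u) \<bullet> (z - k)"
      by (simp add: c_def inner_add_left inner_diff_right right_diff_distrib)
    finally show "y z \<le> g k + (a + s *\<^sub>R u) \<bullet> (z - k)" .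
  qed
  then show ?thesis using that[of a "a + s *\<^sub>R u"] a u(1) s(2) Z(2) by simp
qed

text \<open>Two supergradients at \<open>k\<close> give a strict drop of the second difference along
  \<open>a - b\<close>. Continuity of \<open>g\<close> carries it to points near \<open>k\<close>,
  closeness of envelopes to functions near \<open>f\<close>.\<close>

lemma sharp_bend_near_skeleton_point:
  assumes k: "k \<in> skeleton" "k \<in> open_unit_cube"
  shows "\<exists>\<rho>>0. \<forall>x h. dist x k < \<rho> \<longrightarrow> continuous_on unit_cube h \<longrightarrow> (\<forall>x\<in>unit_cube. \<bar>f x - h x\<bar> \<le> \<rho>) \<longrightarrow>
     sharp_bend n (cenv unit_cube h) x"
proof -
  obtain a b where ab: "a \<noteq> b" "supergradient unit_cube g k a" "supergradient unit_cube g k b"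
    using skeleton_two_supergradients[OF k] by blast
  define A where "A = norm (a - b)"
  have A: "A > 0" using ab(1) by (simp add: A_def)
  obtain R where R: "R > 0" "ball k R \<subseteq> open_unit_cube"
    using k(2) open_box open_contains_ball by metis
  \<comment> \<open>The last entry makes \<open>Suc n * r powr (1 / Suc n) \<le> A / 2\<close>, so
    the required bend costs only half of the available \<open>r * A\<close>.\<close>
  define r where "r = min (min (R / 2) (1 / (2 * real (Suc n)))) ((A / (2 * real (Suc n))) powr real (Suc n))"
  have r: "r > 0" "r < R" "r < 1 / Suc n" "r \<le> (A / (2 * real (Suc n))) powr real (Suc n)"
    using R(1) A unfolding r_def by (auto simp: min_less_iff_disj field_simps)
  have "r powr (1 / Suc n) \<le> ((A / (2 * real (Suc n))) powr real (Suc n)) powr (1 / Suc n)"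
    using r by (intro powr_mono2) auto
  also have "\<dots> = A / (2 * real (Suc n))" using A by (simp add: powr_powr del: of_nat_Suc)
  finally have "real (Suc n) * r powr (1 / Suc n) \<le> A / 2" by (simp add: field_simps del: of_nat_Suc)
  then have "r * (real (Suc n) * r powr (1 / Suc n)) \<le> r * (A / 2)" using r(1) by (intro mult_left_mono) auto
  moreover have "real (Suc n) * r powr (1 + 1 / Suc n) = r * (real (Suc n) * r powr (1 / Suc n))"
    using r(1) by (simp add: powr_add del: of_nat_Suc)
  ultimately have rA: "real (Suc n) * r powr (1 + 1 / Suc n) \<le> r * A / 2" by (metis times_divide_eq_right)
  define u where "u = r *\<^sub>R sgn (a - b)"
  have nu: "norm u = r" using ab(1) r(1) by (simp add: u_def norm_sgn)
  have ku: "k + u \<in> open_unit_cube" "k - u \<in> open_unit_cube"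
    using R(2) nu r(2) by (auto intro!: subsetD[OF R(2)] simp: dist_norm)
  define \<Delta> where "\<Delta> x = g (x + u) + g (x - u) - 2 * g x" for x
  have "g (k + u) \<le> g k + b \<bullet> (k + u - k)" "g (k - u) \<le> g k + a \<bullet> (k - u - k)"
    using supergradientD[OF ab(3)] supergradientD[OF ab(2)] ku box_subset_cbox by blast+
  then have "\<Delta> k \<le> b \<bullet> u - a \<bullet> u" by (simp add: \<Delta>_def)
  also have "\<dots> = - (r * ((a - b) \<bullet> sgn (a - b)))" by (simp add: u_def inner_diff_left algebra_simps)
  finally have "\<Delta> k \<le> - (r * A)" by (simp add: inner_sgn_self A_def)
  moreover have "r * A > 0" using r(1) A by simp
  \<comment> \<open>The other half of \<open>r * A\<close> is spent as one quarter for moving from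
    \<open>k\<close> to \<open>x\<close> and \<open>4 * (r * A / 16)\<close> for replacing
    \<open>g\<close> by the envelope of \<open>h\<close>.\<close>
  ultimately have \<Delta>k: "\<Delta> k < - (r * A) + r * A / 4" by linarith
  define V where "V = {x. x \<in> open_unit_cube \<and> x + u \<in> open_unit_cube \<and> x - u \<in> open_unit_cube}"
  have "V = open_unit_cube \<inter> ((\<lambda>x. x + u) -` open_unit_cube \<inter> (\<lambda>x. x - u) -` open_unit_cube)"
    by (auto simp: V_def)
  then have V: "open V" "k \<in> V"
    using k(2) ku by (auto simp: V_def intro!: open_Int open_vimage continuous_intros)
  have "continuous_on V \<Delta>"
    unfolding \<Delta>_def
    by (intro continuous_intros continuous_on_compose2[OF g_continuous])
      (use box_subset_cbox in \<open>auto simp: V_def\<close>)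
  then have "\<forall>\<^sub>F x in at k. \<Delta> x < - (r * A) + r * A / 4"
    using V \<Delta>k by (auto simp: continuous_on_eq_continuous_at continuous_at intro: order_tendstoD(2))
  then have "\<forall>\<^sub>F x in nhds k. \<Delta> x < - (r * A) + r * A / 4"
    using \<Delta>k by (simp add: eventually_nhds_conv_at)
  moreover have "\<forall>\<^sub>F x in nhds k. x \<in> V" using V by (rule eventually_nhds_in_open)
  ultimately have "\<forall>\<^sub>F x in nhds k. \<Delta> x < - (r * A) + r * A / 4 \<and> x \<in> V" by (rule eventually_conj)
  then obtain d where d: "d > 0" "\<And>x. dist x k < d \<Longrightarrow> \<Delta> x < - (r * A) + r * A / 4 \<and> x \<in> V"
    unfolding eventually_nhds_metric by blast
  show ?thesis
  proof (intro exI[of _ "min d (r * A / 16)"] conjI allI impI)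
    show "min d (r * A / 16) > 0" using d r(1) A by simp
    fix x h
    assume x: "dist x k < min d (r * A / 16)" and h: "continuous_on unit_cube h"
      and fh: "\<forall>x\<in>unit_cube. \<bar>f x - h x\<bar> \<le> min d (r * A / 16)"
    let ?\<phi> = "cenv unit_cube h"
    have xV: "\<Delta> x < - (r * A) + r * A / 4" "x \<in> unit_cube" "x + u \<in> unit_cube" "x - u \<in> unit_cube"
      using d(2)[of x] x box_subset_cbox by (auto simp: V_def)
    have "\<bar>?\<phi> z - g z\<bar> \<le> r * A / 16" if "z \<in> unit_cube" for z
      using cenv_near_g[OF h fh that] by linarith
    from this[OF xV(2)] this[OF xV(3)] this[OF xV(4)]
    have "?\<phi> (x + u) + ?\<phi> (x - u) - 2 * ?\<phi> x \<le> \<Delta> x + 4 * (r * A / 16)"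
      unfolding \<Delta>_def by linarith
    then have "?\<phi> (x + u) + ?\<phi> (x - u) - 2 * ?\<phi> x \<le> - (real (Suc n) * norm u powr (1 + 1 / Suc n))"
      using xV(1) rA unfolding nu by linarith
    then show "sharp_bend n ?\<phi> x"
      unfolding sharp_bend_def using xV nu r by (intro exI[of _ u]) auto
  qed
qed

text \<open>The radius of the pointwise result depends on the skeleton point; compactness of the
  part of the skeleton away from the frontier makes it uniform.\<close>

lemma sharp_bend_near_skeleton:
  obtains \<rho> where "\<rho> > 0"
    "\<And>x k h. k \<in> skeleton \<Longrightarrow> dist x k < \<rho> \<Longrightarrow> ball x (1 / Suc n) \<subseteq> unit_cube \<Longrightarrow>
       continuous_on unit_cube h \<Longrightarrow> \<forall>x\<in>unit_cube. \<bar>f x - h x\<bar> \<le> \<rho> \<Longrightarrow> sharp_bend n (cenv unit_cube h) x"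
proof -
  \<comment> \<open>Half of the depth of \<open>x\<close>: a skeleton point closer than
    \<open>s\<close> to \<open>x\<close> keeps an \<open>s\<close>-ball inside the cube.\<close>
  define s where "s = 1 / (2 * real (Suc n))"
  have s: "s > 0" "2 * s = 1 / Suc n" by (simp_all add: s_def del: of_nat_Suc)
  define K where "K = skeleton \<inter> (\<Inter>v\<in>ball 0 s. {x. x + v \<in> unit_cube})"
  have "closed ((\<lambda>x. x + v) -` unit_cube)" for v :: "real^'n"
    by (intro closed_vimage closed_cbox continuous_intros)
  then have K: "compact K"
    unfolding K_def by (intro compact_Int_closed compact_skeleton closed_INT) (simp add: vimage_def)
  have Kball: "ball k s \<subseteq> unit_cube" if "k \<in> K" for k
  proof
    fix z assume "z \<in> ball k s"
    then have "z - k \<in> ball 0 s" by (simp add: dist_norm norm_minus_commute)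
    then have "k + (z - k) \<in> unit_cube" using that unfolding K_def by blast
    then show "z \<in> unit_cube" by simp
  qed
  have "\<exists>\<rho>>0. \<forall>x h. dist x k < \<rho> \<longrightarrow> continuous_on unit_cube h \<longrightarrow> (\<forall>x\<in>unit_cube. \<bar>f x - h x\<bar> \<le> \<rho>) \<longrightarrow>
     sharp_bend n (cenv unit_cube h) x" if k: "k \<in> K" for k
  proof (rule sharp_bend_near_skeleton_point)
    show "k \<in> skeleton" using k by (simp add: K_def)
    have "k \<in> interior unit_cube" using Kball[OF k] s(1) mem_interior by blast
    then show "k \<in> open_unit_cube" by (simp add: interior_cbox)
  qed
  then obtain \<rho> where \<rho>: "\<And>k. k \<in> K \<Longrightarrow> \<rho> k > 0"
    "\<And>k x h. k \<in> K \<Longrightarrow> dist x k < \<rho> k \<Longrightarrow> continuous_on unit_cube h \<Longrightarrow>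
       \<forall>x\<in>unit_cube. \<bar>f x - h x\<bar> \<le> \<rho> k \<Longrightarrow> sharp_bend n (cenv unit_cube h) x"
    by metis
  have "K \<subseteq> (\<Union>k\<in>K. ball k (\<rho> k / 2))"
  proof
    fix k assume "k \<in> K"
    then show "k \<in> (\<Union>k\<in>K. ball k (\<rho> k / 2))" using \<rho>(1) by (intro UN_I[of k]) auto
  qed
  then obtain D where D: "D \<subseteq> K" "finite D" "K \<subseteq> (\<Union>k\<in>D. ball k (\<rho> k / 2))"
    using compactE_image[OF K, of K "\<lambda>k. ball k (\<rho> k / 2)"] by auto
  \<comment> \<open>The cover uses half radii, so the other half is available for the distance from
    \<open>x\<close> to the skeleton point.\<close>
  define r where "r = Min (insert s ((\<lambda>k. \<rho> k / 2) ` D))"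
  have r: "r > 0" "r \<le> s" using D(1,2) s(1) \<rho>(1) by (auto simp: r_def)
  have r3: "r \<le> \<rho> k / 2" if "k \<in> D" for k
    unfolding r_def by (rule Min_le) (use D(2) that in auto)
  show ?thesis
  proof (rule that[OF r(1)])
    fix x k h
    assume k: "k \<in> skeleton" "dist x k < r" and x: "ball x (1 / Suc n) \<subseteq> unit_cube"
      and h: "continuous_on unit_cube h" "\<forall>x\<in>unit_cube. \<bar>f x - h x\<bar> \<le> r"
    have "k + v \<in> unit_cube" if "v \<in> ball 0 s" for v
    proof -
      have "dist x (k + v) \<le> dist x k + norm v" using dist_triangle[of x "k + v" k] by (simp add: dist_norm)
      also have "\<dots> < 1 / Suc n" using that k(2) r(2) s(2) by simp
      finally show ?thesis using x by auto
    qed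
    then have "k \<in> K" using k(1) by (simp add: K_def)
    then obtain k' where k': "k' \<in> D" "dist k' k < \<rho> k' / 2" using D(3) by auto
    have "dist x k' < \<rho> k'"
      using dist_triangle[of x k' k] k(2) k'(2) r3[OF k'(1)] by (simp add: dist_commute)
    moreover have "\<forall>x\<in>unit_cube. \<bar>f x - h x\<bar> \<le> \<rho> k'"
    proof
      fix z assume "z \<in> (unit_cube :: (real^'n) set)"
      then have "\<bar>f z - h z\<bar> \<le> r" using h(2) by blast
      moreover have "\<rho> k' > 0" using k'(1) D(1) \<rho>(1) by blast
      ultimately show "\<bar>f z - h z\<bar> \<le> \<rho> k'" using r3[OF k'(1)] by linarith
    qed
    ultimately show "sharp_bend n (cenv unit_cube h) x" using \<rho>(2) h(1) k'(1) D(1) by blast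
  qed
qed

text \<open>At a contact point of \<open>h\<close> the gap between \<open>g\<close> and
  \<open>f\<close> is at most \<open>2 * \<delta>\<close>, while it is at least
  \<open>e * min 1 (infdist x Z)\<close>.\<close>

lemma contact_near_vertices:
  assumes h: "continuous_on unit_cube h" "\<forall>x\<in>unit_cube. \<bar>f x - h x\<bar> \<le> \<delta>"
    and \<delta>: "2 * \<delta> < e * min 1 \<eta>" and x: "x \<in> unit_cube" "cenv unit_cube h x = h x"
  shows "\<exists>z\<in>Z. dist x z < \<eta>"
proof -
  have "\<bar>cenv unit_cube h x - g x\<bar> \<le> \<delta>" "\<bar>f x - h x\<bar> \<le> \<delta>" using cenv_near_g[OF h x(1)] h(2) x(1) by auto
  then have "e * min 1 (infdist x Z) \<le> 2 * \<delta>" using f_le[OF x(1)] x(2) by linarith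
  then have "min 1 (infdist x Z) < min 1 \<eta>" using \<delta> e by (metis le_less_trans mult_less_cancel_left_pos)
  then have "infdist x Z < \<eta>" by linarith
  then show ?thesis using infdist_attains_inf[OF compact_imp_closed[OF Z_compact] Z_ne, of x] by metis
qed

text \<open>Order of choices: \<eta> lies below the radii for the bends and for both covers;
  \<delta> is then small enough for local affinity at distance \<eta> from the skeleton and for
  localised contacts.\<close>

lemma almost_polyhedral_near:
  obtains \<delta> where "\<delta> > 0" "\<And>h. continuous_on unit_cube h \<Longrightarrow> \<forall>x\<in>unit_cube. \<bar>f x - h x\<bar> \<le> \<delta> \<Longrightarrow> almost_polyhedral n h"
proof -
  obtain \<rho> where \<rho>: "\<rho> > 0"
    "\<And>x k h. k \<in> skeleton \<Longrightarrow> dist x k < \<rho> \<Longrightarrow> ball x (1 / Suc n) \<subseteq> unit_cube \<Longrightarrow>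
       continuous_on unit_cube h \<Longrightarrow> \<forall>x\<in>unit_cube. \<bar>f x - h x\<bar> \<le> \<rho> \<Longrightarrow> sharp_bend n (cenv unit_cube h) x"
    using sharp_bend_near_skeleton[of n] by metis
  obtain \<eta>1 where \<eta>1: "\<eta>1 > 0" "coverable (CARD('n) - 1) n {x. \<exists>k\<in>skeleton. dist x k < \<eta>1}"
    using box_covered_neighbourhood[OF box_covered_skeleton] by blast
  obtain \<eta>2 where \<eta>2: "\<eta>2 > 0" "coverable 0 n {x. \<exists>z\<in>Z. dist x z < \<eta>2}"
    using box_covered_neighbourhood[OF box_covered_finite[OF Z(1)]] by blast
  define \<eta> where "\<eta> = min \<rho> (min \<eta>1 \<eta>2)"
  have \<eta>: "\<eta> > 0" "\<eta> \<le> \<rho>" "\<eta> \<le> \<eta>1" "\<eta> \<le> \<eta>2" using \<rho> \<eta>1 \<eta>2 by (auto simp: \<eta>_def)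
  obtain \<delta>1 where \<delta>1: "\<delta>1 > 0"
    "\<And>h x. continuous_on unit_cube h \<Longrightarrow> \<forall>x\<in>unit_cube. \<bar>f x - h x\<bar> \<le> \<delta>1 \<Longrightarrow> x \<in> unit_cube \<Longrightarrow>
       (\<And>k. k \<in> skeleton \<Longrightarrow> \<eta> \<le> dist x k) \<Longrightarrow> locally_affine (cenv unit_cube h) x"
    using locally_affine_off_skeleton[OF \<eta>(1)] by metis
  define \<delta> where "\<delta> = min (min \<delta>1 \<rho>) (e * min 1 \<eta> / 4)"
  have em: "e * min 1 \<eta> > 0" using e \<eta>(1) by simp
  have "\<delta> \<le> e * min 1 \<eta> / 4" by (simp add: \<delta>_def)
  then have \<delta>: "\<delta> > 0" "\<delta> \<le> \<delta>1" "\<delta> \<le> \<rho>" "2 * \<delta> < e * min 1 \<eta>"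
    using \<delta>1(1) \<rho>(1) em by (auto simp: \<delta>_def)
  show ?thesis
  proof (rule that[OF \<delta>(1)])
    fix h assume h: "continuous_on unit_cube h" and fh: "\<forall>x\<in>unit_cube. \<bar>f x - h x\<bar> \<le> \<delta>"
    have fh': "\<forall>x\<in>unit_cube. \<bar>f x - h x\<bar> \<le> \<delta>1" "\<forall>x\<in>unit_cube. \<bar>f x - h x\<bar> \<le> \<rho>"
      using fh \<delta>(2,3) by force+
    show "almost_polyhedral n h"
      unfolding almost_polyhedral_def
    proof (intro conjI exI[of _ "{x. \<exists>k\<in>skeleton. dist x k < \<eta>}"] ballI)
      have "\<exists>z\<in>Z. dist x z < \<eta>2" if "x \<in> unit_cube" "cenv unit_cube h x = h x" for x
        using contact_near_vertices[OF h fh \<delta>(4) that] \<eta>(4) by force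
      then show "coverable 0 n {x \<in> unit_cube. cenv unit_cube h x = h x}"
        using \<eta>2(2) by (elim coverable_mono) blast
      show "coverable (CARD('n) - 1) n {x. \<exists>k\<in>skeleton. dist x k < \<eta>}"
        using \<eta>1(2) by (rule coverable_mono) (use \<eta>(3) in force)
      fix x :: "real^'n" assume x: "x \<in> unit_cube"
      show "locally_affine (cenv unit_cube h) x \<or> x \<in> {x. \<exists>k\<in>skeleton. dist x k < \<eta>} \<and>
          (ball x (1 / real (Suc n)) \<subseteq> unit_cube \<longrightarrow> sharp_bend n (cenv unit_cube h) x)"
      proof (cases "\<exists>k\<in>skeleton. dist x k < \<eta>")
        case True
        then obtain k where k: "k \<in> skeleton" "dist x k < \<eta>" by blast
        then have "dist x k < \<rho>" using \<eta>(2) by linarith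
        then show ?thesis using \<rho>(2)[OF k(1) _ _ h fh'(2)] k by blast
      next
        case False
        then have "locally_affine (cenv unit_cube h) x"
          by (intro \<delta>1(2)[OF h fh'(1) x]) (auto simp: not_less)
        then show ?thesis ..
      qed
    qed
  qed
qed

end

lemma robustly_dense_almost_polyhedral:
  "robustly_dense (almost_polyhedral n :: (real^'n::finite \<Rightarrow> real) \<Rightarrow> bool)"
  unfolding robustly_dense_def
proof (intro allI impI)
  fix f :: "real^'n \<Rightarrow> real" and \<epsilon> :: real
  assume f: "continuous_on unit_cube f" and \<epsilon>: "\<epsilon> > 0"
  obtain \<rho> where \<rho>: "\<rho> > 0" "\<And>x y. x \<in> unit_cube \<Longrightarrow> y \<in> unit_cube \<Longrightarrow> dist x y < \<rho> \<Longrightarrow> \<bar>f x - f y\<bar> < \<epsilon> / 8"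
    using uniform_modulus[OF f, of "\<epsilon> / 8"] \<epsilon> by auto
  obtain Z :: "(real^'n) set" where Z: "finite Z" "Z \<subseteq> unit_cube"
    "\<And>x. x \<in> unit_cube \<Longrightarrow> x \<in> convex hull (Z \<inter> ball x \<rho>)"
    using fine_finite_subset_cube[OF \<rho>(1)] by metis
  have hull: "convex hull Z = unit_cube"
  proof
    show "convex hull Z \<subseteq> unit_cube" using Z(2) by (intro hull_minimal convex_box)
    show "unit_cube \<subseteq> convex hull Z" using Z(3) hull_mono[of "Z \<inter> ball _ \<rho>" Z convex] by blast
  qed
  obtain y where y: "\<And>z. z \<in> Z \<Longrightarrow> \<bar>y z - f z\<bar> \<le> \<epsilon> / 8" "\<And>c a. \<not> affine_dependent {z \<in> Z. y z = c + a \<bullet> z}"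
    using general_position[OF Z(1), of "\<epsilon> / 8" f] \<epsilon> by auto
  have cont: "continuous_on Z y'" for y' :: "real^'n \<Rightarrow> real" using Z(1) by (rule continuous_on_finite)
  have cZ: "compact Z" using Z(1) by (rule finite_imp_compact)
  obtain k where k: "continuous_on UNIV k" "\<And>z. z \<in> Z \<Longrightarrow> k z = y z - f z" "\<And>x. \<bar>k x\<bar> \<le> \<epsilon> / 8"
    using Tietze[OF cont, of UNIV "\<epsilon> / 8" "\<lambda>z. y z - f z"] y(1) \<epsilon> cZ
    by (auto simp: compact_imp_closed)
  \<comment> \<open>\<open>f + k\<close> has the heights \<open>y\<close> on \<open>Z\<close>, the
    minimum brings it under the polyhedral envelope, and the last term opens the gap without
    changing values on \<open>Z\<close>.\<close>
  define f' where "f' x = min (f x + k x) (cenv Z y x) - (\<epsilon> / 4) * min 1 (infdist x Z)" for x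
  have "continuous_on unit_cube (cenv Z y)" using continuous_on_cenv_finite[OF Z(1)] hull by metis
  then have f'c: "continuous_on unit_cube f'"
    unfolding f'_def by (intro continuous_intros f continuous_on_subset[OF k(1)]) auto
  \<comment> \<open>The minimum costs little: \<open>x\<close> is a combination of vertices within
    \<rho>, all with heights at least \<open>f x - \<epsilon> / 4\<close>.\<close>
  have ge: "f x - \<epsilon> / 4 \<le> cenv Z y x" if x: "x \<in> unit_cube" for x
  proof -
    have "concave_on unit_cube (cenv Z y)" using concave_cenv[OF cZ cont] hull by simp
    then have "(f x - \<epsilon> / 4) + 0 \<bullet> x \<le> cenv Z y x"
    proof (rule concave_ge_affine_hull)
      show "Z \<inter> ball x \<rho> \<subseteq> unit_cube" using Z(2) by blast
      fix z assume z: "z \<in> Z \<inter> ball x \<rho>"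
      then have "\<bar>f x - f z\<bar> < \<epsilon> / 8" using \<rho>(2)[OF x, of z] Z(2) by auto
      moreover have "\<bar>y z - f z\<bar> \<le> \<epsilon> / 8" "y z \<le> cenv Z y z" using y(1) cenv_ge[OF cZ cont] z by auto
      ultimately show "(f x - \<epsilon> / 4) + 0 \<bullet> z \<le> cenv Z y z" unfolding inner_zero_left by linarith
    qed (use Z(3)[OF x] in simp)
    then show ?thesis by simp
  qed
  have close: "\<bar>f x - f' x\<bar> \<le> \<epsilon>" if x: "x \<in> unit_cube" for x
  proof -
    have "0 \<le> (\<epsilon> / 4) * min 1 (infdist x Z)" "(\<epsilon> / 4) * min 1 (infdist x Z) \<le> (\<epsilon> / 4) * 1"
      using \<epsilon> infdist_nonneg[of x Z] by (auto intro!: mult_left_mono mult_nonneg_nonneg)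
    moreover have "f x - \<epsilon> / 4 \<le> min (f x + k x) (cenv Z y x)" "min (f x + k x) (cenv Z y x) \<le> f x + \<epsilon> / 8"
      using ge[OF x] k(3)[of x] \<epsilon> by (auto simp: abs_le_iff min_def)
    ultimately show ?thesis using \<epsilon> unfolding f'_def by linarith
  qed
  interpret polyhedral_approximation Z y f' "\<epsilon> / 4"
  proof
    show "f' z = y z" if "z \<in> Z" for z
      using that k(2) cenv_ge[OF cZ cont that, of y] by (simp add: f'_def)
    show "f' x \<le> cenv Z y x - \<epsilon> / 4 * min 1 (infdist x Z)" for x by (simp add: f'_def)
  qed (use Z(1) hull y(2) \<epsilon> f'c in auto)
  obtain \<delta> where "\<delta> > 0" "\<And>h. continuous_on unit_cube h \<Longrightarrow> \<forall>x\<in>unit_cube. \<bar>f' x - h x\<bar> \<le> \<delta> \<Longrightarrow> almost_polyhedral n h"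
    using almost_polyhedral_near[of n] by metis
  then show "\<exists>f' \<delta>. continuous_on unit_cube f' \<and> (\<forall>x\<in>unit_cube. \<bar>f x - f' x\<bar> \<le> \<epsilon>) \<and> \<delta> > 0 \<and>
     (\<forall>f''. continuous_on unit_cube f'' \<longrightarrow> (\<forall>x\<in>unit_cube. \<bar>f' x - f'' x\<bar> \<le> \<delta>) \<longrightarrow> almost_polyhedral n f'')"
    using f'c close by (intro exI[of _ f'] exI[of _ \<delta>]) blast
qed

section \<open>Baire category\<close>

lemma robustly_dense_uminus:
  assumes "robustly_dense P"
  shows "robustly_dense (\<lambda>f. P (\<lambda>x. - f x))"
  unfolding robustly_dense_def
proof (intro allI impI)
  fix f :: "real^'a \<Rightarrow> real" and \<epsilon> :: real
  assume "continuous_on unit_cube f" and \<epsilon>: "\<epsilon> > 0"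
  then have "continuous_on unit_cube (\<lambda>x. - f x)" by (intro continuous_intros)
  from robustly_denseE[OF assms this \<epsilon>]
  obtain f' \<delta> where f': "continuous_on unit_cube f'" "\<And>x. x \<in> unit_cube \<Longrightarrow> \<bar>- f x - f' x\<bar> \<le> \<epsilon>" "\<delta> > 0"
    "\<And>f''. continuous_on unit_cube f'' \<Longrightarrow> (\<And>x. x \<in> unit_cube \<Longrightarrow> \<bar>f' x - f'' x\<bar> \<le> \<delta>) \<Longrightarrow> P f''"
    by metis
  show "\<exists>f' \<delta>. continuous_on unit_cube f' \<and> (\<forall>x\<in>unit_cube. \<bar>f x - f' x\<bar> \<le> \<epsilon>) \<and> \<delta> > 0 \<and>
     (\<forall>f''. continuous_on unit_cube f'' \<longrightarrow> (\<forall>x\<in>unit_cube. \<bar>f' x - f'' x\<bar> \<le> \<delta>) \<longrightarrow> P (\<lambda>x. - f'' x))"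
  proof (intro exI[of _ "\<lambda>x. - f' x"] exI[of _ \<delta>] conjI allI impI ballI)
    show "continuous_on unit_cube (\<lambda>x. - f' x)" using f'(1) by (intro continuous_intros)
    show "\<bar>f x - - f' x\<bar> \<le> \<epsilon>" if "x \<in> unit_cube" for x
    proof -
      have "\<bar>- f x - f' x\<bar> \<le> \<epsilon>" using f'(2)[OF that] .
      then show ?thesis by linarith
    qed
    fix h assume h: "continuous_on unit_cube h" "\<forall>x\<in>unit_cube. \<bar>- f' x - h x\<bar> \<le> \<delta>"
    show "P (\<lambda>x. - h x)"
    proof (rule f'(4))
      show "continuous_on unit_cube (\<lambda>x. - h x)" using h(1) by (intro continuous_intros)
      fix x :: "real^'a" assume "x \<in> unit_cube"
      then have "\<bar>- f' x - h x\<bar> \<le> \<delta>" using h(2) by blast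
      then show "\<bar>f' x - - h x\<bar> \<le> \<delta>" by linarith
    qed
  qed (rule f'(3))
qed

lemma mspace_C_cube:
  "mspace (C_cube :: (real^'n::finite \<Rightarrow> real) metric) = {f. f \<in> extensional unit_cube \<and> continuous_on unit_cube f}"
proof -
  have "compactin (top_of_set unit_cube) (topspace (top_of_set (unit_cube :: (real^'n) set)))"
    by (simp add: compactin_subtopology)
  from compactin_mspace_cfunspace[OF this, of "euclidean_metric :: real metric"] show ?thesis
    by (auto simp del: mspace_cfunspace)
qed

lemma mcomplete_C_cube: "mcomplete_of (C_cube :: (real^'n::finite \<Rightarrow> real) metric)"
  using Met_TC.mcomplete_cfunspace[of "top_of_set unit_cube"] complete_UNIV
  by (simp add: mcomplete_iff_complete euclidean_metric_def Met_TC.Self_def)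

text \<open>Baire category for the interiors of the sets of functions with \<open>P\<close>; robust
  density makes these open sets dense.\<close>

lemma robustly_dense_residual:
  fixes \<P> :: "((real^'n::finite \<Rightarrow> real) \<Rightarrow> bool) set"
  assumes count: "countable \<P>" and \<P>: "\<And>P. P \<in> \<P> \<Longrightarrow> robustly_dense P"
  obtains G where "gdelta_in C_cube_topology G" "C_cube_topology closure_of G = topspace C_cube_topology"
    "\<And>f P. f \<in> G \<Longrightarrow> P \<in> \<P> \<Longrightarrow> P f" "\<And>f. f \<in> G \<Longrightarrow> continuous_on unit_cube f"
proof -
  note [simp del] = mspace_cfunspace
  let ?M = "mspace (C_cube :: (real^'n \<Rightarrow> real) metric)"
  let ?d = "mdist (C_cube :: (real^'n \<Rightarrow> real) metric)"
  interpret M: Metric_space ?M ?d by (rule Metric_space_mspace_mdist)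
  have top: "C_cube_topology = M.mtopology" by (simp add: mtopology_of_def)
  define U where "U P = M.mtopology interior_of {f \<in> ?M. P f}" for P
  \<comment> \<open>The whole space is a member so that the intersection consists of functions of
    the space even when \<open>\<P>\<close> is empty.\<close>
  define \<G> where "\<G> = insert ?M (U ` \<P>)"
  have "openin M.mtopology T \<and> M.mtopology closure_of T = ?M" if TG: "T \<in> \<G>" for T
  proof (cases "T = ?M")
    case True
    then show ?thesis using closure_of_topspace[of M.mtopology] by simp
  next
    case False
    then obtain P where P: "P \<in> \<P>" "T = U P" using TG by (auto simp: \<G>_def)
    have "f \<in> M.mtopology closure_of U P" if f: "f \<in> ?M" for f
      unfolding M.metric_closure_of
    proof (intro CollectI conjI allI impI f)
      fix r :: real assume r: "r > 0"
      have "continuous_on unit_cube f" using f unfolding mspace_C_cube by blast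
      from robustly_denseE[OF \<P>[OF P(1)] this half_gt_zero[OF r]]
      obtain f' \<delta> where f': "continuous_on unit_cube f'" "\<And>x. x \<in> unit_cube \<Longrightarrow> \<bar>f x - f' x\<bar> \<le> r / 2" "\<delta> > 0"
        "\<And>f''. continuous_on unit_cube f'' \<Longrightarrow> (\<And>x. x \<in> unit_cube \<Longrightarrow> \<bar>f' x - f'' x\<bar> \<le> \<delta>) \<Longrightarrow> P f''"
        by metis
      \<comment> \<open>Members of the space are extensional, so \<open>f'\<close> is cut down to
        the cube.\<close>
      define F where "F = restrict f' unit_cube"
      have F: "F \<in> ?M" unfolding mspace_C_cube using f'(1) by (simp add: F_def cong: continuous_on_cong)
      have "?d f F \<le> r / 2"
        by (rule mdist_cfunspace_le) (use r f'(2) in \<open>auto simp: F_def dist_real_def\<close>)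
      then have "F \<in> M.mball f r" using f F r by simp
      moreover have "M.mball F \<delta> \<subseteq> {f \<in> ?M. P f}"
      proof
        fix h assume "h \<in> M.mball F \<delta>"
        then have h: "h \<in> ?M" "?d F h < \<delta>" by auto
        have "\<bar>f' x - h x\<bar> \<le> \<delta>" if "x \<in> unit_cube" for x
          using mdist_cfunspace_imp_mdist_le[OF F h(1) less_imp_le[OF h(2)], of x] that
          by (simp add: F_def dist_real_def)
        then have "P h" using f'(4) h(1) unfolding mspace_C_cube by blast
        then show "h \<in> {f \<in> ?M. P f}" using h(1) by blast
      qed
      then have "M.mball F \<delta> \<subseteq> U P" unfolding U_def by (intro interior_of_maximal M.openin_mball)
      then have "F \<in> U P" using F f'(3) by (meson M.centre_in_mball_iff subsetD)
      ultimately show "\<exists>y\<in>U P. y \<in> M.mball f r" by blast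
    qed
    moreover have "M.mtopology closure_of U P \<subseteq> ?M" using closure_of_subset_topspace[of M.mtopology] by simp
    ultimately show ?thesis using P(2) by (auto simp: U_def)
  qed
  note \<G> = this
  have c\<G>: "countable \<G>" using count by (simp add: \<G>_def)
  have "M.mcomplete" using mcomplete_C_cube by (simp add: mcomplete_of_def)
  then have "M.mtopology closure_of \<Inter>\<G> = ?M" using c\<G> \<G> by (rule M.metric_Baire_category)
  then have dense: "C_cube_topology closure_of \<Inter>\<G> = topspace C_cube_topology" by (simp add: top)
  have "gdelta_in C_cube_topology (\<Inter>\<G>)"
    by (rule gdelta_in_Inter[OF c\<G>]) (use \<G> in \<open>auto simp: \<G>_def top intro: open_imp_gdelta_in\<close>)
  then show ?thesis
  proof (rule that[OF _ dense])
    fix f assume f: "f \<in> \<Inter>\<G>"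
    then show "continuous_on unit_cube f" unfolding \<G>_def mspace_C_cube by blast
    fix P assume "P \<in> \<P>"
    then have "f \<in> U P" using f by (simp add: \<G>_def)
    moreover have "U P \<subseteq> {f \<in> ?M. P f}" unfolding U_def by (rule interior_of_subset)
    ultimately show "P f" by blast
  qed
qed

lemma generic_residual:
  obtains G :: "(real^'n::finite \<Rightarrow> real) set" where
    "gdelta_in C_cube_topology G" "C_cube_topology closure_of G = topspace C_cube_topology"
    "\<And>f. f \<in> G \<Longrightarrow> generic f \<and> generic (\<lambda>x. - f x)"
proof -
  define \<Q> where "\<Q> = (\<Union>n. {boundary_steep n, almost_smooth n, almost_polyhedral n :: (real^'n \<Rightarrow> real) \<Rightarrow> bool})"
  define \<P> where "\<P> = \<Q> \<union> (\<lambda>P f. P (\<lambda>x. - f x)) ` \<Q>"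
  have "robustly_dense P" if "P \<in> \<Q>" for P
    using that robustly_dense_boundary_steep robustly_dense_almost_smooth robustly_dense_almost_polyhedral
    unfolding \<Q>_def by blast
  then have rd: "robustly_dense P" if "P \<in> \<P>" for P
    using that robustly_dense_uminus unfolding \<P>_def by blast
  have "countable \<P>" unfolding \<P>_def \<Q>_def by (intro countable_Un countable_image countable_UN) auto
  then obtain G where G: "gdelta_in C_cube_topology G" "C_cube_topology closure_of G = topspace C_cube_topology"
    "\<And>f P. f \<in> G \<Longrightarrow> P \<in> \<P> \<Longrightarrow> P f" "\<And>f. f \<in> G \<Longrightarrow> continuous_on unit_cube f"
    using robustly_dense_residual[OF _ rd] by metis
  have \<Q>: "boundary_steep n \<in> \<Q>" "almost_smooth n \<in> \<Q>" "almost_polyhedral n \<in> \<Q>" for n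
    by (auto simp: \<Q>_def)
  have "P f \<and> P (\<lambda>x. - f x)" if "f \<in> G" "P \<in> \<Q>" for f P
    using G(3)[OF that(1), of P] G(3)[OF that(1), of "\<lambda>f. P (\<lambda>x. - f x)"] that(2) by (auto simp: \<P>_def)
  then have "generic f \<and> generic (\<lambda>x. - f x)" if "f \<in> G" for f
    using that \<Q> G(4)[OF that] continuous_on_minus[OF G(4)[OF that]] unfolding generic_def by blast
  then show ?thesis using that G(1,2) by blast
qed

section \<open>Transfer to the two envelopes\<close>

lemma envelope_hull_uminus:
  "(x, t) \<in> envelope_hull Z (\<lambda>z. - y z) \<longleftrightarrow> (x, - t) \<in> envelope_hull Z y"
proof -
  let ?L = "\<lambda>p::'a \<times> real. (fst p, - snd p)"
  have L: "linear ?L" by (auto intro!: linearI simp: algebra_simps)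
  have "?L ` envelope_hull Z y = envelope_hull Z (\<lambda>z. - y z)"
    unfolding envelope_hull_def convex_hull_linear_image[OF L] by (simp add: image_image)
  then have "(x, t) \<in> envelope_hull Z (\<lambda>z. - y z) \<longleftrightarrow> (x, t) \<in> ?L ` envelope_hull Z y" by simp
  also have "\<dots> \<longleftrightarrow> (x, - t) \<in> envelope_hull Z y" by (force simp: image_iff)
  finally show ?thesis .
qed

lemma envelope_1_eq:
  assumes "continuous_on unit_cube f" "x \<in> unit_cube"
  shows "envelope 1 f x = cenv unit_cube f x"
proof -
  have "(GREATEST y. (x, y) \<in> envelope_hull unit_cube f) = cenv unit_cube f x"
    by (rule Greatest_equality)
      (use cenv_mem[OF compact_cbox assms(1)] cenv_upper[OF compact_cbox assms(1)] assms(2) in auto)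
  then show ?thesis by (simp add: envelope_def graph_hull_def envelope_hull_def)
qed

lemma envelope_2_eq:
  assumes "continuous_on unit_cube f" "x \<in> unit_cube"
  shows "envelope 2 f x = - cenv unit_cube (\<lambda>x. - f x) x"
proof -
  have c: "continuous_on unit_cube (\<lambda>x. - f x)" using assms(1) by (intro continuous_intros)
  have "(LEAST y. (x, y) \<in> envelope_hull unit_cube f) = - cenv unit_cube (\<lambda>x. - f x) x"
  proof (rule Least_equality)
    show "(x, - cenv unit_cube (\<lambda>x. - f x) x) \<in> envelope_hull unit_cube f"
      using cenv_mem[OF compact_cbox c] assms(2) by (simp flip: envelope_hull_uminus)
    fix t assume "(x, t) \<in> envelope_hull unit_cube f"
    then have "(x, - t) \<in> envelope_hull unit_cube (\<lambda>x. - f x)" by (simp add: envelope_hull_uminus)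
    from cenv_upper[OF compact_cbox c this] show "- cenv unit_cube (\<lambda>x. - f x) x \<le> t" by simp
  qed
  then show ?thesis by (simp add: envelope_def graph_hull_def envelope_hull_def)
qed

text \<open>\<open>g\<close> is tied to \<open>h\<close> on the cube only, hence the assumption that
  the points of the quotient eventually lie there.\<close>

lemma has_one_sided_partial_scale:
  assumes g: "\<And>x. x \<in> unit_cube \<Longrightarrow> g x = s * h x" and s: "s \<in> {1, - 1}"
    and w: "w \<in> unit_cube" "\<forall>\<^sub>F t in F. w + t *\<^sub>R axis j 1 \<in> unit_cube"
    and h: "has_one_sided_partial h j F w L"
  shows "has_one_sided_partial g j F w (ereal s * L)"
proof -
  have "((\<lambda>t. ereal s * ereal ((h (w + t *\<^sub>R axis j 1) - h w) / t)) \<longlongrightarrow> ereal s * L) F"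
  proof (cases "s = 1")
    case True
    then show ?thesis using h by (simp add: has_one_sided_partial_def flip: one_ereal_def)
  next
    case False
    then have "ereal s * x = - x" for x using s by (cases x) auto
    then show ?thesis using h unfolding has_one_sided_partial_def by (simp only: tendsto_uminus_ereal)
  qed
  moreover have "\<forall>\<^sub>F t in F. ereal s * ereal ((h (w + t *\<^sub>R axis j 1) - h w) / t) = ereal ((g (w + t *\<^sub>R axis j 1) - g w) / t)"
    using w(2) by (rule eventually_mono) (simp add: g w(1) right_diff_distrib)
  ultimately show ?thesis
    unfolding has_one_sided_partial_def by (rule Lim_transform_eventually)
qed

lemma continuously_differentiable_on_scale:
  fixes h :: "real^'n::finite \<Rightarrow> real"
  assumes g: "\<And>x. x \<in> S \<Longrightarrow> g x = s * h x" and S: "open S" and h: "continuously_differentiable_on h S"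
  shows "continuously_differentiable_on g S"
proof -
  obtain h' where h': "\<And>x. x \<in> S \<Longrightarrow> (h has_derivative blinfun_apply (h' x)) (at x)" "continuous_on S h'"
    using h unfolding continuously_differentiable_on_def by blast
  have "(g has_derivative blinfun_apply (s *\<^sub>R h' x)) (at x)" if x: "x \<in> S" for x
  proof -
    have "((\<lambda>x. s * h x) has_derivative (\<lambda>v. s * h' x v)) (at x)"
      using h'(1)[OF x] by (auto intro!: derivative_eq_intros)
    then have "(g has_derivative (\<lambda>v. s * h' x v)) (at x)"
      by (rule has_derivative_transform_within_open[OF _ S x]) (simp add: g)
    then show ?thesis by (simp add: scaleR_blinfun.rep_eq)
  qed
  moreover have "continuous_on S (\<lambda>x. s *\<^sub>R h' x)" using h'(2) by (intro continuous_intros)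
  ultimately show ?thesis
    unfolding continuously_differentiable_on_def by (intro exI[of _ "\<lambda>x. s *\<^sub>R h' x"]) simp
qed

text \<open>The sign \<open>s\<close> treats both envelopes at once: Hoelder exponents ignore it,
  one-sided derivatives are multiplied by it.\<close>

lemma generic_envelope_properties:
  fixes h g :: "real^'n::finite \<Rightarrow> real"
  assumes gen: "generic h" and s: "s \<in> {1, - 1}" and env: "\<forall>x\<in>unit_cube. g x = s * cenv unit_cube h x"
  shows "continuously_differentiable_on g open_unit_cube"
    and "x \<in> frontier unit_cube \<Longrightarrow> hoelder_exponent g x = 0"
    and "singularity_spectrum g 0 = ereal (real CARD('n) - 1)"
    and "iso_hoelder_set g 0 \<inter> open_unit_cube = {}"
    and "singularity_spectrum g 1 = ereal (real CARD('n) - 1)"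
    and "singularity_spectrum g \<infinity> = ereal (real CARD('n))"
    and "0 < H \<Longrightarrow> H < \<infinity> \<Longrightarrow> H \<noteq> 1 \<Longrightarrow> iso_hoelder_set g H = {}"
    and "w \<in> cube_face 0 j \<Longrightarrow> has_one_sided_partial g j (at_right 0) w (ereal s * \<infinity>)"
    and "w \<in> cube_face 1 j \<Longrightarrow> has_one_sided_partial g j (at_left 0) w (ereal s * - \<infinity>)"
proof -
  let ?\<phi> = "cenv unit_cube h"
  note g = bspec[OF env]
  have sub: "open_unit_cube \<subseteq> (unit_cube :: (real^'n) set)" by (rule box_subset_cbox)
  show "continuously_differentiable_on g open_unit_cube"
    by (rule continuously_differentiable_on_scale[OF g _ generic_continuously_differentiable[OF gen]]) (use sub in auto)
  have exp: "hoelder_exponent g x = hoelder_exponent ?\<phi> x" for x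
  proof -
    have "hoelder_exponent g x = hoelder_exponent (\<lambda>x. s * ?\<phi> x) x" by (rule hoelder_exponent_cong) (rule g)
    also have "\<dots> = hoelder_exponent ?\<phi> x" using s hoelder_exponent_uminus[of ?\<phi> x] by auto
    finally show ?thesis .
  qed
  show front: "hoelder_exponent g x = 0" if "x \<in> frontier unit_cube" for x
    unfolding exp by (rule generic_hoelder_frontier[OF gen that])
  have inter: "hoelder_exponent g x = (if locally_affine ?\<phi> x then \<infinity> else 1)" if "x \<in> open_unit_cube" for x
    unfolding exp by (rule generic_hoelder_interior[OF gen that])
  have split: "x \<in> unit_cube \<longleftrightarrow> x \<in> frontier unit_cube \<or> x \<in> open_unit_cube"
    "x \<in> frontier unit_cube \<Longrightarrow> x \<notin> open_unit_cube" for x :: "real^'n"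
    using sub by (auto simp: frontier_cbox)
  have iso0: "iso_hoelder_set g 0 = frontier unit_cube"
    unfolding iso_hoelder_set_def using split front inter by (auto split: if_splits)
  have iso1: "iso_hoelder_set g 1 = {x \<in> open_unit_cube. \<not> locally_affine ?\<phi> x}"
    unfolding iso_hoelder_set_def using split front inter by (auto split: if_splits)
  have isoinf: "iso_hoelder_set g \<infinity> = {x \<in> open_unit_cube. locally_affine ?\<phi> x}"
    unfolding iso_hoelder_set_def using split front inter by (auto split: if_splits)
  show "singularity_spectrum g 0 = ereal (real CARD('n) - 1)"
    unfolding singularity_spectrum_def iso0 by (rule frontier_cube_dim)
  show "iso_hoelder_set g 0 \<inter> open_unit_cube = {}" unfolding iso0 using split by blast
  show "singularity_spectrum g 1 = ereal (real CARD('n) - 1)"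
    unfolding singularity_spectrum_def iso1 by (rule generic_bend_dim[OF gen])
  show "singularity_spectrum g \<infinity> = ereal (real CARD('n))"
    unfolding singularity_spectrum_def isoinf by (rule generic_affine_dim[OF gen])
  show "iso_hoelder_set g H = {}" if "0 < H" "H < \<infinity>" "H \<noteq> 1"
    unfolding iso_hoelder_set_def using that split front inter by (auto split: if_splits)
  show "has_one_sided_partial g j (at_right 0) w (ereal s * \<infinity>)" if w: "w \<in> cube_face 0 j"
  proof (rule has_one_sided_partial_scale[OF g s _ _ generic_partial_face_0[OF gen w]])
    show wQ: "w \<in> unit_cube" using w by (simp add: cube_face_def)
    have "w + t *\<^sub>R axis j 1 \<in> unit_cube" if "0 < t" "t < 1" for t
      using face_inward_mem[of 0 1 w j t] w that by (simp add: cube_face_def)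
    then show "\<forall>\<^sub>F t in at_right 0. w + t *\<^sub>R axis j 1 \<in> unit_cube"
      unfolding eventually_at_right_field by (intro exI[of _ 1]) auto
  qed
  show "has_one_sided_partial g j (at_left 0) w (ereal s * - \<infinity>)" if w: "w \<in> cube_face 1 j"
  proof (rule has_one_sided_partial_scale[OF g s _ _ generic_partial_face_1[OF gen w]])
    show wQ: "w \<in> unit_cube" using w by (simp add: cube_face_def)
    have "w + t *\<^sub>R axis j 1 \<in> unit_cube" if "- 1 < t" "t < 0" for t
      using face_inward_mem[of 1 "-1" w j "-t"] w that by (simp add: cube_face_def)
    then show "\<forall>\<^sub>F t in at_left 0. w + t *\<^sub>R axis j 1 \<in> unit_cube"
      unfolding eventually_at_left_field by (intro exI[of _ "-1"]) auto
  qed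
qed

theorem theorem3:
  shows "\<exists>G :: (real ^ 'n::finite \<Rightarrow> real) set.
    gdelta_in C_cube_topology G \<and>
    C_cube_topology closure_of G = topspace C_cube_topology \<and>
    (\<forall>f\<in>G. \<forall>i\<in>{1, 2}.
       continuously_differentiable_on (envelope i f) open_unit_cube \<and>
       (\<forall>x\<in>frontier unit_cube. hoelder_exponent (envelope i f) x = 0) \<and>
       singularity_spectrum (envelope i f) 0 = ereal (real CARD('n) - 1) \<and>
       iso_hoelder_set (envelope i f) 0 \<inter> open_unit_cube = {} \<and>
       singularity_spectrum (envelope i f) 1 = ereal (real CARD('n) - 1) \<and>
       singularity_spectrum (envelope i f) \<infinity> = ereal (real CARD('n)) \<and>
       (\<forall>h::ereal. 0 < h \<and> h < \<infinity> \<and> h \<noteq> 1 \<longrightarrow>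
          singularity_spectrum (envelope i f) h = -\<infinity> \<and>
          iso_hoelder_set (envelope i f) h = {}) \<and>
       (\<forall>j.
          (\<forall>x\<in>cube_face 0 j.
             has_one_sided_partial (envelope i f) j (at_right 0) x ((-1) ^ (i + 1) * \<infinity>)) \<and>
          (\<forall>x\<in>cube_face 1 j.
             has_one_sided_partial (envelope i f) j (at_left 0) x ((-1) ^ i * \<infinity>))) \<and>
       hausdorff_dim (contact_set i f) = 0)"
proof -
  obtain G :: "(real ^ 'n \<Rightarrow> real) set" where G: "gdelta_in C_cube_topology G"
    "C_cube_topology closure_of G = topspace C_cube_topology"
    "\<And>f. f \<in> G \<Longrightarrow> generic f \<and> generic (\<lambda>x. - f x)"
    using generic_residual by metis
  show ?thesis
  proof (rule exI[of _ G], rule conjI[OF G(1) conjI[OF G(2)]], intro ballI conjI allI impI)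
    fix f :: "real ^ 'n \<Rightarrow> real" and i :: nat
    assume f: "f \<in> G" and i: "i \<in> {1, 2}"
    have gen: "generic f" "generic (\<lambda>x. - f x)" using G(3)[OF f] by auto
    have cont: "continuous_on unit_cube f" using gen(1) by (rule generic_continuous)
    \<comment> \<open>\<open>ereal s\<close> equals \<open>(- 1) ^ (i + 1)\<close>; for
      \<open>i = 2\<close> the generic function is \<open>- f\<close>.\<close>
    define s where "s = (if i = 1 then 1 else - 1 :: real)"
    define h where "h x = s * f x" for x
    have s: "s \<in> {1, - 1}" by (simp add: s_def)
    have h: "generic h"
    proof (cases "i = 1")
      case True
      then have "h = f" by (simp add: h_def s_def fun_eq_iff)
      then show ?thesis using gen by simp
    next
      case False
      then have "h = (\<lambda>x. - f x)" by (simp add: h_def s_def fun_eq_iff)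
      then show ?thesis using gen by simp
    qed
    have env: "\<forall>x\<in>unit_cube. envelope i f x = s * cenv unit_cube h x"
      using i envelope_1_eq[OF cont] envelope_2_eq[OF cont] unfolding h_def s_def by auto
    have sg: "ereal s * \<infinity> = (- 1) ^ (i + 1) * \<infinity>" "ereal s * - \<infinity> = (- 1) ^ i * \<infinity>"
      using i by (auto simp: s_def)
    have "contact_set i f = {x \<in> unit_cube. cenv unit_cube h x = h x}"
      unfolding contact_set_def using env s by (auto simp: h_def)
    then have con: "hausdorff_dim (contact_set i f) = 0" using generic_contact_dim[OF h] by simp
    note C = generic_envelope_properties[OF h s env]
    have emp: "iso_hoelder_set (envelope i f) H = {} \<and> singularity_spectrum (envelope i f) H = - \<infinity>"
      if "0 < H" "H < \<infinity>" "H \<noteq> 1" for H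
      using C(7)[OF that] by (simp add: singularity_spectrum_def hausdorff_dim_def)
    show "continuously_differentiable_on (envelope i f) open_unit_cube"
      "singularity_spectrum (envelope i f) 0 = ereal (real CARD('n) - 1)"
      "iso_hoelder_set (envelope i f) 0 \<inter> open_unit_cube = {}"
      "singularity_spectrum (envelope i f) 1 = ereal (real CARD('n) - 1)"
      "singularity_spectrum (envelope i f) \<infinity> = ereal (real CARD('n))"
      by (rule C)+
    show "hausdorff_dim (contact_set i f) = 0" by (rule con)
    show "hoelder_exponent (envelope i f) x = 0" if "x \<in> frontier unit_cube" for x
      by (rule C(2)[OF that])
    show "singularity_spectrum (envelope i f) H = - \<infinity>" "iso_hoelder_set (envelope i f) H = {}"
      if "0 < H \<and> H < \<infinity> \<and> H \<noteq> 1" for H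
      using emp[of H] that by blast+
    show "has_one_sided_partial (envelope i f) j (at_right 0) x ((- 1) ^ (i + 1) * \<infinity>)"
      if "x \<in> cube_face 0 j" for j x
      using C(8)[OF that] unfolding sg .
    show "has_one_sided_partial (envelope i f) j (at_left 0) x ((- 1) ^ i * \<infinity>)"
      if "x \<in> cube_face 1 j" for j x
      using C(9)[OF that] unfolding sg .
  qed
qed

end
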